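(* Let $S^1=\{z\in\mathbb{C}:|z|=1\}$, let $\widehat{\mathcal{T}}=(\mathbb{Z}^+)^{\infty}$ be the set of all infinite sequences $\mathbf{k}=(k_1,k_2,\ldots)$ of positive integers, let \[ \widetilde{\mathcal{ST}}=\{(z,\mathbf{k})\in S^1\times\widehat{\mathcal{T}}: \text{ if } z=1,\text{ then } k_1\ge 2 \text{ and } \mathbf{k}\ne(2,1,1,\ldots)\}, \] and let $\mathcal{H}=\{w\in\mathbb{C}:\mathrm{Re}\,w\ge\frac12\}$. Then the map \[ \eta_{\mathcal{S}}:\widetilde{\mathcal{ST}}\to\mathcal{H}\setminus\{1\},\qquad (z,\mathbf{k})\mapsto\widetilde{\mathrm{Li}}^{\star}_{\mathbf{k}}(z) \] is well defined and bijective. Moreover, put $\beta(\mathbf{k})=\frac{1}{2^{k_1}}+\frac{1}{2^{k_1+k_2}}+\cdots+\frac{1}{2^{k_1+\cdots+k_r}}+\cdots$. Equip $\widehat{\mathcal{T}}$ with the topology transported from $(0,1]$ by the bijection $\beta:\widehat{\mathcal{T}}\to(0,1]$, and equip $\widetilde{\mathcal{ST}}$ with the corresponding subspace topology of $S^1\times\widehat{\mathcal{T}}$. Then $\tau_{\mathcal{S}}(z,\mathbf{k})=z\beta(\mathbf{k})$ identifies $\widetilde{\mathcal{ST}}$ (i.e. is a homeomorphism) with \[ \overline{\mathcal{U}}\setminus\big(\{0\}\cup[1/2,1]\big),\qquad \overline{\mathcal{U}}=\{u\in\mathbb{C}:|u|\le1\}, \] and $\eta_{\mathcal{S}}\circ\tau_{\mathcal{S}}^{-1}$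 is a homeomorphism from $\overline{\mathcal{U}}\setminus(\{0\}\cup[1/2,1])$ onto $\mathcal{H}\setminus\{1\}$.
   Context: For positive integers $k_1,\ldots,k_r$ and $|z|<1$, put $\widetilde{\mathrm{Li}}^{\star}_{k_1,\ldots,k_r}(z)=\sum_{n_1\geq\cdots\geq n_r\geq 1}\frac{z^{n_1-1}}{n_1^{k_1}\cdots n_r^{k_r}}$; this function extends holomorphically to $\mathbb{C}\setminus[1,+\infty)$, and the same symbol denotes the extension. (On $|z|=1$, $z\ne1$, the extension agrees with the sum of the series taken by partial sums with respect to the outer variable $n_1$.) For an infinite index $\mathbf{k}=(k_1,k_2,\ldots)$ and $z$ with $\mathrm{Re}\,z<1$ (in particular $z\in S^1\setminus\{1\}$), $\widetilde{\mathrm{Li}}^{\star}_{\mathbf{k}}(z)=\lim_{r\to+\infty}\widetilde{\mathrm{Li}}^{\star}_{k_1,\ldots,k_r}(z)$; this limit exists locally uniformly on $\{\mathrm{Re}\,z<1\}$. For $z=1$ and $\mathbf{k}$ with $k_1\ge2$, $\mathbf{k}\neq(2,1,1,\ldots)$, $\widetilde{\mathrm{Li}}^{\star}_{\mathbf{k}}(1)=\lim_{r\to+\infty}\zeta^{\star}(k_1,\ldots,k_r)$, where $\zeta^{\star}(k_1,\ldots,k_r)=\sum_{n_1\ge\cdots\ge n_r\ge1}\frac{1}{n_1^{k_1}\cdots n_r^{k_r}}$; this limit exists and is finite. The map $\beta:\widehat{\mathcal{T}}\to(0,1]$ is a bijection (unique binary expansion with infinitely many digits $1$). *)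

theory Defs
  imports "HOL-Complex_Analysis.Complex_Analysis"
begin

text \<open>
  A finite index \<open>(k\<^sub>1, \<dots>, k\<^sub>r)\<close> is a list, an infinite index \<open>(k\<^sub>1, k\<^sub>2, \<dots>)\<close> is a function
  \<open>k :: nat \<Rightarrow> nat\<close> with \<open>k\<^sub>i = k (i - 1)\<close>.
\<close>

definition star_indices :: "nat \<Rightarrow> nat list set" where
  "star_indices r = {ns. length ns = r \<and> sorted_wrt (\<ge>) ns \<and> (\<forall>n\<in>set ns. 1 \<le> n)}"

definition star_denom :: "nat list \<Rightarrow> nat list \<Rightarrow> nat" where
  "star_denom ks ns = (\<Prod>i<length ks. (ns ! i) ^ (ks ! i))"

definition slit_plane :: "complex set" where
  "slit_plane = - complex_of_real ` {1..}"

definition is_Li_star :: "nat list \<Rightarrow> (complex \<Rightarrow> complex) \<Rightarrow> bool" where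
  "is_Li_star ks f \<longleftrightarrow>
     f holomorphic_on slit_plane \<and>
     (\<forall>z\<in>ball 0 1.
        ((\<lambda>ns. z ^ (hd ns - 1) / of_nat (star_denom ks ns)) has_sum f z)
          (star_indices (length ks)))"

text \<open>
  By the identity theorem the choice below is unique on \<^const>\<open>slit_plane\<close>; values on the cut
  \<open>[1, \<infinity>)\<close> are arbitrary and never used.
\<close>

definition Li_star :: "nat list \<Rightarrow> complex \<Rightarrow> complex" where
  "Li_star ks = (SOME f. is_Li_star ks f)"

definition zeta_star :: "nat list \<Rightarrow> real" where
  "zeta_star ks = (\<Sum>\<^sub>\<infinity>ns\<in>star_indices (length ks). 1 / real (star_denom ks ns))"

definition That :: "(nat \<Rightarrow> nat) set" where
  "That = {k. \<forall>i. 1 \<le> k i}"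

definition index_prefix :: "(nat \<Rightarrow> nat) \<Rightarrow> nat \<Rightarrow> nat list" where
  "index_prefix k r = map k [0..<r]"

text \<open>The limits run over \<open>Suc r\<close> only to avoid the meaningless empty index.\<close>

definition eta_S :: "complex \<times> (nat \<Rightarrow> nat) \<Rightarrow> complex" where
  "eta_S = (\<lambda>(z, k).
     if z = 1 then of_real (lim (\<lambda>r. zeta_star (index_prefix k (Suc r))))
     else lim (\<lambda>r. Li_star (index_prefix k (Suc r)) z))"

text \<open>
  All extensions, sums and limits that enter \<^const>\<open>eta_S\<close> at \<open>(z, k)\<close> exist, so that no default
  value of \<^const>\<open>Eps\<close>, \<^const>\<open>infsum\<close> or \<^const>\<open>lim\<close> is involved.
\<close>

definition eta_S_defined :: "complex \<times> (nat \<Rightarrow> nat) \<Rightarrow> bool" where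
  "eta_S_defined = (\<lambda>(z, k).
     if z = 1 then
       (\<forall>r. (\<lambda>ns. 1 / real (star_denom (index_prefix k (Suc r)) ns))
              summable_on star_indices (Suc r)) \<and>
       convergent (\<lambda>r. zeta_star (index_prefix k (Suc r)))
     else
       (\<forall>r. \<exists>f. is_Li_star (index_prefix k (Suc r)) f) \<and>
       convergent (\<lambda>r. Li_star (index_prefix k (Suc r)) z))"

definition ST :: "(complex \<times> (nat \<Rightarrow> nat)) set" where
  "ST = {(z, k). z \<in> sphere 0 1 \<and> k \<in> That \<and>
           (z = 1 \<longrightarrow> 2 \<le> k 0 \<and> k \<noteq> (\<lambda>i. if i = 0 then 2 else 1))}"

definition Hplane :: "complex set" where
  "Hplane = {w. 1 / 2 \<le> Re w}"

definition beta :: "(nat \<Rightarrow> nat) \<Rightarrow> real" where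
  "beta k = (\<Sum>r. 1 / 2 ^ (\<Sum>i\<le>r. k i))"

definition tau_S :: "complex \<times> (nat \<Rightarrow> nat) \<Rightarrow> complex" where
  "tau_S = (\<lambda>(z, k). z * of_real (beta k))"

text \<open>
  Since \<^const>\<open>beta\<close> is a bijection from \<^const>\<open>That\<close> onto \<open>(0, 1]\<close>, pulling the topology of
  \<open>(0, 1]\<close> back along it is the same as transporting it.
\<close>

definition That_topology :: "(nat \<Rightarrow> nat) topology" where
  "That_topology = pullback_topology That beta (top_of_set {0<..1})"

definition ST_topology :: "(complex \<times> (nat \<Rightarrow> nat)) topology" where
  "ST_topology = subtopology (prod_topology (top_of_set (sphere 0 1)) That_topology) ST"

definition cut_disc :: "complex set" where
  "cut_disc = cball 0 1 - ({0} \<union> complex_of_real ` {1/2..1})"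

end

(*
  Write Li for the extended function of an infinite index k.  The binary digits of beta k drive a
  random walk on [0,1]: the digit 0 replaces t by a uniform point of [0,t], the digit 1 by a uniform
  point of [t,1].  Applying the digits from the last to the first gives a random point X in [0,1]
  with expectation functional E k, and Li(z) = E k (1 / (1 - X z)); the mean of X is beta k.

  Order.  If k and k' have beta k < beta k', their laws are ordered by likelihood ratio.  In complex
  form: if u : [0,1] -> C turns counterclockwise, then E k' u lies to the left of E k u.

  Injectivity on the upper semicircle.  Let beta k < beta k' and suppose that Li_k(e^{ia}) =
  Li_k'(e^{ib}) = w.  If a <= b, the order property at e^{ib} with u(t) = t/(1-tz), together with the
  starlikeness of Li_k with respect to 1, contradicts the equality of arguments of w - 1.
  If a > b, one uses instead the pencil of lines through 1/(1-z) at z = e^{ib}: an explicit identity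
  shows that the chord of Li_k from e^{ib} to e^{ia} turns to the left of that pencil, while the order
  property puts w on its right.  Starlikeness is inherited from the tail of k by the order
  property for a leading digit 1, and by a Jack type argument for a leading digit 0.

  Topology.  The map on the slit disc is continuous and proper: near the slit it dominates partial
  sums of the harmonic series, near 0 it tends to 1.  Invariance of domain then gives surjectivity,
  and properness the continuity of the inverse.
*)
theory Submission
  imports Defs
begin

section \<open>Positive unital functionals and averages over intervals\<close>

text \<open>Why the walk computes star sums: averaging over [0,s] sends t^n to s^n/(n+1), and
  averaging over [s,1] sends it to (1 + s + ... + s^n)/(n+1). The block of one entry therefore
  performs exactly one nested summation, with n+1 as summation variable, and the n-th moment of the
  functional is the coefficient of z^n. Integrating the kernel 1/(1-tz) instead of summing the
  series gives a formula on the whole slit plane, where estimates can be made pointwise in t. No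
  measure is constructed: the laws appear as positive unital functionals on continuous functions on
  [0,1], and every comparison integrates a pointwise inequality in one or two variables. The
  obstacle is z = 1, where the kernel is unbounded. There the value is the sum of the moments, and
  continuity across the positive axis requires a summable majorant that serves all indices with beta
  up to a bound below 1/2. The order property supplies it, because moments increase with beta: it
  suffices to know explicit indices whose beta lies arbitrarily close below 1/2.\<close>

abbreviation cont01 :: "(real \<Rightarrow> 'a :: topological_space) \<Rightarrow> bool" where
  "cont01 \<equiv> continuous_on {0..1}"

locale state =
  fixes L :: "(real \<Rightarrow> complex) \<Rightarrow> complex"
  assumes add: "\<lbrakk>cont01 f; cont01 g\<rbrakk> \<Longrightarrow> L (\<lambda>t. f t + g t) = L f + L g"
    and scale: "cont01 f \<Longrightarrow> L (\<lambda>t. c * f t) = c * L f"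
    and unit: "L (\<lambda>t. 1) = 1"
    and pos: "\<lbrakk>cont01 f; \<And>t. t \<in> {0..1} \<Longrightarrow> 0 \<le> Re (f t)\<rbrakk> \<Longrightarrow> 0 \<le> Re (L f)"
begin

lemma const: "L (\<lambda>t. c) = c"
  using scale[of "\<lambda>t. 1" c] unit by simp

lemma scale': "cont01 f \<Longrightarrow> L (\<lambda>t. f t * c) = L f * c"
  using scale[of f c] by (simp add: mult.commute)

lemma minus: "cont01 f \<Longrightarrow> L (\<lambda>t. - f t) = - L f"
  using scale[of f "-1"] by simp

lemma diff:
  assumes "cont01 f" "cont01 g"
  shows "L (\<lambda>t. f t - g t) = L f - L g"
  using add[of f "\<lambda>t. - g t"] minus[of g] assms by (simp add: continuous_intros)

lemma sum:
  assumes "finite A" "\<And>i. i \<in> A \<Longrightarrow> cont01 (f i)"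
  shows "L (\<lambda>t. \<Sum>i\<in>A. f i t) = (\<Sum>i\<in>A. L (f i))"
  using assms by (induction A rule: finite_induct) (auto simp: const add continuous_on_sum)

lemma mono:
  assumes "cont01 f" "cont01 g"
    and "\<And>t. t \<in> {0..1} \<Longrightarrow> Re (f t) \<le> Re (g t)"
  shows "Re (L f) \<le> Re (L g)"
  using pos[of "\<lambda>t. g t - f t"] assms by (simp add: diff continuous_intros)

text \<open>A unimodular factor turns \<open>L f\<close> onto the nonnegative real axis, where the
  modulus is a real part and \<open>mono\<close> applies.\<close>

lemma norm_le:
  assumes "cont01 f" "cont01 g"
    and "\<And>t. t \<in> {0..1} \<Longrightarrow> norm (f t) \<le> Re (g t)"
  shows "norm (L f) \<le> Re (L g)"
proof (cases "L f = 0")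
  case True
  have "0 \<le> Re (g t)" if "t \<in> {0..1}" for t
    using assms(3)[OF that] norm_ge_zero order_trans by blast
  then show ?thesis
    using True pos[OF assms(2)] by simp
next
  case False
  define c where "c = cnj (sgn (L f))"
  have c1: "norm c = 1" using False by (simp add: c_def norm_sgn)
  have cL: "c * L f = of_real (norm (L f))"
  proof -
    have "L f = of_real (norm (L f)) * sgn (L f)"
      using False by (simp add: sgn_eq)
    moreover have "cnj (sgn (L f)) * sgn (L f) = 1"
      using complex_norm_square[of "sgn (L f)"] False by (simp add: norm_sgn mult.commute)
    ultimately show ?thesis
      by (metis c_def mult.commute mult.left_commute mult.right_neutral)
  qed
  have "Re (L (\<lambda>t. c * f t)) \<le> Re (L g)"
  proof (rule mono)
    fix t :: real assume t: "t \<in> {0..1}"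
    have "Re (c * f t) \<le> norm (c * f t)" by (rule complex_Re_le_cmod)
    also have "\<dots> \<le> Re (g t)" using assms(3)[OF t] c1 by (simp add: norm_mult)
    finally show "Re (c * f t) \<le> Re (g t)" .
  qed (use assms in \<open>auto intro!: continuous_intros\<close>)
  then show ?thesis using scale[OF assms(1)] cL by simp
qed

lemma norm_bound:
  assumes "cont01 f" "\<And>t. t \<in> {0..1} \<Longrightarrow> norm (f t) \<le> C"
  shows "norm (L f) \<le> C"
  using norm_le[of f "\<lambda>t. of_real C"] assms by (simp add: const)

text \<open>Functions live on all of the reals, but positivity is tested on [0,1] only, so the
  functional sees nothing outside that interval.\<close>

lemma cong:
  assumes "cont01 f" "\<And>t. t \<in> {0..1} \<Longrightarrow> f t = g t"
  shows "L f = L g"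
proof -
  have g: "cont01 g"
    using assms continuous_on_cong by metis
  have "norm (L (\<lambda>t. f t - g t)) \<le> 0"
    by (rule norm_bound) (use assms g in \<open>auto intro!: continuous_intros\<close>)
  then show ?thesis using diff[OF assms(1) g] by simp
qed

lemma Re_bounds:
  assumes "cont01 f" "\<And>t. t \<in> {0..1} \<Longrightarrow> Re (f t) \<ge> c"
  shows "Re (L f) \<ge> c"
  using mono[of "\<lambda>t. of_real c" f] assms by (simp add: const)

lemma real:
  assumes "cont01 f" "\<And>t. t \<in> {0..1} \<Longrightarrow> Im (f t) = 0"
  shows "Im (L f) = 0"
proof -
  have "0 \<le> Re (L (\<lambda>t. \<i> * f t))" "0 \<le> Re (L (\<lambda>t. - \<i> * f t))"
    using assms by (auto intro!: pos continuous_intros)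
  then show ?thesis
    using scale[OF assms(1), of \<i>] scale[OF assms(1), of "-\<i>"] by simp
qed

lemma cnj:
  assumes "cont01 f"
  shows "L (\<lambda>t. cnj (f t)) = cnj (L f)"
proof -
  have c: "cont01 (\<lambda>t. complex_of_real (Re (f t)))"
      "cont01 (\<lambda>t. complex_of_real (Im (f t)))"
    using assms by (auto intro!: continuous_intros)
  define a b where "a = L (\<lambda>t. of_real (Re (f t)))" and "b = L (\<lambda>t. of_real (Im (f t)))"
  have ab: "Im a = 0" "Im b = 0" unfolding a_def b_def using c by (auto intro!: real)
  have "L f = L (\<lambda>t. of_real (Re (f t)) + \<i> * of_real (Im (f t)))"
    by (rule cong[OF assms]) (auto simp: complex_eq_iff)
  also have "\<dots> = a + \<i> * b"
    using c by (simp add: add scale a_def b_def continuous_intros)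
  finally have 1: "L f = a + \<i> * b" .
  have "L (\<lambda>t. cnj (f t)) = L (\<lambda>t. of_real (Re (f t)) - \<i> * of_real (Im (f t)))"
    by (rule cong) (auto simp: complex_eq_iff intro!: continuous_intros assms)
  also have "\<dots> = a - \<i> * b"
    using c by (simp add: diff scale a_def b_def continuous_intros)
  finally show ?thesis using 1 ab by (simp add: complex_eq_iff)
qed

lemma strict_pos:
  assumes "cont01 f" "\<And>t. t \<in> {0..1} \<Longrightarrow> 0 < Re (f t)"
  shows "0 < Re (L f)"
proof -
  have "\<exists>x\<in>{0..1::real}. \<forall>y\<in>{0..1}. Re (f x) \<le> Re (f y)"
    using assms by (intro continuous_attains_inf) (auto intro!: continuous_intros)
  then obtain x where "x \<in> {0..1}" "\<And>y. y \<in> {0..1} \<Longrightarrow> Re (f x) \<le> Re (f y)" by blast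
  then show ?thesis using Re_bounds[OF assms(1), of "Re (f x)"] assms(2)[of x] by simp
qed

text \<open>Integrating the symmetrised integrand twice gives twice the product of the two values.\<close>

lemma pair_pos:
  assumes g: "cont01 g" and h: "cont01 h"
    and "\<And>t s. \<lbrakk>t \<in> {0..1}; s \<in> {0..1}\<rbrakk> \<Longrightarrow> 0 \<le> Re (g t * cnj (h s) + g s * cnj (h t))"
  shows "0 \<le> Re (L g * cnj (L h))"
proof -
  have 1: "0 \<le> Re (g t * cnj (L h) + L g * cnj (h t))" if t: "t \<in> {0..1}" for t
  proof -
    have "0 \<le> Re (L (\<lambda>s. g t * cnj (h s) + g s * cnj (h t)))"
      using assms t by (auto intro!: pos continuous_intros)
    then show ?thesis
      using g h by (simp add: add scale scale' cnj continuous_intros)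
  qed
  have "0 \<le> Re (L (\<lambda>t. g t * cnj (L h) + L g * cnj (h t)))"
    using g h 1 by (intro pos) (auto intro!: continuous_intros)
  then show ?thesis
    using g h by (simp add: add scale scale' cnj continuous_intros)
qed

end

section \<open>Interval averages and the two digit operators\<close>

text \<open>Reparametrised over [0,1] rather than normalised by \<open>b - a\<close>, so that a
  degenerate interval gives evaluation at the point and no case distinction is needed for continuity
  in the endpoints.\<close>

definition avg :: "real \<Rightarrow> real \<Rightarrow> (real \<Rightarrow> complex) \<Rightarrow> complex" where
  "avg a b f = integral {0..1} (\<lambda>u. f (a + u * (b - a)))"

lemma avg_mem:
  fixes a b u :: real
  assumes "0 \<le> a" "a \<le> b" "b \<le> 1" "u \<in> {0..1}"
  shows "a + u * (b - a) \<in> {a..b}" "a + u * (b - a) \<in> {0..1}"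
proof -
  have "u * (b - a) \<le> 1 * (b - a)" "0 \<le> u * (b - a)"
    by (rule mult_right_mono mult_nonneg_nonneg; use assms in simp)+
  then show "a + u * (b - a) \<in> {a..b}" "a + u * (b - a) \<in> {0..1}"
    using assms by auto
qed

lemma avg_cont:
  fixes f :: "real \<Rightarrow> complex"
  assumes "0 \<le> a" "a \<le> b" "b \<le> 1" "cont01 f"
  shows "cont01 (\<lambda>u. f (a + u * (b - a)))"
  by (rule continuous_on_compose2[OF assms(4)])
    (use avg_mem[OF assms(1-3)] in \<open>auto intro!: continuous_intros\<close>)

lemma avg_integrable:
  fixes f :: "real \<Rightarrow> complex"
  assumes "0 \<le> a" "a \<le> b" "b \<le> 1" "cont01 f"
  shows "(\<lambda>u. f (a + u * (b - a))) integrable_on {0..1}"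
  using avg_cont[OF assms] by (rule integrable_continuous_real)

lemma avg_pos:
  assumes "0 \<le> a" "a \<le> b" "b \<le> 1" "cont01 f"
    and "\<And>t. t \<in> {a..b} \<Longrightarrow> 0 \<le> Re (f t)"
  shows "0 \<le> Re (avg a b f)"
proof -
  have "((\<lambda>u. Re (f (a + u * (b - a)))) has_integral Re (avg a b f)) {0..1}"
    using has_integral_Re[OF integrable_integral[OF avg_integrable[OF assms(1-4)]]]
    by (simp add: avg_def)
  then show ?thesis
    by (rule has_integral_nonneg) (use avg_mem(1)[OF assms(1-3)] assms(5) in auto)
qed

lemma avg_strict_pos:
  assumes "0 \<le> a" "a < b" "b \<le> 1" "cont01 f"
    and "\<And>t. t \<in> {a..b} \<Longrightarrow> 0 \<le> Re (f t)" "\<And>t. t \<in> {a<..<b} \<Longrightarrow> 0 < Re (f t)"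
  shows "0 < Re (avg a b f)"
proof (rule ccontr)
  assume neg: "\<not> ?thesis"
  define h where "h = (\<lambda>u. Re (f (a + u * (b - a))))"
  have h: "(h has_integral Re (avg a b f)) {0..1}"
    using has_integral_Re[OF integrable_integral[OF avg_integrable[of a b f]]] assms(1-4)
    unfolding avg_def h_def by auto
  moreover have "Re (avg a b f) = 0"
    using neg avg_pos[of a b f] assms by fastforce
  moreover have "cont01 h"
    unfolding h_def using avg_cont[of a b f] assms by (auto intro!: continuous_intros)
  moreover have "0 \<le> h u" if "u \<in> {0..1}" for u
    using avg_mem(1)[of a b u] assms that by (auto simp: h_def)
  ultimately have "h (1/2) = 0"
    using has_integral_0_cbox_imp_0[of 0 1 h "1/2"] by auto
  moreover have "a + 1/2 * (b - a) \<in> {a<..<b}" using assms by (auto simp: field_simps)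
  ultimately show False using assms(6) unfolding h_def by fastforce
qed

lemma avg_state:
  assumes "0 \<le> a" "a \<le> b" "b \<le> 1"
  shows "state (avg a b)"
proof
  fix f g :: "real \<Rightarrow> complex" and c
  assume f: "cont01 f"
  show "avg a b (\<lambda>t. c * f t) = c * avg a b f"
    by (simp add: avg_def)
  show "0 \<le> Re (avg a b f)" if "\<And>t. t \<in> {0..1} \<Longrightarrow> 0 \<le> Re (f t)"
    using avg_pos[OF assms f] that assms by auto
  assume g: "cont01 g"
  show "avg a b (\<lambda>t. f t + g t) = avg a b f + avg a b g"
    using avg_integrable[OF assms f] avg_integrable[OF assms g]
    by (simp add: avg_def Henstock_Kurzweil_Integration.integral_add)
qed (simp add: avg_def)

lemma avg_FTC:
  assumes "0 \<le> a" "a \<le> b" "b \<le> 1"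
    and "\<And>t. t \<in> {0..1} \<Longrightarrow> (F has_vector_derivative f t) (at t within {0..1})"
  shows "of_real (b - a) * avg a b f = F b - F a"
proof -
  have "((\<lambda>u. (b - a) *\<^sub>R f (a + u * (b - a))) has_integral
          F (a + 1 * (b - a)) - F (a + 0 * (b - a))) {0..1}"
  proof (rule fundamental_theorem_of_calculus)
    fix u :: real assume u: "u \<in> {0..1}"
    have "((F \<circ> (\<lambda>u. a + u * (b - a))) has_vector_derivative
        (b - a) *\<^sub>R f (a + u * (b - a))) (at u within {0..1})"
    proof (rule vector_diff_chain_within)
      show "((\<lambda>u. a + u * (b - a)) has_vector_derivative b - a) (at u within {0..1})"
        by (auto intro!: derivative_eq_intros)
      show "(F has_vector_derivative f (a + u * (b - a)))
          (at (a + u * (b - a)) within (\<lambda>u. a + u * (b - a)) ` {0..1})"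
      proof (rule has_vector_derivative_within_subset)
        show "(F has_vector_derivative f (a + u * (b - a))) (at (a + u * (b - a)) within {0..1})"
          using assms(4) avg_mem(2)[OF assms(1-3) u] by blast
        show "(\<lambda>u. a + u * (b - a)) ` {0..1} \<subseteq> {0..1}"
          using avg_mem(2)[OF assms(1-3)] by blast
      qed
    qed
    then show "((\<lambda>u. F (a + u * (b - a))) has_vector_derivative
        (b - a) *\<^sub>R f (a + u * (b - a))) (at u within {0..1})"
      by (simp add: o_def)
  qed simp
  then have "integral {0..1} (\<lambda>u. (b - a) *\<^sub>R f (a + u * (b - a)))
      = F (a + 1 * (b - a)) - F (a + 0 * (b - a))"
    by (rule integral_unique)
  also have "\<dots> = F b - F a" by simp
  finally show ?thesis
    using Henstock_Kurzweil_Integration.integral_cmul[of "{0..1}" "b - a" "\<lambda>u. f (a + u * (b - a))"]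
    by (metis avg_def scaleR_conv_of_real)
qed

lemma avg_refl [simp]: "avg a a f = f a"
  by (simp add: avg_def)

lemma avg_split:
  assumes "0 \<le> a" "a \<le> b" "b \<le> c" "c \<le> 1" and f: "cont01 f"
  shows "of_real (c - a) * avg a c f = of_real (b - a) * avg a b f + of_real (c - b) * avg b c f"
proof -
  define F where "F = (\<lambda>x. integral {0..x} f)"
  have F: "(F has_vector_derivative f t) (at t within {0..1})" if "t \<in> {0..1}" for t
    unfolding F_def using integral_has_vector_derivative[OF f that] .
  show ?thesis
    using avg_FTC[of a c F f] avg_FTC[of a b F f] avg_FTC[of b c F f] assms(1-4) F
    by (simp del: of_real_diff)
qed

definition M0 :: "(real \<Rightarrow> complex) \<Rightarrow> real \<Rightarrow> complex" where
  "M0 f s = avg 0 s f"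

definition M1 :: "(real \<Rightarrow> complex) \<Rightarrow> real \<Rightarrow> complex" where
  "M1 f s = avg s 1 f"

lemma continuous_on_M0 [continuous_intros]:
  assumes "cont01 f"
  shows "cont01 (M0 f)"
proof -
  have "cont01 (\<lambda>s. integral (cbox 0 1) (\<lambda>u. f (0 + u * (s - 0))))"
  proof (rule integral_continuous_on_param)
    show "continuous_on ({0..1} \<times> cbox 0 1) (\<lambda>(s, u). f (0 + u * (s - 0)))"
      unfolding case_prod_beta
      by (rule continuous_on_compose2[OF assms])
        (auto intro!: continuous_intros mult_le_one)
  qed
  then show ?thesis by (simp add: M0_def[abs_def] avg_def)
qed

lemma continuous_on_M1 [continuous_intros]:
  assumes "cont01 f"
  shows "cont01 (M1 f)"
proof -
  have "cont01 (\<lambda>s. integral (cbox 0 1) (\<lambda>u. f (s + u * (1 - s))))"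
  proof (rule integral_continuous_on_param)
    show "continuous_on ({0..1} \<times> cbox 0 1) (\<lambda>(s, u). f (s + u * (1 - s)))"
      unfolding case_prod_beta
    proof (rule continuous_on_compose2[OF assms])
      show "(\<lambda>x. fst x + snd x * (1 - fst x)) ` ({0..1} \<times> cbox 0 1) \<subseteq> {0..1::real}"
        using avg_mem(2) by fastforce
    qed (auto intro!: continuous_intros)
  qed
  then show ?thesis by (simp add: M1_def[abs_def] avg_def)
qed

lemma state_M0: "s \<in> {0..1} \<Longrightarrow> state (\<lambda>f. M0 f s)"
  using avg_state[of 0 s] by (simp add: M0_def)

lemma state_M1: "s \<in> {0..1} \<Longrightarrow> state (\<lambda>f. M1 f s)"
  using avg_state[of s 1] by (simp add: M1_def)

lemma M0_0 [simp]: "M0 f 0 = f 0" and M1_1 [simp]: "M1 f 1 = f 1"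
  by (simp_all add: M0_def M1_def)

text \<open>One step of a Markov chain: \<open>M\<close> is the transition kernel, and the
  continuity assumption says that it preserves the class of test functions.\<close>

lemma state_comp:
  assumes L: "state L" and S: "\<And>s. s \<in> {0..1} \<Longrightarrow> state (\<lambda>f. M f s)"
    and C: "\<And>f. cont01 f \<Longrightarrow> cont01 (M f)"
  shows "state (\<lambda>f. L (M f))"
proof
  fix f g :: "real \<Rightarrow> complex" and c
  assume f: "cont01 f"
  have "L (M (\<lambda>t. c * f t)) = L (\<lambda>s. c * M f s)"
    using f by (intro state.cong[OF L] C continuous_intros) (auto simp: state.scale[OF S])
  then show "L (M (\<lambda>t. c * f t)) = c * L (M f)"
    using state.scale[OF L C[OF f]] by simp
  show "0 \<le> Re (L (M f))" if "\<And>t. t \<in> {0..1} \<Longrightarrow> 0 \<le> Re (f t)"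
    using that by (intro state.pos[OF L C[OF f]] state.pos[OF S f])
  assume g: "cont01 g"
  have "L (M (\<lambda>t. f t + g t)) = L (\<lambda>s. M f s + M g s)"
    using f g by (intro state.cong[OF L] C continuous_intros) (auto simp: state.add[OF S])
  then show "L (M (\<lambda>t. f t + g t)) = L (M f) + L (M g)"
    using state.add[OF L C[OF f] C[OF g]] by simp
next
  have "L (M (\<lambda>t. 1)) = L (\<lambda>t. 1)"
    by (intro state.cong[OF L] C continuous_intros) (auto simp: state.unit[OF S])
  then show "L (M (\<lambda>t. 1)) = 1" using state.unit[OF L] by simp
qed

section \<open>The functional of an infinite index\<close>

text \<open>A block \<open>k\<close> is the digit word \<open>0\<dots>01\<close> of length \<open>k\<close>; the first digit acts first on the test function.\<close>

definition block :: "nat \<Rightarrow> (real \<Rightarrow> complex) \<Rightarrow> real \<Rightarrow> complex" where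
  "block k f = M1 ((M0 ^^ (k - 1)) f)"

lemma continuous_on_M0_funpow [continuous_intros]:
  "cont01 f \<Longrightarrow> cont01 ((M0 ^^ n) f)"
  by (induction n) (auto intro: continuous_on_M0)

lemma continuous_on_block [continuous_intros]:
  "cont01 f \<Longrightarrow> cont01 (block k f)"
  by (auto simp: block_def intro!: continuous_intros)

lemma state_M0_funpow: "s \<in> {0..1} \<Longrightarrow> state (\<lambda>f. (M0 ^^ n) f s)"
proof (induction n arbitrary: s)
  case 0
  then show ?case by unfold_locales auto
next
  case (Suc n)
  show ?case
    using state_comp[OF state_M0[OF Suc.prems], of "\<lambda>f. (M0 ^^ n) f"] Suc.IH
    by (auto intro: continuous_on_M0_funpow)
qed

lemma state_block: "s \<in> {0..1} \<Longrightarrow> state (\<lambda>f. block k f s)"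
  unfolding block_def
  using state_comp[OF state_M1, of s "\<lambda>f. (M0 ^^ (k - 1)) f"] state_M0_funpow
  by (auto intro: continuous_on_M0_funpow)

definition blocks :: "nat list \<Rightarrow> (real \<Rightarrow> complex) \<Rightarrow> real \<Rightarrow> complex" where
  "blocks ks f = fold block ks f"

lemma blocks_simps [simp]:
  "blocks [] f = f" "blocks (k # ks) f = blocks ks (block k f)"
  "blocks (ks @ ks') f = blocks ks' (blocks ks f)"
  by (simp_all add: blocks_def)

lemma continuous_on_blocks [continuous_intros]:
  "cont01 f \<Longrightarrow> cont01 (blocks ks f)"
  by (induction ks arbitrary: f) (auto intro: continuous_on_block)

lemma state_blocks: "s \<in> {0..1} \<Longrightarrow> state (\<lambda>f. blocks ks f s)"
proof (induction ks)
  case Nil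
  then show ?case by unfold_locales auto
next
  case (Cons k ks)
  show ?case
    using state_comp[OF Cons.IH[OF Cons.prems], of "block k"] state_block
    by (auto intro: continuous_on_block)
qed

text \<open>The base point 0 carries meaning: there t^n vanishes for n > 0, which is the initial
  value of the nested sums, so finite prefixes reproduce the finite star sums exactly.\<close>

definition EF :: "nat list \<Rightarrow> (real \<Rightarrow> complex) \<Rightarrow> complex" where
  "EF ks f = blocks ks f 0"

definition E :: "(nat \<Rightarrow> nat) \<Rightarrow> (real \<Rightarrow> complex) \<Rightarrow> complex" where
  "E k f = lim (\<lambda>r. EF (index_prefix k r) f)"

lemma state_EF: "state (EF ks)"
  using state_blocks[of 0 ks] by (simp add: EF_def[abs_def])

section \<open>Contraction of oscillation and existence of the limit functional\<close>

text \<open>An error plus a slope: digits halve the slope, while \<open>e\<close> absorbs the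
  failure of a general continuous function to be Lipschitz.\<close>

definition osc_le :: "real \<Rightarrow> real \<Rightarrow> (real \<Rightarrow> complex) \<Rightarrow> bool" where
  "osc_le e C f \<longleftrightarrow> 0 \<le> C \<and> (\<forall>s\<in>{0..1}. \<forall>t\<in>{0..1}. norm (f s - f t) \<le> e + C * \<bar>s - t\<bar>)"

text \<open>Points closer than the modulus of continuity \<open>d\<close> are covered by
  \<open>e\<close>. For all others the slope \<open>2 * B / d\<close> already contributes the
  trivial bound \<open>2 * B\<close>.\<close>

lemma continuous_osc_le:
  assumes f: "cont01 f" and e: "0 < e"
  obtains C where "osc_le e C f"
proof -
  have "uniformly_continuous_on {0..1} f"
    using f by (intro compact_uniformly_continuous) auto
  then obtain d where d: "0 < d" "\<And>s t. \<lbrakk>s \<in> {0..1}; t \<in> {0..1}; dist s t < d\<rbrakk> \<Longrightarrow> dist (f s) (f t) < e"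
    using e unfolding uniformly_continuous_on_def by metis
  have "bounded (f ` {0..1})"
    using f by (intro compact_imp_bounded compact_continuous_image) auto
  then obtain B where B: "0 < B" "\<And>t. t \<in> {0..1} \<Longrightarrow> norm (f t) \<le> B"
    unfolding bounded_pos by auto
  have "norm (f s - f t) \<le> e + 2 * B / d * \<bar>s - t\<bar>" if st: "s \<in> {0..1}" "t \<in> {0..1}" for s t
  proof (cases "dist s t < d")
    case True
    have "0 \<le> 2 * B / d * \<bar>s - t\<bar>" using B d by simp
    then show ?thesis
      using d(2)[OF st True] unfolding dist_norm by linarith
  next
    case False
    then have "2 * B / d * d \<le> 2 * B / d * \<bar>s - t\<bar>"
      using B d by (intro mult_left_mono) (auto simp: dist_norm)
    then have "2 * B \<le> 2 * B / d * \<bar>s - t\<bar>" using d by simp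
    moreover have "norm (f s - f t) \<le> 2 * B"
      using norm_triangle_ineq4[of "f s" "f t"] B(2)[OF st(1)] B(2)[OF st(2)] by linarith
    ultimately show ?thesis using e by linarith
  qed
  then show ?thesis
    using that[of "2 * B / d"] B d by (simp add: osc_le_def)
qed

text \<open>The distance of corresponding points is at most the affine function with end values
  \<open>x\<close> and \<open>y\<close>, whose integral is their mean. For each digit one end of the
  two intervals coincides, so one of \<open>x\<close>, \<open>y\<close> is 0; this is the source of
  the factor 1/2.\<close>

lemma osc_le_avg:
  assumes f: "cont01 f" and C: "osc_le e C f"
    and ab: "0 \<le> a" "a \<le> b" "b \<le> 1" and cd: "0 \<le> c" "c \<le> d" "d \<le> 1"
    and D: "\<And>u. u \<in> {0..1} \<Longrightarrow> \<bar>(a + u * (b - a)) - (c + u * (d - c))\<bar> \<le> (1 - u) * x + u * y"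
    and xy: "0 \<le> x" "0 \<le> y"
  shows "norm (avg a b f - avg c d f) \<le> e + C * ((x + y) / 2)"
proof -
  have "norm (integral {0..1} (\<lambda>u. f (a + u * (b - a)) - f (c + u * (d - c))))
      \<le> integral {0..1} (\<lambda>u. e + C * ((1 - u) * x + u * y))"
  proof (rule Henstock_Kurzweil_Integration.integral_norm_bound_integral)
    show "(\<lambda>u. f (a + u * (b - a)) - f (c + u * (d - c))) integrable_on {0..1}"
      using avg_integrable[OF ab f] avg_integrable[OF cd f]
      by (rule Henstock_Kurzweil_Integration.integrable_diff)
    show "(\<lambda>u. e + C * ((1 - u) * x + u * y)) integrable_on {0..1}"
      by (intro integrable_continuous_real continuous_intros)
    fix u :: real assume u: "u \<in> {0..1}"
    have "norm (f (a + u * (b - a)) - f (c + u * (d - c)))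
        \<le> e + C * \<bar>(a + u * (b - a)) - (c + u * (d - c))\<bar>"
      using C avg_mem(2)[OF ab u] avg_mem(2)[OF cd u] by (simp add: osc_le_def)
    also have "\<dots> \<le> e + C * ((1 - u) * x + u * y)"
      using D[OF u] C by (intro add_left_mono mult_left_mono) (auto simp: osc_le_def)
    finally show "norm (f (a + u * (b - a)) - f (c + u * (d - c))) \<le> e + C * ((1 - u) * x + u * y)" .
  qed
  moreover have "((\<lambda>u. e + C * ((1 - u) * x + u * y)) has_integral
      (\<lambda>u. e * u + C * ((u - u\<^sup>2 / 2) * x + u\<^sup>2 / 2 * y)) 1 -
      (\<lambda>u. e * u + C * ((u - u\<^sup>2 / 2) * x + u\<^sup>2 / 2 * y)) 0) {0..1::real}"
    by (rule fundamental_theorem_of_calculus)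
      (auto intro!: derivative_eq_intros simp: has_real_derivative_iff_has_vector_derivative[symmetric] field_simps)
  then have "integral {0..1} (\<lambda>u. e + C * ((1 - u) * x + u * y)) = e + C * ((x + y) / 2)"
    by (simp add: integral_unique field_simps)
  ultimately show ?thesis
    using avg_integrable[OF ab f] avg_integrable[OF cd f]
    by (simp add: avg_def Henstock_Kurzweil_Integration.integral_diff)
qed

lemma osc_le_M0:
  assumes "cont01 f" "osc_le e C f"
  shows "osc_le e (C / 2) (M0 f)"
  unfolding osc_le_def
proof (intro conjI ballI)
  show "0 \<le> C / 2" using assms by (simp add: osc_le_def)
  fix s t :: real assume st: "s \<in> {0..1}" "t \<in> {0..1}"
  have "norm (avg 0 s f - avg 0 t f) \<le> e + C * ((0 + \<bar>s - t\<bar>) / 2)"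
  proof (rule osc_le_avg[OF assms])
    fix u :: real assume u: "u \<in> {0..1}"
    have "(0 + u * (s - 0)) - (0 + u * (t - 0)) = u * (s - t)" by (simp add: algebra_simps)
    then show "\<bar>(0 + u * (s - 0)) - (0 + u * (t - 0))\<bar> \<le> (1 - u) * 0 + u * \<bar>s - t\<bar>"
      using u by (simp add: abs_mult)
  qed (use st in auto)
  then show "norm (M0 f s - M0 f t) \<le> e + C / 2 * \<bar>s - t\<bar>" by (simp add: M0_def)
qed

lemma osc_le_M1:
  assumes "cont01 f" "osc_le e C f"
  shows "osc_le e (C / 2) (M1 f)"
  unfolding osc_le_def
proof (intro conjI ballI)
  show "0 \<le> C / 2" using assms by (simp add: osc_le_def)
  fix s t :: real assume st: "s \<in> {0..1}" "t \<in> {0..1}"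
  have *: "s + u * (1 - s) - (t + u * (1 - t)) = (1 - u) * (s - t)" for u
    by (simp add: algebra_simps)
  have "norm (avg s 1 f - avg t 1 f) \<le> e + C * ((\<bar>s - t\<bar> + 0) / 2)"
  proof (rule osc_le_avg[OF assms])
    fix u :: real assume u: "u \<in> {0..1}"
    show "\<bar>(s + u * (1 - s)) - (t + u * (1 - t))\<bar> \<le> (1 - u) * \<bar>s - t\<bar> + u * 0"
      unfolding * using u by (simp add: abs_mult)
  qed (use st in auto)
  then show "norm (M1 f s - M1 f t) \<le> e + C / 2 * \<bar>s - t\<bar>" by (simp add: M1_def)
qed

lemma osc_le_mono: "osc_le e C f \<Longrightarrow> C \<le> D \<Longrightarrow> osc_le e D f"
  unfolding osc_le_def
  by (meson abs_ge_zero add_left_mono mult_right_mono order_trans)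

lemma osc_le_M0_funpow:
  assumes "cont01 f" "osc_le e C f"
  shows "osc_le e C ((M0 ^^ n) f)"
proof (induction n)
  case (Suc n)
  have "osc_le e (C / 2) ((M0 ^^ Suc n) f)"
    using osc_le_M0[OF _ Suc] continuous_on_M0_funpow[OF assms(1)] by simp
  then show ?case by (rule osc_le_mono) (use assms in \<open>simp add: osc_le_def\<close>)
qed (use assms in auto)

lemma osc_le_block:
  assumes "cont01 f" "osc_le e C f"
  shows "osc_le e (C / 2) (block k f)"
  unfolding block_def using assms by (intro osc_le_M1 osc_le_M0_funpow continuous_intros)

lemma osc_le_blocks:
  assumes "cont01 f" "osc_le e C f"
  shows "osc_le e (C / 2 ^ length ks) (blocks ks f)"
  using assms
proof (induction ks arbitrary: f C)
  case (Cons k ks)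
  from Cons.IH[OF continuous_on_block osc_le_block] Cons.prems show ?case by simp
qed simp

lemma state_osc:
  assumes L: "state L" and f: "cont01 f" "osc_le e C f" and s: "s \<in> {0..1}"
  shows "norm (L f - f s) \<le> e + C"
proof -
  have "norm (L (\<lambda>t. f t - f s)) \<le> e + C"
  proof (rule state.norm_bound[OF L])
    fix t :: real assume t: "t \<in> {0..1}"
    have "norm (f t - f s) \<le> e + C * \<bar>t - s\<bar>" using f(2) s t by (simp add: osc_le_def)
    also have "\<dots> \<le> e + C * 1"
      using s t f(2) by (intro add_left_mono mult_left_mono) (auto simp: osc_le_def)
    finally show "norm (f t - f s) \<le> e + C" by simp
  qed (use f in \<open>auto intro!: continuous_intros\<close>)
  then show ?thesis using f by (simp add: state.diff[OF L] state.const[OF L])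
qed

text \<open>Every block halves the oscillation, so the choice of the base point is immaterial in the limit.\<close>

lemma EF_append_bound:
  assumes "cont01 f" "osc_le e C f" "state L"
  shows "norm (L (blocks ks f) - EF ks f) \<le> e + C / 2 ^ length ks"
  using state_osc[OF assms(3) continuous_on_blocks[OF assms(1)] osc_le_blocks[OF assms(1,2)], of 0]
  by (simp add: EF_def)

lemma index_prefix_add:
  "index_prefix k (m + n) = index_prefix k m @ index_prefix (\<lambda>i. k (m + i)) n"
  by (induction n) (auto simp: index_prefix_def)

lemma length_index_prefix [simp]: "length (index_prefix k n) = n"
  by (simp add: index_prefix_def)

lemma index_prefix_Suc: "index_prefix k (Suc n) = k 0 # index_prefix (\<lambda>i. k (Suc i)) n"
  using index_prefix_add[of k 1 n] by (simp add: index_prefix_def)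

text \<open>Everything after the first \<open>N\<close> blocks acts as some state on a function that
  varies by at most \<open>e / 4 + C / 2 ^ N\<close>.\<close>

lemma EF_Cauchy:
  assumes f: "cont01 f"
  shows "Cauchy (\<lambda>r. EF (index_prefix k r) f)"
proof (rule CauchyI)
  fix e :: real assume e: "0 < e"
  obtain C where C: "osc_le (e/4) C f" using continuous_osc_le[OF f, of "e/4"] e by auto
  obtain N where N: "C / 2 ^ N < e / 4"
  proof -
    have "(\<lambda>n. C / 2 ^ n) \<longlonglongrightarrow> 0" by real_asymp
    then have "eventually (\<lambda>n. C / 2 ^ n < e / 4) sequentially"
      using e by (intro order_tendstoD) auto
    then show ?thesis using that eventually_happens by fastforce
  qed
  have 1: "norm (EF (index_prefix k m) f - EF (index_prefix k N) f) < e / 2" if "N \<le> m" for m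
  proof -
    have "norm (EF (index_prefix (\<lambda>i. k (N + i)) (m - N)) (blocks (index_prefix k N) f)
        - EF (index_prefix k N) f) \<le> e / 4 + C / 2 ^ N"
      using EF_append_bound[OF f C state_EF, of "index_prefix (\<lambda>i. k (N + i)) (m - N)" "index_prefix k N"] by simp
    moreover have "EF (index_prefix k m) f
        = EF (index_prefix (\<lambda>i. k (N + i)) (m - N)) (blocks (index_prefix k N) f)"
      using index_prefix_add[of k N "m - N"] that by (simp add: EF_def)
    ultimately have "norm (EF (index_prefix k m) f - EF (index_prefix k N) f) \<le> e / 4 + C / 2 ^ N"
      by simp
    then show ?thesis using N by linarith
  qed
  have "norm (EF (index_prefix k m) f - EF (index_prefix k n) f) < e" if "N \<le> m" "N \<le> n" for m n
    using norm_triangle_lt[of "EF (index_prefix k m) f - EF (index_prefix k N) f"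
        "EF (index_prefix k N) f - EF (index_prefix k n) f" e]
      1[OF that(1)] 1[OF that(2)] by (simp add: norm_minus_commute)
  then show "\<exists>M. \<forall>m\<ge>M. \<forall>n\<ge>M. norm (EF (index_prefix k m) f - EF (index_prefix k n) f) < e"
    by blast
qed

lemma EF_tendsto_E:
  "cont01 f \<Longrightarrow> (\<lambda>r. EF (index_prefix k r) f) \<longlonglongrightarrow> E k f"
  unfolding E_def using EF_Cauchy Cauchy_convergent convergent_LIMSEQ_iff by blast

lemma state_E: "state (E k)"
proof
  fix f g :: "real \<Rightarrow> complex" and c
  assume f: "cont01 f"
  have "(\<lambda>r. EF (index_prefix k r) (\<lambda>t. c * f t)) \<longlonglongrightarrow> c * E k f"
    using tendsto_mult_left[OF EF_tendsto_E[OF f], of c] by (simp add: state.scale[OF state_EF f])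
  then show "E k (\<lambda>t. c * f t) = c * E k f"
    using EF_tendsto_E f LIMSEQ_unique by (blast intro: continuous_intros)
  show "0 \<le> Re (E k f)" if "\<And>t. t \<in> {0..1} \<Longrightarrow> 0 \<le> Re (f t)"
  proof (rule LIMSEQ_le_const)
    show "(\<lambda>r. Re (EF (index_prefix k r) f)) \<longlonglongrightarrow> Re (E k f)"
      by (intro tendsto_intros EF_tendsto_E f)
    show "\<exists>N. \<forall>n\<ge>N. 0 \<le> Re (EF (index_prefix k n) f)"
      using state.pos[OF state_EF f] that by blast
  qed
  assume g: "cont01 g"
  have "(\<lambda>r. EF (index_prefix k r) (\<lambda>t. f t + g t)) \<longlonglongrightarrow> E k f + E k g"
    using tendsto_add[OF EF_tendsto_E[OF f] EF_tendsto_E[OF g]] by (simp add: state.add[OF state_EF f g])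
  then show "E k (\<lambda>t. f t + g t) = E k f + E k g"
    using EF_tendsto_E f g LIMSEQ_unique by (blast intro: continuous_intros)
next
  show "E k (\<lambda>t. 1) = 1"
    unfolding E_def by (simp add: state.unit[OF state_EF])
qed

interpretation E: state "E k" for k
  by (rule state_E)

lemma E_block:
  assumes f: "cont01 f"
  shows "E k f = E (\<lambda>i. k (Suc i)) (block (k 0) f)"
proof -
  have "(\<lambda>r. EF (index_prefix k (Suc r)) f) \<longlonglongrightarrow> E k f"
    using EF_tendsto_E[OF f] by (rule LIMSEQ_Suc)
  moreover have "(\<lambda>r. EF (index_prefix k (Suc r)) f) \<longlonglongrightarrow> E (\<lambda>i. k (Suc i)) (block (k 0) f)"
    using EF_tendsto_E[OF continuous_on_block[OF f]] by (simp add: index_prefix_Suc EF_def)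
  ultimately show ?thesis by (rule LIMSEQ_unique)
qed

lemma E_M1:
  assumes "cont01 f" "k 0 = 1"
  shows "E k f = E (\<lambda>i. k (Suc i)) (M1 f)"
  using E_block[OF assms(1), of k] assms(2) by (simp add: block_def)

text \<open>The index \<open>k(0 := k 0 - m)\<close> encodes the digit word from which
  \<open>m\<close> leading zeros have been removed; this gives access to single digits without a
  second coding of words.\<close>

lemma E_M0_funpow:
  assumes "cont01 f" "m < k 0"
  shows "E k f = E (k(0 := k 0 - m)) ((M0 ^^ m) f)"
proof -
  have "k 0 - 1 = (k 0 - m - 1) + m" using assms(2) by simp
  then have "block (k 0) f = block (k 0 - m) ((M0 ^^ m) f)"
    unfolding block_def by (metis comp_apply funpow_add)
  then show ?thesis
    using E_block[OF assms(1), of k] E_block[OF continuous_on_M0_funpow[OF assms(1)], of "k(0 := k 0 - m)" m]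
    by simp
qed

lemma E_M0:
  assumes "cont01 f" "1 < k 0"
  shows "E k f = E (k(0 := k 0 - 1)) (M0 f)"
  using E_M0_funpow[of f 1 k] assms by simp

section \<open>The order of the functionals\<close>

text \<open>Increasing argument written with cross products: no branch of the argument is chosen,
  zeros are allowed, and the expression is real bilinear, so it can be integrated in each
  variable.\<close>

definition ccw :: "(real \<Rightarrow> complex) \<Rightarrow> bool" where
  "ccw u \<longleftrightarrow> (\<forall>s\<in>{0..1}. \<forall>t\<in>{0..1}. s < t \<longrightarrow> 0 \<le> Im (cnj (u s) * u t))"

text \<open>The endpoint 0 is left out of the strict part because the intended curve
  \<open>t * ker z t\<close> vanishes there.\<close>

definition strict_ccw :: "(real \<Rightarrow> complex) \<Rightarrow> bool" where
  "strict_ccw u \<longleftrightarrow> ccw u \<and> (\<forall>s t. 0 < s \<and> s < t \<and> t \<le> 1 \<longrightarrow> 0 < Im (cnj (u s) * u t))"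

lemma ccwD: "ccw u \<Longrightarrow> 0 \<le> s \<Longrightarrow> s \<le> t \<Longrightarrow> t \<le> 1 \<Longrightarrow> 0 \<le> Im (cnj (u s) * u t)"
  by (cases "s = t") (auto simp: ccw_def)

lemma strict_ccwD:
  "strict_ccw u \<Longrightarrow> ccw u" "strict_ccw u \<Longrightarrow> 0 < s \<Longrightarrow> s < t \<Longrightarrow> t \<le> 1 \<Longrightarrow> 0 < Im (cnj (u s) * u t)"
  by (auto simp: strict_ccw_def)

lemma Im_cnj_mult_left: "Im (cnj a * b) = Re ((\<i> * cnj b) * a)"
  and Im_cnj_mult_right: "Im (cnj a * b) = Re ((- \<i> * cnj a) * b)"
  by (simp_all add: algebra_simps)

lemma avg_Im_left:
  assumes "0 \<le> a" "a \<le> b" "b \<le> 1" "cont01 u"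
  shows "Im (cnj (avg a b u) * w) = Re (avg a b (\<lambda>t. (\<i> * cnj w) * u t))"
  unfolding Im_cnj_mult_left using state.scale[OF avg_state[OF assms(1-3)] assms(4)] by simp

lemma avg_Im_right:
  assumes "0 \<le> a" "a \<le> b" "b \<le> 1" "cont01 u"
  shows "Im (cnj w * avg a b u) = Re (avg a b (\<lambda>t. (- \<i> * cnj w) * u t))"
  unfolding Im_cnj_mult_right by (simp only: state.scale[OF avg_state[OF assms(1-3)] assms(4)])

text \<open>By bilinearity the cross product is integrated first in one point, then in the other;
  the separation of the intervals puts every pair in order.\<close>

lemma avg_cross_nonneg:
  assumes u: "cont01 u" "ccw u"
    and le: "0 \<le> a" "a \<le> b" "b \<le> c" "c \<le> d" "d \<le> 1"
  shows "0 \<le> Im (cnj (avg a b u) * avg c d u)"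
proof -
  have 1: "0 \<le> Im (cnj (avg a b u) * u t)" if t: "t \<in> {c..d}" for t
  proof -
    have "0 \<le> Re (avg a b (\<lambda>s. (\<i> * cnj (u t)) * u s))"
      using ccwD[OF u(2)] le t unfolding Im_cnj_mult_left
      by (intro avg_pos continuous_intros u) auto
    then show ?thesis using avg_Im_left[OF _ _ _ u(1), of a b] le by simp
  qed
  have "0 \<le> Re (avg c d (\<lambda>t. (- \<i> * cnj (avg a b u)) * u t))"
    using 1 le unfolding Im_cnj_mult_right by (intro avg_pos continuous_intros u) auto
  then show ?thesis using avg_Im_right[OF _ _ _ u(1), of c d] le by simp
qed

lemma avg_cross_pos:
  assumes u: "cont01 u" "strict_ccw u"
    and le: "0 \<le> a" "a < b" "b \<le> c" "c \<le> d" "d \<le> 1"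
  shows "0 < Im (cnj (avg a b u) * avg c d u)"
proof -
  have 1: "0 < Im (cnj (avg a b u) * u t)" if t: "t \<in> {c..d}" for t
  proof -
    have "0 < Re (avg a b (\<lambda>s. (\<i> * cnj (u t)) * u s))"
      using ccwD[OF strict_ccwD(1)[OF u(2)]] strict_ccwD(2)[OF u(2)] le t unfolding Im_cnj_mult_left
      by (intro avg_strict_pos continuous_intros u) auto
    then show ?thesis using avg_Im_left[OF _ _ _ u(1), of a b] le by simp
  qed
  show ?thesis
  proof (cases "c = d")
    case True
    then show ?thesis using 1[of c] by simp
  next
    case False
    have "0 < Re (avg c d (\<lambda>t. (- \<i> * cnj (avg a b u)) * u t))"
      using 1 le False unfolding Im_cnj_mult_right
      by (intro avg_strict_pos continuous_intros u) (auto intro: less_imp_le)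
    then show ?thesis using avg_Im_right[OF _ _ _ u(1), of c d] le by simp
  qed
qed

text \<open>\<open>t * M0 u t\<close> splits into \<open>s * M0 u s\<close> and the contribution of
  [s,t]; the first part is parallel to \<open>M0 u s\<close> and drops out of the cross
  product.\<close>

lemma M0_cross_eq:
  assumes u: "cont01 u" and st: "0 \<le> s" "s \<le> t" "t \<le> 1"
  shows "t * Im (cnj (M0 u s) * M0 u t) = (t - s) * Im (cnj (avg 0 s u) * avg s t u)"
proof -
  have 1: "of_real t * avg 0 t u = of_real s * avg 0 s u + of_real (t - s) * avg s t u"
    using avg_split[of 0 s t u] u st by simp
  have "cnj (avg 0 s u) * (of_real t * avg 0 t u)
      = of_real s * (cnj (avg 0 s u) * avg 0 s u) + of_real (t - s) * (cnj (avg 0 s u) * avg s t u)"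
    unfolding 1 by (simp add: algebra_simps)
  from arg_cong[OF this, of Im] show ?thesis
    by (simp add: M0_def algebra_simps)
qed

lemma M1_cross_eq:
  assumes u: "cont01 u" and st: "0 \<le> s" "s \<le> t" "t \<le> 1"
  shows "(1 - s) * Im (cnj (M1 u s) * M1 u t) = (t - s) * Im (cnj (avg s t u) * avg t 1 u)"
proof -
  have "of_real (1 - s) * avg s 1 u = of_real (t - s) * avg s t u + of_real (1 - t) * avg t 1 u"
    using avg_split[of s t 1 u] u st by simp
  from arg_cong[OF this, of cnj]
  have "(of_real (1 - s) * cnj (avg s 1 u)) * avg t 1 u
      = of_real (t - s) * (cnj (avg s t u) * avg t 1 u) + of_real (1 - t) * (cnj (avg t 1 u) * avg t 1 u)"
    by (simp only: complex_cnj_mult complex_cnj_complex_of_real complex_cnj_add distrib_right mult.assoc)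
  from arg_cong[OF this, of Im] show ?thesis
    by (simp add: M1_def algebra_simps)
qed

lemma ccw_M0:
  assumes u: "cont01 u" "ccw u"
  shows "ccw (M0 u)"
  unfolding ccw_def
proof (intro ballI impI)
  fix s t :: real assume st: "s \<in> {0..1}" "t \<in> {0..1}" "s < t"
  have "0 \<le> t * Im (cnj (M0 u s) * M0 u t)"
    unfolding M0_cross_eq[OF u(1), of s t, OF _ less_imp_le[OF st(3)]]
    using st avg_cross_nonneg[OF u, of 0 s s t]
    by (subst M0_cross_eq[OF u(1)]) auto
  then show "0 \<le> Im (cnj (M0 u s) * M0 u t)"
    using st by (simp add: zero_le_mult_iff)
qed

lemma strict_ccw_M0:
  assumes u: "cont01 u" "strict_ccw u"
  shows "strict_ccw (M0 u)"
  unfolding strict_ccw_def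
proof (intro conjI allI impI ccw_M0 strict_ccwD(1) u)
  fix s t :: real assume st: "0 < s \<and> s < t \<and> t \<le> 1"
  have "0 < (t - s) * Im (cnj (avg 0 s u) * avg s t u)"
    using st avg_cross_pos[OF u, of 0 s s t] by auto
  then have "0 < t * Im (cnj (M0 u s) * M0 u t)"
    using M0_cross_eq[OF u(1), of s t] st by simp
  then show "0 < Im (cnj (M0 u s) * M0 u t)"
    using st by (simp add: zero_less_mult_iff)
qed

lemma ccw_M1:
  assumes u: "cont01 u" "ccw u"
  shows "ccw (M1 u)"
  unfolding ccw_def
proof (intro ballI impI)
  fix s t :: real assume st: "s \<in> {0..1}" "t \<in> {0..1}" "s < t"
  have "0 \<le> (t - s) * Im (cnj (avg s t u) * avg t 1 u)"
    using st avg_cross_nonneg[OF u, of s t t 1] by auto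
  then have "0 \<le> (1 - s) * Im (cnj (M1 u s) * M1 u t)"
    using M1_cross_eq[OF u(1), of s t] st by simp
  then show "0 \<le> Im (cnj (M1 u s) * M1 u t)"
    using st by (simp add: zero_le_mult_iff)
qed

lemma strict_ccw_M1:
  assumes u: "cont01 u" "strict_ccw u"
  shows "strict_ccw (M1 u)"
  unfolding strict_ccw_def
proof (intro conjI allI impI ccw_M1 strict_ccwD(1) u)
  fix s t :: real assume st: "0 < s \<and> s < t \<and> t \<le> 1"
  have "0 < (t - s) * Im (cnj (avg s t u) * avg t 1 u)"
    using st avg_cross_pos[OF u, of s t t 1] by auto
  then have "0 < (1 - s) * Im (cnj (M1 u s) * M1 u t)"
    using M1_cross_eq[OF u(1), of s t] st by simp
  then show "0 < Im (cnj (M1 u s) * M1 u t)"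
    using st by (simp add: zero_less_mult_iff)
qed

text \<open>If \<open>t < s\<close>, the intervals \<open>[0, s]\<close> and \<open>[t, 1]\<close> overlap; the overlap cancels by antisymmetry.\<close>

lemma M0_M1_cross_eq:
  assumes u: "cont01 u" and st: "0 \<le> t" "t \<le> s" "s \<le> 1"
  shows "s * (1 - t) * Im (cnj (M0 u s) * M1 u t)
    = t * (1 - t) * Im (cnj (avg 0 t u) * avg t 1 u) + (s - t) * (1 - s) * Im (cnj (avg t s u) * avg s 1 u)"
proof -
  have 1: "of_real s * avg 0 s u = of_real t * avg 0 t u + of_real (s - t) * avg t s u"
    using avg_split[of 0 t s u] u st by simp
  have 2: "of_real (1 - t) * avg t 1 u = of_real (s - t) * avg t s u + of_real (1 - s) * avg s 1 u"
    using avg_split[of t s 1 u] u st by simp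
  have "cnj (of_real s * avg 0 s u) * (of_real (1 - t) * avg t 1 u)
      = of_real t * (of_real (1 - t) * (cnj (avg 0 t u) * avg t 1 u))
        + of_real (s - t) * (cnj (avg t s u) * (of_real (1 - t) * avg t 1 u))"
    unfolding 1 by (simp add: algebra_simps)
  also have "\<dots> = of_real t * (of_real (1 - t) * (cnj (avg 0 t u) * avg t 1 u))
        + of_real (s - t) * (of_real (1 - s) * (cnj (avg t s u) * avg s 1 u))
        + of_real (s - t) * (of_real (s - t) * (cnj (avg t s u) * avg t s u))"
    unfolding 2 by (simp add: algebra_simps)
  finally have *: "cnj (of_real s * avg 0 s u) * (of_real (1 - t) * avg t 1 u) = \<dots>" .
  from arg_cong[OF *, of Im] show ?thesis
    by (simp add: M0_def M1_def algebra_simps)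
qed

text \<open>Valid for every pair of base points, which is what lets the two walks continue
  independently once their digits differ.\<close>

lemma M0_M1_cross_nonneg:
  assumes u: "cont01 u" "ccw u" and s: "s \<in> {0..1}" and t: "t \<in> {0..1}"
  shows "0 \<le> Im (cnj (M0 u s) * M1 u t)"
proof (cases "s \<le> t")
  case True
  then show ?thesis using avg_cross_nonneg[OF u, of 0 s t 1] s t by (simp add: M0_def M1_def)
next
  case False
  have "0 \<le> s * (1 - t) * Im (cnj (M0 u s) * M1 u t)"
    using avg_cross_nonneg[OF u, of 0 t t 1] avg_cross_nonneg[OF u, of t s s 1] s t False
    by (subst M0_M1_cross_eq[OF u(1)]) (auto intro!: add_nonneg_nonneg mult_nonneg_nonneg simp del: times_complex.sel)
  moreover have "0 < s * (1 - t)" using s t False by auto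
  ultimately show ?thesis by (simp add: zero_le_mult_iff)
qed

lemma M0_M1_cross_pos:
  assumes u: "cont01 u" "strict_ccw u" and s: "s \<in> {0<..1}" and t: "t \<in> {0<..1}"
  shows "0 < Im (cnj (M0 u s) * M1 u t)"
proof (cases "s \<le> t")
  case True
  then show ?thesis using avg_cross_pos[OF u, of 0 s t 1] s t by (simp add: M0_def M1_def)
next
  case False
  have "0 < s * (1 - t) * Im (cnj (M0 u s) * M1 u t)"
    using avg_cross_pos[OF u, of 0 t t 1] avg_cross_nonneg[OF u(1) strict_ccwD(1)[OF u(2)], of t s s 1] s t False
    by (subst M0_M1_cross_eq[OF u(1)]) (auto intro!: add_pos_nonneg mult_pos_pos mult_nonneg_nonneg simp del: times_complex.sel)
  moreover have "0 < s * (1 - t)" using s t False by auto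
  ultimately show ?thesis by (simp add: zero_less_mult_iff)
qed

section \<open>Strict positivity and the digits that enforce it\<close>

lemma M0_pos_right:
  assumes f: "cont01 f" "\<And>t. t \<in> {0..1} \<Longrightarrow> 0 \<le> Re (f t)"
    and "\<And>t. t \<in> {0<..<1} \<Longrightarrow> 0 < Re (f t)" and s: "s \<in> {0<..1}"
  shows "0 < Re (M0 f s)"
  unfolding M0_def using assms by (intro avg_strict_pos) auto

lemma M1_pos_left:
  assumes f: "cont01 f" "\<And>t. t \<in> {0..1} \<Longrightarrow> 0 \<le> Re (f t)"
    and "\<And>t. t \<in> {0<..<1} \<Longrightarrow> 0 < Re (f t)" and s: "s \<in> {0..<1}"
  shows "0 < Re (M1 f s)"
  unfolding M1_def using assms by (intro avg_strict_pos) auto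

text \<open>Digits 0 keep positivity on (0,1], and the digit 1 closing the block extends it to 0.
  After one block the integrand is positive on the compact interval, hence bounded below by a
  positive constant.\<close>

lemma E_pos_right:
  assumes k: "k \<in> That" and f: "cont01 f" "\<And>t. t \<in> {0..1} \<Longrightarrow> 0 \<le> Re (f t)"
    and pos: "\<And>t. t \<in> {0<..1} \<Longrightarrow> 0 < Re (f t)"
  shows "0 < Re (E k f)"
proof -
  have M0: "0 < Re ((M0 ^^ n) f t)" if "t \<in> {0<..1}" for n t
    using that
  proof (induction n arbitrary: t)
    case (Suc n)
    have "0 < Re (M0 ((M0 ^^ n) f) t)"
      using Suc f(2) by (intro M0_pos_right continuous_intros f state.pos[OF state_M0_funpow]) auto
    then show ?case by simp
  qed (use pos in auto)
  have M1: "0 < Re (block n f t)" if t: "t \<in> {0..1}" for n t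
  proof (cases "t = 1")
    case True
    then show ?thesis using M0[of 1] by (simp add: block_def)
  next
    case False
    then show ?thesis
      unfolding block_def using t M0 f(2)
      by (intro M1_pos_left continuous_intros f state.pos[OF state_M0_funpow]) auto
  qed
  show ?thesis
    unfolding E_block[OF f(1), of k] by (rule E.strict_pos) (auto intro!: continuous_intros f M1)
qed

lemma That_simps:
  "k \<in> That \<Longrightarrow> (\<lambda>i. k (Suc i)) \<in> That" "k \<in> That \<Longrightarrow> 1 \<le> k i"
  "k \<in> That \<Longrightarrow> 1 \<le> n \<Longrightarrow> k(0 := n) \<in> That"
  by (auto simp: That_def)

text \<open>An entry different from 1 contributes a digit 0, and averaging over [0,s] turns
  positivity on [0,1) into positivity everywhere. The all-ones index is excluded because its law is
  the point mass at 1.\<close>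

lemma E_pos_left:
  assumes "k \<in> That" "k i \<noteq> 1" and "cont01 f" "\<And>t. t \<in> {0..1} \<Longrightarrow> 0 \<le> Re (f t)"
    and "\<And>t. t \<in> {0..<1} \<Longrightarrow> 0 < Re (f t)"
  shows "0 < Re (E k f)"
  using assms
proof (induction i arbitrary: k f)
  case 0
  have M: "0 < Re (M0 f s)" if "s \<in> {0..1}" for s
    using M0_pos_right[OF 0(3,4), of s] 0(5)[of s] that 0(5) by (cases "s = 0") auto
  have "1 < k 0" using 0(1,2) That_simps(2)[of k 0] by simp
  show ?case
    unfolding E_M0[where k = k, OF 0(3) \<open>1 < k 0\<close>]
    by (rule E.strict_pos[OF continuous_on_M0[OF 0(3)] M])
next
  case (Suc i)
  show ?case
  proof (cases "k 0 = 1")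
    case True
    show ?thesis
      unfolding E_M1[where k = k, OF Suc.prems(3) True]
    proof (rule Suc.IH)
      show "(\<lambda>i. k (Suc i)) \<in> That" "k (Suc i) \<noteq> 1" using Suc.prems by (auto simp: That_simps)
      show "cont01 (M1 f)" by (intro continuous_intros Suc.prems)
      show "0 \<le> Re (M1 f t)" if "t \<in> {0..1}" for t
        using state.pos[OF state_M1[OF that] Suc.prems(3,4)] .
      show "0 < Re (M1 f t)" if "t \<in> {0..<1}" for t
        using M1_pos_left[OF Suc.prems(3,4) _ that] Suc.prems(5) by auto
    qed
  next
    case False
    have M: "0 < Re (M0 f s)" if "s \<in> {0..1}" for s
      using M0_pos_right[OF Suc.prems(3,4), of s] Suc.prems(5)[of s] that Suc.prems(5) by (cases "s = 0") auto
    have "1 < k 0" using False Suc.prems That_simps(2)[of k 0] by simp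
    show ?thesis
      unfolding E_M0[where k = k, OF Suc.prems(3) \<open>1 < k 0\<close>]
      by (rule E.strict_pos[OF continuous_on_M0[OF Suc.prems(3)] M])
  qed
qed

text \<open>The first digit repairs one of the two endpoints: a digit 1 leads to
  \<open>E_pos_left\<close>, a digit 0 to \<open>E_pos_right\<close>.\<close>

lemma E_pos_mid:
  assumes k: "k \<in> That" "k i \<noteq> 1" and f: "cont01 f" "\<And>t. t \<in> {0..1} \<Longrightarrow> 0 \<le> Re (f t)"
    and pos: "\<And>t. t \<in> {0<..<1} \<Longrightarrow> 0 < Re (f t)"
  shows "0 < Re (E k f)"
proof (cases "k 0 = 1")
  case True
  with k obtain j where j: "i = Suc j" by (cases i) auto
  show ?thesis
    unfolding E_M1[where k = k, OF f(1) True]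
  proof (rule E_pos_left)
    show "(\<lambda>i. k (Suc i)) \<in> That" "k (Suc j) \<noteq> 1" using k j by (auto simp: That_simps)
    show "0 \<le> Re (M1 f t)" if "t \<in> {0..1}" for t
      using state.pos[OF state_M1[OF that] f] .
  qed (auto intro!: continuous_intros f M1_pos_left pos)
next
  case False
  then have k0: "1 < k 0" using k That_simps(2)[of k 0] by simp
  show ?thesis
    unfolding E_M0[where k = k, OF f(1) k0]
  proof (rule E_pos_right)
    show "k(0 := k 0 - 1) \<in> That" using k k0 by (intro That_simps(3)) auto
    show "0 \<le> Re (M0 f t)" if "t \<in> {0..1}" for t
      using state.pos[OF state_M0[OF that] f] .
  qed (auto intro!: continuous_intros f M0_pos_right pos)
qed

section \<open>Comparison of two indices\<close>

lemma state_Im_left: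
  assumes "state L" "cont01 u"
  shows "Im (cnj (L u) * w) = Re (L (\<lambda>t. (\<i> * cnj w) * u t))"
  unfolding Im_cnj_mult_left using state.scale[OF assms] by simp

lemma state_Im_right:
  assumes "state L" "cont01 u"
  shows "Im (cnj w * L u) = Re (L (\<lambda>t. (- \<i> * cnj w) * u t))"
  unfolding Im_cnj_mult_right by (simp only: state.scale[OF assms])

lemma state_cross_nonneg:
  assumes L: "state L" "state L'" and v: "cont01 v" and w: "cont01 w"
    and "\<And>s t. s \<in> {0..1} \<Longrightarrow> t \<in> {0..1} \<Longrightarrow> 0 \<le> Im (cnj (v s) * w t)"
  shows "0 \<le> Im (cnj (L v) * L' w)"
proof -
  have 1: "0 \<le> Im (cnj (L v) * w t)" if "t \<in> {0..1}" for t
    unfolding state_Im_left[OF L(1) v]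
    using assms(5) that unfolding Im_cnj_mult_left
    by (intro state.pos[OF L(1)] continuous_intros v) auto
  show ?thesis
    unfolding state_Im_right[OF L(2) w]
    using 1 unfolding Im_cnj_mult_right
    by (intro state.pos[OF L(2)] continuous_intros w) auto
qed

lemma E_cross_pos_aux:
  assumes k: "k \<in> That" "k' \<in> That" and v: "cont01 v" and w: "cont01 w"
    and nn: "\<And>s t. s \<in> {0..1} \<Longrightarrow> t \<in> {0..1} \<Longrightarrow> 0 \<le> Im (cnj (v s) * w t)"
    and pos: "\<And>s t. s \<in> {0<..1} \<Longrightarrow> t \<in> {0<..1} \<Longrightarrow> 0 < Im (cnj (v s) * w t)"
  shows "0 < Im (cnj (E k v) * E k' w)"
proof -
  have 1: "0 \<le> Im (cnj (E k v) * w t)" if "t \<in> {0..1}" for t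
    unfolding state_Im_left[OF state_E v]
    using nn that unfolding Im_cnj_mult_left
    by (intro E.pos continuous_intros v) auto
  have 2: "0 < Im (cnj (E k v) * w t)" if "t \<in> {0<..1}" for t
    unfolding state_Im_left[OF state_E v]
    using nn pos that unfolding Im_cnj_mult_left
    by (intro E_pos_right[OF k(1)] continuous_intros v) auto
  show ?thesis
    unfolding state_Im_right[OF state_E w]
    using 1 2 unfolding Im_cnj_mult_right
    by (intro E_pos_right[OF k(2)] continuous_intros w) auto
qed

lemma ccw_M0_funpow:
  assumes "cont01 u"
  shows "ccw u \<Longrightarrow> ccw ((M0 ^^ n) u)" "strict_ccw u \<Longrightarrow> strict_ccw ((M0 ^^ n) u)"
  by (induction n) (auto intro!: ccw_M0 strict_ccw_M0 continuous_intros assms)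

lemma ccw_block:
  assumes "cont01 u"
  shows "ccw u \<Longrightarrow> ccw (block n u)" "strict_ccw u \<Longrightarrow> strict_ccw (block n u)"
  unfolding block_def by (auto intro!: ccw_M1 strict_ccw_M1 ccw_M0_funpow continuous_intros assms)

text \<open>A larger entry is a longer run of zeros before the next digit 1, so the order is
  reversed: this is the digitwise form of \<open>beta k < beta k'\<close>.\<close>

definition first_larger :: "(nat \<Rightarrow> nat) \<Rightarrow> (nat \<Rightarrow> nat) \<Rightarrow> bool" where
  "first_larger k k' \<longleftrightarrow> (\<exists>i. (\<forall>j<i. k j = k' j) \<and> k' i < k i)"

text \<open>The zeros common to both words are collected in \<open>v\<close>; then \<open>k\<close>
  reads one more digit 0 while \<open>k'\<close> reads its digit 1.\<close>

lemma E_diverge: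
  assumes k: "k \<in> That" "k' \<in> That" "k' 0 < k 0" and u: "cont01 u"
  obtains l l' v where "l \<in> That" "l' \<in> That" "v = (M0 ^^ (k' 0 - 1)) u"
    "E k u = E l (M0 v)" "E k' u = E l' (M1 v)"
proof -
  define m where "m = k' 0 - 1"
  define v where "v = (M0 ^^ m) u"
  have v: "cont01 v" unfolding v_def by (intro continuous_intros u)
  have k1: "1 \<le> k' 0" using k by (auto simp: That_def)
  have "E k u = E (k(0 := k 0 - m)) v"
    using E_M0_funpow[OF u, of m k] k m_def v_def by simp
  also have "\<dots> = E (k(0 := k 0 - m - 1)) (M0 v)"
    using E_M0[OF v, of "k(0 := k 0 - m)"] k k1 by (simp add: m_def)
  finally have 1: "E k u = E (k(0 := k 0 - m - 1)) (M0 v)" .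
  have "E k' u = E (k'(0 := k' 0 - m)) v"
    using E_M0_funpow[OF u, of m k'] k1 m_def v_def by simp
  also have "\<dots> = E (\<lambda>i. k' (Suc i)) (M1 v)"
    using E_M1[OF v, of "k'(0 := k' 0 - m)"] k1 by (simp add: m_def)
  finally have 2: "E k' u = E (\<lambda>i. k' (Suc i)) (M1 v)" .
  show ?thesis
  proof (rule that[OF _ _ _ 1 2])
    show "k(0 := k 0 - m - 1) \<in> That" using k k1 by (intro That_simps(3)) (auto simp: m_def)
    show "(\<lambda>i. k' (Suc i)) \<in> That" using k(2) by (rule That_simps(1))
    show "v = (M0 ^^ (k' 0 - 1)) u" by (simp add: v_def m_def)
  qed
qed

text \<open>Common blocks preserve \<open>ccw\<close>. At the first difference the two sides are
  averages of \<open>M0 v\<close> and \<open>M1 v\<close> for one and the same \<open>v\<close>, and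
  every cross product between these two curves has the right sign, so the laws given by the
  remaining digits can be arbitrary.\<close>

lemma E_cross:
  assumes k: "k \<in> That" "k' \<in> That" "first_larger k k'" and u: "cont01 u"
  shows "ccw u \<Longrightarrow> 0 \<le> Im (cnj (E k u) * E k' u)"
    and "strict_ccw u \<Longrightarrow> 0 < Im (cnj (E k u) * E k' u)"
proof -
  obtain i where i: "\<forall>j<i. k j = k' j" "k' i < k i" using k by (auto simp: first_larger_def)
  have "(ccw u \<longrightarrow> 0 \<le> Im (cnj (E k u) * E k' u)) \<and> (strict_ccw u \<longrightarrow> 0 < Im (cnj (E k u) * E k' u))"
    using k(1,2) i u
  proof (induction i arbitrary: k k' u)
    case 0
    from 0 have lt: "k' 0 < k 0" by simp
    obtain l l' v where l: "l \<in> That" "l' \<in> That" "v = (M0 ^^ (k' 0 - 1)) u"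
      and E: "E k u = E l (M0 v)" "E k' u = E l' (M1 v)"
      using E_diverge[OF 0(1,2) lt 0(5)] .
    have v: "cont01 v" unfolding l by (intro continuous_intros 0)
    show ?case
      unfolding E
    proof (intro conjI impI)
      assume "ccw u"
      then have "ccw v" unfolding l using 0 by (intro ccw_M0_funpow)
      then show "0 \<le> Im (cnj (E l (M0 v)) * E l' (M1 v))"
        by (intro state_cross_nonneg[OF state_E state_E] continuous_on_M0 continuous_on_M1 v
            M0_M1_cross_nonneg)
    next
      assume "strict_ccw u"
      then have "strict_ccw v" unfolding l using 0 by (intro ccw_M0_funpow)
      then show "0 < Im (cnj (E l (M0 v)) * E l' (M1 v))"
        by (intro E_cross_pos_aux[OF l(1,2)] continuous_on_M0 continuous_on_M1 v
            M0_M1_cross_nonneg M0_M1_cross_pos strict_ccwD(1))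
    qed
  next
    case (Suc i)
    have eq: "E k u = E (\<lambda>i. k (Suc i)) (block (k 0) u)" "E k' u = E (\<lambda>i. k' (Suc i)) (block (k 0) u)"
      using E_block[OF Suc.prems(5), of k] E_block[OF Suc.prems(5), of k'] Suc.prems(3) by auto
    have "(ccw (block (k 0) u) \<longrightarrow> 0 \<le> Im (cnj (E k u) * E k' u)) \<and>
        (strict_ccw (block (k 0) u) \<longrightarrow> 0 < Im (cnj (E k u) * E k' u))"
      unfolding eq using Suc.prems
      by (intro Suc.IH) (auto intro!: That_simps(1) continuous_intros)
    then show ?case using ccw_block[OF Suc.prems(5)] by blast
  qed
  then show "ccw u \<Longrightarrow> 0 \<le> Im (cnj (E k u) * E k' u)"
    and "strict_ccw u \<Longrightarrow> 0 < Im (cnj (E k u) * E k' u)" by auto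
qed

section \<open>Binary expansions and moments\<close>

text \<open>Uniqueness for functional equations that contract by 1/2 along the dynamics
  \<open>nx\<close>: a bounded discrepancy must vanish. The set \<open>P\<close> is invariant under
  \<open>nx\<close>.\<close>

lemma halving_zero:
  fixes d :: "'a \<Rightarrow> real"
  assumes step: "\<And>a. P a \<Longrightarrow> P (nx a) \<and> \<bar>d a\<bar> \<le> \<bar>d (nx a)\<bar> / 2 \<and> \<bar>d a\<bar> \<le> 1" and a: "P a"
  shows "d a = 0"
proof -
  have "\<bar>d a\<bar> \<le> 1 / 2 ^ n" for n
    using a
  proof (induction n arbitrary: a)
    case (Suc n)
    have "\<bar>d (nx a)\<bar> \<le> 1 / 2 ^ n" using Suc step by blast
    then have "\<bar>d (nx a)\<bar> / 2 \<le> 1 / 2 ^ Suc n" by simp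
    then show ?case using step[OF Suc.prems] by linarith
  qed (use step in auto)
  moreover have "(\<lambda>n. 1 / 2 ^ n) \<longlonglongrightarrow> (0::real)" by real_asymp
  ultimately have "\<bar>d a\<bar> \<le> 0" by (intro LIMSEQ_le_const) auto
  then show ?thesis by simp
qed

definition shift :: "(nat \<Rightarrow> nat) \<Rightarrow> nat \<Rightarrow> nat" where
  "shift k = (\<lambda>i. k (Suc i))"

lemma shift_That: "k \<in> That \<Longrightarrow> shift k \<in> That"
  by (simp add: shift_def That_def)

lemma sum_That_ge: "k \<in> That \<Longrightarrow> r < (\<Sum>i\<le>r. k i)"
proof (induction r)
  case 0
  then show ?case using That_simps(2)[of k 0] by simp
next
  case (Suc r)
  then show ?case using That_simps(2)[of k "Suc r"] by simp
qed

lemma beta_term_le: "k \<in> That \<Longrightarrow> 1 / 2 ^ (\<Sum>i\<le>r. k i) \<le> (1 / 2 :: real) ^ Suc r"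
  using sum_That_ge[of k r] by (simp add: power_one_over power_increasing field_simps del: power_Suc)

lemma summable_beta: "k \<in> That \<Longrightarrow> summable (\<lambda>r. 1 / 2 ^ (\<Sum>i\<le>r. k i) :: real)"
  by (rule summable_comparison_test'[where g = "\<lambda>r. (1/2) ^ Suc r" and N = 0])
    (use beta_term_le power_half_series[THEN sums_summable] in \<open>auto simp del: power_Suc\<close>)

lemma beta_pos: "k \<in> That \<Longrightarrow> 0 < beta k"
  unfolding beta_def by (rule suminf_pos[OF summable_beta]) auto

lemma beta_le_1: "k \<in> That \<Longrightarrow> beta k \<le> 1"
proof -
  assume k: "k \<in> That"
  have "(\<lambda>r. (1/2::real) ^ Suc r) sums 1" using power_half_series .
  then show ?thesis
    unfolding beta_def using suminf_le[OF beta_term_le[OF k] summable_beta[OF k]] sums_summable sums_unique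
    by metis
qed

lemma beta_rec:
  assumes k: "k \<in> That"
  shows "beta k = (1 + beta (shift k)) / 2 ^ k 0"
proof -
  have eq: "1 / 2 ^ (\<Sum>i\<le>Suc r. k i) = (1 / 2 ^ k 0) * (1 / 2 ^ (\<Sum>i\<le>r. shift k i) :: real)" for r
    by (subst sum.atMost_Suc_shift) (simp add: shift_def power_add)
  have "beta k = (\<Sum>r. 1 / 2 ^ (\<Sum>i\<le>Suc r. k i)) + 1 / 2 ^ k 0"
    unfolding beta_def using suminf_split_head[OF summable_beta[OF k]] by simp
  also have "\<dots> = (1 / 2 ^ k 0) * beta (shift k) + 1 / 2 ^ k 0"
    unfolding eq beta_def by (subst suminf_mult[OF summable_beta[OF shift_That[OF k]]]) simp
  finally show ?thesis by (simp add: field_simps)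
qed

text \<open>These half-open dyadic intervals are disjoint for different values of
  \<open>k 0\<close>, so the first entry can be read off from \<open>beta k\<close>.\<close>

lemma beta_bounds:
  assumes k: "k \<in> That"
  shows "1 / 2 ^ k 0 < beta k" "beta k \<le> 2 / 2 ^ k 0"
  unfolding beta_rec[OF k]
  using beta_pos[OF shift_That[OF k]] beta_le_1[OF shift_That[OF k]] by (simp_all add: divide_simps)

lemma beta_head_inj:
  assumes k: "k \<in> That" "k' \<in> That" "beta k = beta k'"
  shows "k 0 = k' 0"
proof -
  have "\<not> l 0 < l' 0" if "l \<in> That" "l' \<in> That" "beta l = beta l'" for l l'
  proof
    assume "l 0 < l' 0"
    then have "(2::real) ^ Suc (l 0) \<le> 2 ^ l' 0" by (intro power_increasing) auto
    then have "2 / 2 ^ l' 0 \<le> (1::real) / 2 ^ l 0" by (simp add: field_simps)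
    then show False using beta_bounds(1)[OF that(1)] beta_bounds(2)[OF that(2)] that(3) by linarith
  qed
  from this[OF k] this[OF k(2,1)] k(3) show ?thesis by simp
qed

lemma beta_inj_aux:
  assumes "k \<in> That" "k' \<in> That" "beta k = beta k'"
  shows "k i = k' i"
  using assms
proof (induction i arbitrary: k k')
  case 0
  then show ?case by (rule beta_head_inj)
next
  case (Suc i)
  have "beta (shift k) = beta (shift k')"
    using Suc.prems(3) beta_rec[OF Suc.prems(1)] beta_rec[OF Suc.prems(2)] beta_head_inj[OF Suc.prems] by simp
  then have "shift k i = shift k' i" using Suc.IH shift_That Suc.prems by blast
  then show ?case by (simp add: shift_def)
qed

lemma beta_inj: "inj_on beta That"
  by (rule inj_onI) (use beta_inj_aux in blast)

lemma beta_surj: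
  assumes x: "0 < x" "x \<le> 1"
  obtains k where "k \<in> That" "beta k = x"
proof -
  \<comment> \<open>\<open>K\<close> is the position of the first digit 1 and \<open>T\<close>
    deletes the digits up to it. The strict inequality selects the expansion with infinitely many
    digits 1, so \<open>T\<close> never reaches 0.\<close>
  define K where "K = (\<lambda>x::real. LEAST n. 1 < 2 ^ n * x)"
  define T where "T = (\<lambda>x::real. 2 ^ K x * x - 1)"
  have K: "1 < 2 ^ K x * x \<and> 2 ^ K x * x \<le> 2 \<and> 1 \<le> K x" if "0 < x" "x \<le> 1" for x
  proof -
    obtain n where "1 / x < 2 ^ n" using real_arch_pow[of 2 "1/x"] by auto
    then have "1 < 2 ^ n * x" using that by (simp add: field_simps)
    then have 1: "1 < 2 ^ K x * x" unfolding K_def by (rule LeastI)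
    have "K x \<noteq> 0"
    proof
      assume "K x = 0"
      then show False using 1 that by simp
    qed
    then obtain m where m: "K x = Suc m" using not0_implies_Suc by blast
    then have "\<not> 1 < 2 ^ m * x"
      unfolding K_def by (metis lessI not_less_Least)
    then show ?thesis using 1 m by simp
  qed
  have T: "0 < T x \<and> T x \<le> 1" if "0 < x" "x \<le> 1" for x using K[OF that] by (simp add: T_def)
  define kx where "kx = (\<lambda>x i. K ((T ^^ i) x))"
  have Ti: "0 < (T ^^ i) x \<and> (T ^^ i) x \<le> 1" if "0 < x" "x \<le> 1" for i x
    by (induction i) (use that T in auto)
  have kx: "kx x \<in> That" if "0 < x" "x \<le> 1" for x
    using K Ti that by (auto simp: That_def kx_def)
  have sh: "shift (kx x) = kx (T x)" for x
    by (auto simp: shift_def kx_def funpow_swap1)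
  have "beta (kx x) - x = 0"
  proof (rule halving_zero[where nx = T and P = "\<lambda>x. 0 < x \<and> x \<le> 1"
        and d = "\<lambda>x. beta (kx x) - x" and a = x])
    fix x :: real assume x: "0 < x \<and> x \<le> 1"
    have "x = (1 + T x) / 2 ^ K x" by (simp add: T_def)
    moreover have "beta (kx x) = (1 + beta (kx (T x))) / 2 ^ K x"
      using beta_rec[OF kx, of x] x by (simp add: sh) (simp add: kx_def)
    ultimately have "beta (kx x) - x = (beta (kx (T x)) - T x) / 2 ^ K x"
      by (metis add_diff_cancel_left diff_divide_distrib)
    then have "\<bar>beta (kx x) - x\<bar> = \<bar>beta (kx (T x)) - T x\<bar> / 2 ^ K x" by simp
    also have "\<dots> \<le> \<bar>beta (kx (T x)) - T x\<bar> / 2 ^ 1"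
      using K x by (intro divide_left_mono power_increasing) auto
    finally have "\<bar>beta (kx x) - x\<bar> \<le> \<bar>beta (kx (T x)) - T x\<bar> / 2" by simp
    moreover have "\<bar>beta (kx x) - x\<bar> \<le> 1"
    proof -
      have "kx x \<in> That" using kx x by blast
      then show ?thesis using beta_pos[of "kx x"] beta_le_1[of "kx x"] x by linarith
    qed
    ultimately show "(0 < T x \<and> T x \<le> 1) \<and> \<bar>beta (kx x) - x\<bar> \<le> \<bar>beta (kx (T x)) - T x\<bar> / 2 \<and> \<bar>beta (kx x) - x\<bar> \<le> 1"
      using T x by blast
  qed (use x in auto)
  then show ?thesis using that[of "kx x"] kx x by auto
qed

lemma beta_image: "beta ` That = {0<..1}"
proof
  show "beta ` That \<subseteq> {0<..1}" using beta_pos beta_le_1 by auto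
  show "{0<..1} \<subseteq> beta ` That" by (auto elim!: beta_surj)
qed

section \<open>Moments\<close>

lemma pow_antiderivative:
  "((\<lambda>t. of_real t ^ Suc n / of_nat (Suc n)) has_vector_derivative complex_of_real t ^ n) (at t within A)"
proof -
  have "((\<lambda>z. z ^ Suc n / of_nat (Suc n)) has_field_derivative z ^ n) (at z)" for z :: complex
    using DERIV_cdivide[OF DERIV_power[OF DERIV_ident[of "at z"], of "Suc n"], of "of_nat (Suc n)"]
    by (simp del: of_nat_Suc power_Suc)
  then show ?thesis by (rule has_vector_derivative_real_field)
qed

lemma M0_of_real_pow: "s \<in> {0..1} \<Longrightarrow> M0 (\<lambda>t. of_real t ^ n) s = of_real s ^ n / of_nat (Suc n)"
proof -
  assume s: "s \<in> {0..1}"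
  show ?thesis
  proof (cases "s = 0")
    case True
    then show ?thesis by (cases n) auto
  next
    case False
    have "of_real (s - 0) * avg 0 s (\<lambda>t. of_real t ^ n)
        = of_real s ^ Suc n / of_nat (Suc n) - of_real 0 ^ Suc n / of_nat (Suc n)"
      using s by (intro avg_FTC pow_antiderivative) auto
    then show ?thesis using False by (simp add: M0_def field_simps del: of_nat_Suc)
  qed
qed

lemma M1_of_real_pow:
  assumes s: "s \<in> {0..1}"
  shows "M1 (\<lambda>t. of_real t ^ n) s = (\<Sum>j\<le>n. of_real s ^ j) / of_nat (Suc n)"
proof (cases "s = 1")
  case False
  have "of_real (1 - s) * avg s 1 (\<lambda>t. of_real t ^ n)
      = of_real 1 ^ Suc n / of_nat (Suc n) - of_real s ^ Suc n / of_nat (Suc n)"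
    using s by (intro avg_FTC pow_antiderivative) auto
  moreover have "(1 - of_real s) * (\<Sum>j\<le>n. complex_of_real s ^ j) = 1 - of_real s ^ Suc n"
    by (rule sum_gp_basic)
  ultimately have "(1 - of_real s) * M1 (\<lambda>t. of_real t ^ n) s
      = (1 - of_real s) * ((\<Sum>j\<le>n. complex_of_real s ^ j) / of_nat (Suc n))"
    by (simp add: M1_def diff_divide_distrib[symmetric] del: of_nat_Suc)
  moreover have "1 - complex_of_real s \<noteq> 0" using False by auto
  ultimately show ?thesis using mult_left_cancel by blast
next
  case True
  have "1 + complex_of_nat n \<noteq> 0" by (metis of_nat_Suc of_nat_neq_0)
  then show ?thesis using True by simp
qed

definition mom :: "(nat \<Rightarrow> nat) \<Rightarrow> nat \<Rightarrow> real" where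
  "mom k n = Re (E k (\<lambda>t. of_real t ^ n))"

lemma cont_of_real_pow: "continuous_on A (\<lambda>t. complex_of_real t ^ n)"
  by (intro continuous_intros)

lemma E_of_real_pow: "E k (\<lambda>t. of_real t ^ n) = of_real (mom k n)"
  using state.real[OF state_E[of k] cont_of_real_pow[of _ n]]
  by (auto simp: mom_def complex_eq_iff simp flip: of_real_power)

lemma mom_bounds: "0 \<le> mom k n" "mom k n \<le> 1"
proof -
  show "0 \<le> mom k n"
    unfolding mom_def by (rule E.pos[OF cont_of_real_pow]) (simp flip: of_real_power)
  have "Re (E k (\<lambda>t. of_real t ^ n)) \<le> Re (E k (\<lambda>t. 1))"
    by (rule E.mono[OF cont_of_real_pow])
      (auto simp flip: of_real_power simp: power_le_one)
  then show "mom k n \<le> 1" by (simp add: mom_def E.unit)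
qed

lemma mom_0 [simp]: "mom k 0 = 1"
  by (simp add: mom_def E.unit)

lemma mom_M0:
  assumes "1 < k 0"
  shows "mom k n = mom (k(0 := k 0 - 1)) n / Suc n"
proof -
  have "E k (\<lambda>t. of_real t ^ n) = E (k(0 := k 0 - 1)) (\<lambda>s. (1 / of_nat (Suc n)) * of_real s ^ n)"
    unfolding E_M0[where k = k, OF cont_of_real_pow assms]
    by (intro E.cong continuous_intros) (simp add: M0_of_real_pow)
  also have "\<dots> = of_real (mom (k(0 := k 0 - 1)) n / Suc n)"
    by (subst E.scale[OF cont_of_real_pow]) (simp add: E_of_real_pow)
  finally show ?thesis by (simp only: E_of_real_pow of_real_eq_iff)
qed

lemma mom_M1:
  assumes "k 0 = 1"
  shows "mom k n = (\<Sum>j\<le>n. mom (shift k) j) / Suc n"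
proof -
  have "E k (\<lambda>t. of_real t ^ n) = E (shift k) (\<lambda>s. (1 / of_nat (Suc n)) * (\<Sum>j\<le>n. of_real s ^ j))"
    unfolding E_M1[where k = k, OF cont_of_real_pow assms] shift_def
    by (intro E.cong continuous_intros) (simp add: M1_of_real_pow)
  also have "\<dots> = of_real ((\<Sum>j\<le>n. mom (shift k) j) / Suc n)"
    by (subst E.scale, intro continuous_intros, subst E.sum)
      (auto simp: E_of_real_pow intro!: continuous_intros)
  finally show ?thesis by (simp only: E_of_real_pow of_real_eq_iff)
qed

lemma mom_1_rec:
  assumes "k \<in> That"
  shows "mom k 1 = (1 + mom (shift k) 1) / 2 ^ k 0"
  using assms
proof (induction "k 0" arbitrary: k)
  case 0
  then show ?case using That_simps(2)[of k 0] by simp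
next
  case (Suc n)
  show ?case
  proof (cases "n = 0")
    case True
    then have "k 0 = 1" using Suc.hyps(2) by simp
    then show ?thesis by (simp add: mom_M1)
  next
    case False
    have "mom (k(0 := n)) 1 = (1 + mom (shift (k(0 := n))) 1) / 2 ^ n"
      using Suc(1)[of "k(0 := n)"] Suc.prems False That_simps(3)[of k n] by simp
    moreover have "shift (k(0 := n)) = shift k" by (auto simp: shift_def)
    moreover have "mom k 1 = mom (k(0 := k 0 - 1)) 1 / 2"
      using mom_M0[of k 1] Suc.hyps(2) False by simp
    ultimately show ?thesis using Suc.hyps(2)[symmetric] by simp
  qed
qed

lemma mom_1: "k \<in> That \<Longrightarrow> mom k 1 = beta k"
proof -
  assume "k \<in> That"
  then have "mom k 1 - beta k = 0"
  proof (rule halving_zero[where nx = shift and P = "\<lambda>k. k \<in> That"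
        and d = "\<lambda>k. mom k 1 - beta k" and a = k, rotated])
    fix k assume k: "k \<in> That"
    have "mom k 1 - beta k = (mom (shift k) 1 - beta (shift k)) / 2 ^ k 0"
      using mom_1_rec[OF k] beta_rec[OF k] by (simp add: diff_divide_distrib add_divide_distrib)
    then have "\<bar>mom k 1 - beta k\<bar> = \<bar>mom (shift k) 1 - beta (shift k)\<bar> / 2 ^ k 0" by simp
    also have "\<dots> \<le> \<bar>mom (shift k) 1 - beta (shift k)\<bar> / 2 ^ 1"
      using That_simps(2)[OF k, of 0] by (intro divide_left_mono power_increasing) auto
    finally show "shift k \<in> That \<and> \<bar>mom k 1 - beta k\<bar> \<le> \<bar>mom (shift k) 1 - beta (shift k)\<bar> / 2
        \<and> \<bar>mom k 1 - beta k\<bar> \<le> 1"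
      using mom_bounds[of k 1] beta_pos[OF k] beta_le_1[OF k] shift_That[OF k] by auto
  qed
  then show ?thesis by simp
qed

section \<open>Monotone and Lipschitz dependence on beta\<close>

text \<open>On the line of real part 1 the cross product of two points is the difference of their
  heights. Stochastic order on real monotone functions thus becomes a special case of
  \<open>E_cross\<close>.\<close>

lemma ccw_of_mono:
  assumes "\<And>s t. 0 \<le> s \<Longrightarrow> s < t \<Longrightarrow> t \<le> 1 \<Longrightarrow> f s \<le> (f t :: real)"
  shows "ccw (\<lambda>t. Complex 1 (f t))"
  using assms by (auto simp: ccw_def)

lemma E_Complex_1:
  assumes "cont01 f"
  shows "E k (\<lambda>t. Complex 1 (f t)) = Complex 1 (Re (E k (\<lambda>t. of_real (f t))))"
proof -
  have c: "cont01 (\<lambda>t. complex_of_real (f t))" by (intro continuous_intros assms)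
  have "E k (\<lambda>t. Complex 1 (f t)) = E k (\<lambda>t. 1 + \<i> * of_real (f t))"
    by (rule arg_cong[of _ _ "E k"]) (auto simp: complex_eq_iff)
  also have "\<dots> = 1 + \<i> * E k (\<lambda>t. of_real (f t))"
    by (subst E.add) (auto intro!: continuous_intros c simp: E.unit E.scale[OF c])
  also have "\<dots> = Complex 1 (Re (E k (\<lambda>t. of_real (f t))))"
    using E.real[OF c] by (simp add: complex_eq_iff)
  finally show ?thesis .
qed

text \<open>The mean of the curve 1 + it is 1 + i \<open>beta k\<close>, so \<open>E_cross\<close>
  yields one direction; distinct indices are always comparable by \<open>first_larger\<close>, which
  yields the other.\<close>

lemma beta_less_iff:
  assumes k: "k \<in> That" "k' \<in> That"
  shows "beta k < beta k' \<longleftrightarrow> first_larger k k'"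
proof -
  have 1: "beta l < beta l'" if "l \<in> That" "l' \<in> That" "first_larger l l'" for l l'
  proof -
    have "strict_ccw (\<lambda>t. Complex 1 t)"
      using ccw_of_mono[of "\<lambda>t. t"] by (auto simp: strict_ccw_def)
    moreover have "cont01 (\<lambda>t. Complex 1 t)"
      unfolding complex_eq by (intro continuous_intros)
    ultimately have "0 < Im (cnj (E l (\<lambda>t. Complex 1 t)) * E l' (\<lambda>t. Complex 1 t))"
      using E_cross(2) that by blast
    then show ?thesis
      using mom_1[OF that(1)] mom_1[OF that(2)] by (simp add: E_Complex_1 mom_def)
  qed
  have 2: "first_larger k k' \<or> first_larger k' k" if "k \<noteq> k'"
  proof -
    define i where "i = (LEAST i. k i \<noteq> k' i)"
    obtain m where "k m \<noteq> k' m" using \<open>k \<noteq> k'\<close> by (auto simp: fun_eq_iff)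
    then have "k i \<noteq> k' i" unfolding i_def by (rule LeastI)
    moreover have "k j = k' j" if "j < i" for j using not_less_Least that unfolding i_def by blast
    ultimately show ?thesis unfolding first_larger_def by (metis linorder_neqE_nat)
  qed
  show ?thesis
    using 1[OF k] 1[OF k(2,1)] 2 by (metis less_asym less_irrefl)
qed

lemma E_cross_le:
  assumes k: "k \<in> That" "k' \<in> That" "beta k \<le> beta k'" and u: "cont01 u" "ccw u"
  shows "0 \<le> Im (cnj (E k u) * E k' u)"
proof (cases "beta k = beta k'")
  case True
  then have "k = k'" using k beta_inj by (auto dest: inj_onD)
  then show ?thesis by simp
next
  case False
  then show ?thesis using E_cross(1)[OF k(1,2) _ u] k beta_less_iff[OF k(1,2)] by simp
qed

lemma E_cross_less:
  assumes k: "k \<in> That" "k' \<in> That" "beta k < beta k'" and u: "cont01 u" "strict_ccw u"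
  shows "0 < Im (cnj (E k u) * E k' u)"
  using E_cross(2)[OF k(1,2) _ u] k beta_less_iff[OF k(1,2)] by simp

lemma E_mono:
  assumes k: "k \<in> That" "k' \<in> That" "beta k \<le> beta k'" and f: "cont01 f"
    and mono: "\<And>s t. 0 \<le> s \<Longrightarrow> s < t \<Longrightarrow> t \<le> 1 \<Longrightarrow> f s \<le> (f t :: real)"
  shows "Re (E k (\<lambda>t. of_real (f t))) \<le> Re (E k' (\<lambda>t. of_real (f t)))"
proof -
  have "cont01 (\<lambda>t. Complex 1 (f t))"
    unfolding complex_eq by (intro continuous_intros f)
  from E_cross_le[OF k this ccw_of_mono[OF mono]] show ?thesis
    by (simp add: E_Complex_1[OF f])
qed

lemma E_strict_mono:
  assumes k: "k \<in> That" "k' \<in> That" "beta k < beta k'" and f: "cont01 f"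
    and mono: "\<And>s t. 0 \<le> s \<Longrightarrow> s < t \<Longrightarrow> t \<le> 1 \<Longrightarrow> f s < (f t :: real)"
  shows "Re (E k (\<lambda>t. of_real (f t))) < Re (E k' (\<lambda>t. of_real (f t)))"
proof -
  have c: "cont01 (\<lambda>t. Complex 1 (f t))"
    unfolding complex_eq by (intro continuous_intros f)
  have "strict_ccw (\<lambda>t. Complex 1 (f t))"
    unfolding strict_ccw_def using mono by (intro conjI ccw_of_mono) (auto intro: less_imp_le)
  from E_cross_less[OF k c this] show ?thesis
    by (simp add: E_Complex_1[OF f])
qed

text \<open>Both \<open>C * t + f t\<close> and \<open>C * t - f t\<close> are nondecreasing, and
  the mean of t is beta. Comparing their expectations bounds the change of \<open>E k f\<close> from
  both sides.\<close>

lemma E_lipschitz_real: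
  assumes k: "k \<in> That" "k' \<in> That" "beta k \<le> beta k'" and f: "cont01 f"
    and C: "\<And>s t. s \<in> {0..1} \<Longrightarrow> t \<in> {0..1} \<Longrightarrow> \<bar>f s - f t\<bar> \<le> C * \<bar>s - t\<bar>"
  shows "\<bar>Re (E k' (\<lambda>t. of_real (f t))) - Re (E k (\<lambda>t. of_real (f t)))\<bar> \<le> C * (beta k' - beta k)"
proof -
  have *: "Re (E l (\<lambda>t. of_real (C * t + c * f t))) = C * beta l + c * Re (E l (\<lambda>t. of_real (f t)))"
    if "l \<in> That" for l c
  proof -
    have "E l (\<lambda>t. of_real (C * t + c * f t))
        = of_real C * E l (\<lambda>t. of_real t ^ 1) + of_real c * E l (\<lambda>t. of_real (f t))"
      by (simp add: E.add E.scale continuous_intros f)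
    then show ?thesis using mom_1[OF that] by (simp only: E_of_real_pow) simp
  qed
  have c: "cont01 (\<lambda>t. C * t + c * f t)" for c by (intro continuous_intros f)
  have "C * s + f s \<le> C * t + f t" "C * s - f s \<le> C * t - f t" if "0 \<le> s" "s < t" "t \<le> 1" for s t
    using C[of s t] that by (auto simp: algebra_simps abs_if split: if_splits)
  then have "Re (E k (\<lambda>t. of_real (C * t + c * f t))) \<le> Re (E k' (\<lambda>t. of_real (C * t + c * f t)))"
    if "c = 1 \<or> c = -1" for c
    using that by (intro E_mono[OF k c]) auto
  from this[of 1] this[of "-1"]
  have "C * beta k + 1 * Re (E k (\<lambda>t. of_real (f t))) \<le> C * beta k' + 1 * Re (E k' (\<lambda>t. of_real (f t)))"
    "C * beta k + -1 * Re (E k (\<lambda>t. of_real (f t))) \<le> C * beta k' + -1 * Re (E k' (\<lambda>t. of_real (f t)))"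
    unfolding *[OF k(1)] *[OF k(2)] by auto
  then show ?thesis
    by (simp add: algebra_simps abs_le_iff)
qed

lemma E_lipschitz:
  assumes k: "k \<in> That" "k' \<in> That" and f: "cont01 f"
    and C: "\<And>s t. s \<in> {0..1} \<Longrightarrow> t \<in> {0..1} \<Longrightarrow> norm (f s - f t) \<le> C * \<bar>s - t\<bar>"
  shows "norm (E k f - E k' f) \<le> 2 * C * \<bar>beta k - beta k'\<bar>"
proof -
  have 1: "norm (E l' f - E l f) \<le> 2 * (C * (beta l' - beta l))"
    if l: "l \<in> That" "l' \<in> That" "beta l \<le> beta l'" for l l'
  proof -
    have c: "cont01 (\<lambda>t. Re (f t))" "cont01 (\<lambda>t. Im (f t))"
      by (intro continuous_intros f)+
    have *: "E m f = E m (\<lambda>t. of_real (Re (f t))) + \<i> * E m (\<lambda>t. of_real (Im (f t)))" for m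
    proof -
      have "E m f = E m (\<lambda>t. of_real (Re (f t)) + \<i> * of_real (Im (f t)))"
        by (rule arg_cong[of _ _ "E m"]) (auto simp: complex_eq_iff)
      then show ?thesis
        by (simp add: E.add E.scale continuous_intros c)
    qed
    have i: "Im (E m (\<lambda>t. of_real (Re (f t)))) = 0" "Im (E m (\<lambda>t. of_real (Im (f t)))) = 0" for m
      by (intro E.real continuous_intros c; simp)+
    have "\<bar>Re (E l' (\<lambda>t. of_real (Re (f t)))) - Re (E l (\<lambda>t. of_real (Re (f t))))\<bar> \<le> C * (beta l' - beta l)"
      by (rule E_lipschitz_real[OF l c(1)]) (metis C abs_Re_le_cmod minus_complex.sel(1) order_trans)
    moreover have "\<bar>Re (E l' (\<lambda>t. of_real (Im (f t)))) - Re (E l (\<lambda>t. of_real (Im (f t))))\<bar> \<le> C * (beta l' - beta l)"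
      by (rule E_lipschitz_real[OF l c(2)]) (metis C abs_Im_le_cmod minus_complex.sel(2) order_trans)
    moreover have "norm (E l' f - E l f) \<le> \<bar>Re (E l' f - E l f)\<bar> + \<bar>Im (E l' f - E l f)\<bar>"
      by (rule cmod_le)
    ultimately show ?thesis using *[of l] *[of l'] i[of l] i[of l'] by simp
  qed
  show ?thesis
    using 1[OF k] 1[OF k(2,1)] by (cases "beta k \<le> beta k'") (auto simp: norm_minus_commute)
qed

section \<open>The kernel\<close>

lemma slit_plane_iff: "z \<in> slit_plane \<longleftrightarrow> Im z \<noteq> 0 \<or> Re z < 1"
proof -
  have "z \<in> complex_of_real ` {1..} \<longleftrightarrow> Im z = 0 \<and> 1 \<le> Re z"
    by (auto simp: image_iff complex_eq_iff intro: exI[of _ "Re z"])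
  then show ?thesis by (auto simp: slit_plane_def)
qed

lemma open_slit_plane: "open slit_plane"
proof -
  have "slit_plane = - ({z. Im z = 0} \<inter> {z. 1 \<le> Re z})"
    by (auto simp: slit_plane_iff)
  moreover have "closed ({z. Im z = 0} \<inter> {z. 1 \<le> Re z})"
    by (intro closed_Int closed_halfspace_Re_ge closed_Collect_eq continuous_intros)
  ultimately show ?thesis by (metis open_Compl)
qed

lemma slit_plane_denom:
  assumes "z \<in> slit_plane" "t \<in> {0..1}"
  shows "1 - of_real t * z \<noteq> 0"
proof
  assume "1 - of_real t * z = 0"
  then have "t * Re z = 1" "t * Im z = 0" by (auto simp: complex_eq_iff)
  moreover from this have t: "t \<noteq> 0" by auto
  ultimately have "Im z = 0" "Re z = 1 / t" by (auto simp: field_simps)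
  then show False using assms t by (auto simp: slit_plane_iff divide_less_eq)
qed

lemma slit_plane_denom_bound:
  assumes "z \<in> slit_plane"
  obtains d where "0 < d" "\<And>t. t \<in> {0..1} \<Longrightarrow> d \<le> norm (1 - of_real t * z)"
proof -
  have "\<exists>x\<in>{0..1::real}. \<forall>y\<in>{0..1}. norm (1 - of_real x * z) \<le> norm (1 - of_real y * z)"
    by (intro continuous_attains_inf) (auto intro!: continuous_intros)
  then obtain x where "x \<in> {0..1}" "\<And>y. y \<in> {0..1} \<Longrightarrow> norm (1 - of_real x * z) \<le> norm (1 - of_real y * z)"
    by blast
  then show ?thesis using that[of "norm (1 - of_real x * z)"] slit_plane_denom[OF assms, of x] by auto
qed

definition ker :: "complex \<Rightarrow> real \<Rightarrow> complex" where
  "ker z t = 1 / (1 - of_real t * z)"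

lemma ker_cont [continuous_intros]: "z \<in> slit_plane \<Longrightarrow> cont01 (ker z)"
  unfolding ker_def[abs_def] by (intro continuous_intros ballI slit_plane_denom)

text \<open>The difference quotient minus the proposed derivative has an integrand w t^2 h / (a^2
  b), which is O(h) uniformly in t. The weight lets one computation serve both \<open>LiS\<close>
  and \<open>qLiS\<close>.\<close>

lemma (in state) ker_deriv:
  assumes w: "cont01 w" and z: "z \<in> slit_plane"
  shows "((\<lambda>z. L (\<lambda>t. w t * ker z t)) has_field_derivative L (\<lambda>t. w t * (of_real t * (ker z t)\<^sup>2))) (at z)"
proof -
  obtain d where d: "0 < d" "\<And>t. t \<in> {0..1} \<Longrightarrow> d \<le> norm (1 - of_real t * z)"
    using slit_plane_denom_bound[OF z] by blast
  have "bounded (w ` {0..1})"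
    using w by (intro compact_imp_bounded compact_continuous_image) auto
  then obtain B where B: "0 < B" "\<And>t. t \<in> {0..1} \<Longrightarrow> norm (w t) \<le> B"
    unfolding bounded_pos by auto
  have "((\<lambda>h. (L (\<lambda>t. w t * ker (z + h) t) - L (\<lambda>t. w t * ker z t)) / h
      - L (\<lambda>t. w t * (of_real t * (ker z t)\<^sup>2))) \<longlongrightarrow> 0) (at 0)"
  proof (rule Lim_null_comparison)
    show "((\<lambda>h::complex. norm h * (2 * B / d ^ 3)) \<longlongrightarrow> 0) (at 0)"
      using d(1) by (auto intro!: tendsto_eq_intros)
    have "eventually (\<lambda>h. z + h \<in> slit_plane) (at 0)"
    proof -
      have "((\<lambda>h. z + h) \<longlongrightarrow> z + 0) (at 0)" by (intro tendsto_intros)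
      then show ?thesis using topological_tendstoD[OF _ open_slit_plane] z by fastforce
    qed
    moreover have "eventually (\<lambda>h::complex. h \<noteq> 0 \<and> norm h < d / 2) (at 0)"
      unfolding eventually_at using d(1) by (intro exI[of _ "d/2"]) auto
    ultimately show "eventually (\<lambda>h. norm ((L (\<lambda>t. w t * ker (z + h) t) - L (\<lambda>t. w t * ker z t)) / h
      - L (\<lambda>t. w t * (of_real t * (ker z t)\<^sup>2))) \<le> norm h * (2 * B / d ^ 3)) (at 0)"
    proof eventually_elim
      case (elim h)
      define q where "q = (\<lambda>t. 1 / h * (w t * ker (z + h) t - w t * ker z t) - w t * (of_real t * (ker z t)\<^sup>2))"
      have qc: "cont01 q"
        unfolding q_def using elim z by (auto intro!: continuous_intros w)
      have "L q = (L (\<lambda>t. w t * ker (z + h) t) - L (\<lambda>t. w t * ker z t)) / h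
          - L (\<lambda>t. w t * (of_real t * (ker z t)\<^sup>2))"
        unfolding q_def using elim z
        by (subst diff | subst scale | intro continuous_intros w | simp)+
      moreover have "norm (L q) \<le> norm h * (2 * B / d ^ 3)"
      proof (rule norm_bound[OF qc])
        fix t :: real assume t: "t \<in> {0..1}"
        define a b where "a = 1 - of_real t * z" and "b = 1 - of_real t * (z + h)"
        have ab: "a \<noteq> 0" "b \<noteq> 0"
          using slit_plane_denom elim z t unfolding a_def b_def by auto
        have b: "b = a - of_real t * h" by (simp add: a_def b_def algebra_simps)
        have nb: "d / 2 \<le> norm b"
        proof -
          have "norm (of_real t * h) \<le> 1 * norm h"
            unfolding norm_mult using t by (intro mult_right_mono) auto
          then show ?thesis
            using d(2)[OF t] elim norm_triangle_ineq2[of a "of_real t * h"] unfolding b a_def by linarith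
        qed
        have "q t = w t * (of_real t)\<^sup>2 * h / (a\<^sup>2 * b)"
        proof -
          have "q t = w t * (1 / h * (1 / b - 1 / a) - of_real t / a\<^sup>2)"
            by (simp add: q_def ker_def a_def b_def algebra_simps power_divide)
          also have "1 / b - 1 / a = of_real t * h / (a * b)"
            using ab by (simp add: b field_simps)
          also have "1 / h * (of_real t * h / (a * b)) - of_real t / a\<^sup>2 = of_real t * (a - b) / (a\<^sup>2 * b)"
            using ab elim by (simp add: field_simps power2_eq_square)
          also have "a - b = of_real t * h" by (simp add: b)
          finally show ?thesis by (simp add: power2_eq_square algebra_simps)
        qed
        then have "norm (q t) = norm (w t) * t\<^sup>2 * norm h / ((norm a)\<^sup>2 * norm b)"
          by (simp add: norm_mult norm_divide norm_power)
        also have "\<dots> \<le> B * 1 * norm h / (d\<^sup>2 * (d / 2))"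
        proof (intro frac_le mult_mono)
          show "t\<^sup>2 \<le> 1" using t by (simp add: power_le_one)
          show "d\<^sup>2 \<le> (norm a)\<^sup>2" using d t unfolding a_def by (intro power_mono) auto
        qed (use B t nb d in auto)
        also have "\<dots> = norm h * (2 * B / d ^ 3)"
          by (simp add: power3_eq_cube power2_eq_square)
        finally show "norm (q t) \<le> norm h * (2 * B / d ^ 3)" .
      qed
      ultimately show ?case by simp
    qed
  qed
  then show ?thesis unfolding DERIV_def by (simp add: LIM_zero_iff)
qed

text \<open>
  \<open>LiS k\<close> is the function of the infinite index \<open>k\<close>, \<open>dLiS k\<close> its derivative and
  \<open>qLiS k z\<close> the quotient \<open>(LiS k z - 1) / z\<close>.
\<close>

definition LiS :: "(nat \<Rightarrow> nat) \<Rightarrow> complex \<Rightarrow> complex" where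
  "LiS k z = E k (ker z)"

definition qLiS :: "(nat \<Rightarrow> nat) \<Rightarrow> complex \<Rightarrow> complex" where
  "qLiS k z = E k (\<lambda>t. of_real t * ker z t)"

definition dLiS :: "(nat \<Rightarrow> nat) \<Rightarrow> complex \<Rightarrow> complex" where
  "dLiS k z = E k (\<lambda>t. of_real t * (ker z t)\<^sup>2)"

lemma ker_identity: "z \<in> slit_plane \<Longrightarrow> t \<in> {0..1} \<Longrightarrow> ker z t = 1 + z * (of_real t * ker z t)"
  using slit_plane_denom[of z t] by (simp add: ker_def field_simps)

lemma LiS_eq_qLiS:
  assumes z: "z \<in> slit_plane"
  shows "LiS k z = 1 + z * qLiS k z"
proof -
  have "LiS k z = E k (\<lambda>t. 1 + z * (of_real t * ker z t))"
    unfolding LiS_def using z by (intro E.cong ker_cont ker_identity)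
  also have "\<dots> = 1 + z * qLiS k z"
    unfolding qLiS_def using z
    by (simp add: E.add E.scale E.unit continuous_intros)
  finally show ?thesis .
qed

lemma LiS_deriv: "z \<in> slit_plane \<Longrightarrow> (LiS k has_field_derivative dLiS k z) (at z)"
  using state.ker_deriv[OF state_E, of "\<lambda>t. 1" z k] by (simp add: LiS_def[abs_def] dLiS_def)

lemma qLiS_deriv:
  "z \<in> slit_plane \<Longrightarrow> (qLiS k has_field_derivative E k (\<lambda>t. of_real t * (of_real t * (ker z t)\<^sup>2))) (at z)"
  using state.ker_deriv[OF state_E, of "\<lambda>t. of_real t" z k] by (simp add: qLiS_def[abs_def] continuous_intros)

lemma LiS_holomorphic: "LiS k holomorphic_on slit_plane"
  using LiS_deriv open_slit_plane by (auto simp: holomorphic_on_open)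

lemma qLiS_holomorphic: "qLiS k holomorphic_on slit_plane"
  using qLiS_deriv open_slit_plane by (auto simp: holomorphic_on_open)

lemma dLiS_holomorphic: "dLiS k holomorphic_on slit_plane"
proof (rule holomorphic_transform)
  show "deriv (LiS k) holomorphic_on slit_plane"
    by (rule holomorphic_deriv[OF LiS_holomorphic open_slit_plane])
  show "deriv (LiS k) z = dLiS k z" if "z \<in> slit_plane" for z
    using LiS_deriv[OF that] by (rule DERIV_imp_deriv)
qed

text \<open>The derivative of \<open>1 + z * qLiS k z\<close>. Hence
  \<open>dLiS k z / qLiS k z\<close> is z f'/(f - 1) for f = \<open>LiS k\<close>, the quotient
  whose real part measures starlikeness with respect to 1.\<close>

lemma dLiS_eq_qLiS:
  assumes z: "z \<in> slit_plane"
  shows "dLiS k z = qLiS k z + z * deriv (qLiS k) z"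
proof -
  have d: "deriv (qLiS k) z = E k (\<lambda>t. of_real t * (of_real t * (ker z t)\<^sup>2))"
    using qLiS_deriv[OF z] by (rule DERIV_imp_deriv)
  have c: "cont01 (\<lambda>t. of_real t * ker z t)"
      "cont01 (\<lambda>t. of_real t * (of_real t * (ker z t)\<^sup>2))"
      "cont01 (\<lambda>t. of_real t * (ker z t)\<^sup>2)"
    by (intro continuous_intros z)+
  have "dLiS k z = E k (\<lambda>t. of_real t * ker z t + z * (of_real t * (of_real t * (ker z t)\<^sup>2)))"
    unfolding dLiS_def
  proof (rule E.cong[OF c(3)])
    fix t :: real assume t: "t \<in> {0..1}"
    have "of_real t * (ker z t)\<^sup>2 = of_real t * ker z t * ker z t"
      by (simp add: power2_eq_square)
    also have "\<dots> = of_real t * ker z t * (1 + z * (of_real t * ker z t))"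
      using ker_identity[OF z t] by simp
    finally show "of_real t * (ker z t)\<^sup>2 = of_real t * ker z t + z * (of_real t * (of_real t * (ker z t)\<^sup>2))"
      by (simp add: algebra_simps power2_eq_square)
  qed
  also have "\<dots> = qLiS k z + z * deriv (qLiS k) z"
    unfolding d qLiS_def using c
    by (simp add: E.add E.scale continuous_intros)
  finally show ?thesis .
qed

lemma cnj_ker: "ker (cnj z) t = cnj (ker z t)"
  by (simp add: ker_def)

lemma LiS_cnj: "z \<in> slit_plane \<Longrightarrow> LiS k (cnj z) = cnj (LiS k z)"
  using state.cnj[OF state_E, of "ker z" k] by (simp add: LiS_def cnj_ker[abs_def] continuous_intros)

lemma qLiS_cnj: "z \<in> slit_plane \<Longrightarrow> qLiS k (cnj z) = cnj (qLiS k z)"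
  using state.cnj[OF state_E, of "\<lambda>t. of_real t * ker z t" k]
  by (simp add: qLiS_def cnj_ker continuous_intros)

lemma dLiS_cnj: "z \<in> slit_plane \<Longrightarrow> dLiS k (cnj z) = cnj (dLiS k z)"
  using state.cnj[OF state_E, of "\<lambda>t. of_real t * (ker z t)\<^sup>2" k]
  by (simp add: dLiS_def cnj_ker continuous_intros)

lemma ker_eq: "ker z t = cnj (1 - of_real t * z) / of_real ((norm (1 - of_real t * z))\<^sup>2)"
  unfolding ker_def using complex_div_cnj[of 1 "1 - of_real t * z"] by simp

lemma Re_ker: "Re (ker z t) = (1 - t * Re z) / (norm (1 - of_real t * z))\<^sup>2"
  and Im_ker: "Im (ker z t) = t * Im z / (norm (1 - of_real t * z))\<^sup>2"
  unfolding ker_eq by (simp_all add: Re_divide_of_real Im_divide_of_real del: of_real_power)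

lemma Re_lt_1_slit: "Re z < 1 \<Longrightarrow> z \<in> slit_plane"
  by (simp add: slit_plane_iff)

lemma mult_less_1:
  assumes "t \<in> {0..1}" "a < (1::real)"
  shows "t * a < 1"
proof (cases "0 \<le> a")
  case True
  then have "t * a \<le> 1 * a" using assms by (intro mult_right_mono) auto
  then show ?thesis using assms by simp
next
  case False
  then have "t * a \<le> 0" using assms by (simp add: mult_nonneg_nonpos)
  then show ?thesis by simp
qed

lemma Re_ker_pos:
  assumes "Re z < 1" "t \<in> {0..1}"
  shows "0 < Re (ker z t)"
  unfolding Re_ker using slit_plane_denom[OF Re_lt_1_slit[OF assms(1)] assms(2)] mult_less_1[OF assms(2,1)]
  by simp

lemma Im_ker_nonneg: "0 \<le> Im z \<Longrightarrow> 0 \<le> t \<Longrightarrow> 0 \<le> Im (ker z t)"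
  unfolding Im_ker by simp

text \<open>Keeps \<open>qLiS\<close> free of zeros and inside the domain of the principal
  logarithm, as the starlikeness quotient and the argument function require.\<close>

lemma Re_qLiS_pos:
  assumes k: "k \<in> That" and z: "Re z < 1"
  shows "0 < Re (qLiS k z)"
  unfolding qLiS_def
proof (rule E_pos_right[OF k])
  show "cont01 (\<lambda>t. of_real t * ker z t)"
    by (intro continuous_intros Re_lt_1_slit z)
  show "0 \<le> Re (of_real t * ker z t)" if "t \<in> {0..1}" for t
    using Re_ker_pos[OF z that] that by simp
  show "0 < Re (of_real t * ker z t)" if "t \<in> {0<..1}" for t
    using Re_ker_pos[OF z, of t] that by simp
qed

lemma Im_nonneg:
  assumes L: "state L" and f: "cont01 f" "\<And>t. t \<in> {0..1} \<Longrightarrow> 0 \<le> Im (f t)"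
  shows "0 \<le> Im (L f)"
proof -
  have "0 \<le> Re (L (\<lambda>t. - \<i> * f t))" using f by (intro state.pos[OF L] continuous_intros) auto
  then show ?thesis unfolding state.scale[OF L f(1)] by simp
qed

lemma Im_qLiS_nonneg:
  assumes "z \<in> slit_plane" "0 \<le> Im z"
  shows "0 \<le> Im (qLiS k z)"
  unfolding qLiS_def using assms Im_ker_nonneg
  by (intro Im_nonneg[OF state_E]) (auto intro!: continuous_intros)

lemma ker_cross:
  assumes z: "z \<in> slit_plane" and st: "s \<in> {0..1}" "t \<in> {0..1}"
  shows "Im (cnj (ker z s) * ker z t)
    = (t - s) * Im z / ((norm (1 - of_real s * z))\<^sup>2 * (norm (1 - of_real t * z))\<^sup>2)"
proof -
  have "cnj (ker z s) * ker z t = ((1 - of_real s * z) * cnj (1 - of_real t * z))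
      / of_real ((norm (1 - of_real s * z))\<^sup>2 * (norm (1 - of_real t * z))\<^sup>2)"
    unfolding ker_eq by simp
  then show ?thesis
    by (simp add: Im_divide_of_real algebra_simps del: of_real_mult of_real_power)
qed

lemma ker_cross_nonneg:
  assumes "z \<in> slit_plane" "s \<in> {0..1}" "t \<in> {0..1}" "s \<le> t" "0 \<le> Im z"
  shows "0 \<le> Im (cnj (ker z s) * ker z t)"
  unfolding ker_cross[OF assms(1-3)] using assms by simp

lemma ker_cross_pos:
  assumes "z \<in> slit_plane" "s \<in> {0..1}" "t \<in> {0..1}" "s < t" "0 < Im z"
  shows "0 < Im (cnj (ker z s) * ker z t)"
  unfolding ker_cross[OF assms(1-3)] using assms slit_plane_denom[OF assms(1)] by simp

lemma ccw_qLiS: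
  assumes z: "z \<in> slit_plane" "0 \<le> Im z"
  shows "ccw (\<lambda>t. of_real t * ker z t)"
  unfolding ccw_def
proof (intro ballI impI)
  fix s t :: real assume st: "s \<in> {0..1}" "t \<in> {0..1}" "s < t"
  have "cnj (of_real s * ker z s) * (of_real t * ker z t) = of_real (s * t) * (cnj (ker z s) * ker z t)"
    by simp
  then have "Im (cnj (of_real s * ker z s) * (of_real t * ker z t)) = s * t * Im (cnj (ker z s) * ker z t)"
    by (simp only: Im_complex_of_real times_complex.sel Re_complex_of_real)
  then show "0 \<le> Im (cnj (of_real s * ker z s) * (of_real t * ker z t))"
    using ker_cross_nonneg[OF z(1) st(1,2) _ z(2)] st by (simp only: mult_nonneg_nonneg) auto
qed

lemma strict_ccw_qLiS:
  assumes z: "z \<in> slit_plane" "0 < Im z"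
  shows "strict_ccw (\<lambda>t. of_real t * ker z t)"
  unfolding strict_ccw_def
proof (intro conjI ccw_qLiS allI impI)
  fix s t :: real assume st: "0 < s \<and> s < t \<and> t \<le> 1"
  have "cnj (of_real s * ker z s) * (of_real t * ker z t) = of_real (s * t) * (cnj (ker z s) * ker z t)"
    by simp
  then have "Im (cnj (of_real s * ker z s) * (of_real t * ker z t)) = s * t * Im (cnj (ker z s) * ker z t)"
    by (simp only: Im_complex_of_real times_complex.sel Re_complex_of_real)
  moreover have "0 < s * t * Im (cnj (ker z s) * ker z t)"
    using ker_cross_pos[OF z(1) _ _ _ z(2), of s t] st by (intro mult_pos_pos) auto
  ultimately show "0 < Im (cnj (of_real s * ker z s) * (of_real t * ker z t))" by simp
qed (use z in auto)

text \<open>The integrand \<open>t * ker z t\<close> against \<open>ker z s\<close> has no fixed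
  sign, but adding its mirror image in s and t produces a nonnegative multiple of (t - s)^2.\<close>

lemma Im_cnj_LiS_qLiS:
  assumes z: "z \<in> slit_plane" "0 \<le> Im z"
  shows "0 \<le> Im (cnj (LiS k z) * qLiS k z)"
proof -
  have c: "cont01 (\<lambda>t. of_real t * ker z t)" by (intro continuous_intros z)
  have "0 \<le> Re (E k (\<lambda>t. - \<i> * (of_real t * ker z t)) * cnj (E k (ker z)))"
  proof (rule E.pair_pos)
    fix s t :: real assume st: "s \<in> {0..1}" "t \<in> {0..1}"
    have "Re (- \<i> * (of_real t * ker z t) * cnj (ker z s) + - \<i> * (of_real s * ker z s) * cnj (ker z t))
        = t * Im (cnj (ker z s) * ker z t) + s * Im (cnj (ker z t) * ker z s)"
      by (simp add: algebra_simps)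
    also have "\<dots> = (t - s)\<^sup>2 * Im z / ((norm (1 - of_real s * z))\<^sup>2 * (norm (1 - of_real t * z))\<^sup>2)"
      unfolding ker_cross[OF z(1) st] ker_cross[OF z(1) st(2,1)]
      by (simp add: power2_eq_square mult.commute add_divide_distrib[symmetric]) (simp add: algebra_simps)
    also have "\<dots> \<ge> 0" using z by simp
    finally show "0 \<le> Re (- \<i> * (of_real t * ker z t) * cnj (ker z s) + - \<i> * (of_real s * ker z s) * cnj (ker z t))" .
  qed (auto intro!: continuous_intros z)
  then show ?thesis
    unfolding E.scale[OF c] LiS_def qLiS_def by (simp add: algebra_simps)
qed

section \<open>Starlikeness\<close>

lemma radial_limit_nonneg:
  fixes g :: "complex \<Rightarrow> real"
  assumes g: "isCont g w" and pos: "\<And>s. 0 < s \<Longrightarrow> s < 1 \<Longrightarrow> 0 \<le> g (of_real s * w)"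
  shows "0 \<le> g w"
proof (rule LIMSEQ_le_const)
  have "(\<lambda>n. 1 - 1 / real (n + 2)) \<longlonglongrightarrow> 1" by real_asymp
  then have "(\<lambda>n. complex_of_real (1 - 1 / real (n + 2)) * w) \<longlonglongrightarrow> of_real 1 * w"
    by (intro tendsto_intros)
  then show "(\<lambda>n. g (complex_of_real (1 - 1 / real (n + 2)) * w)) \<longlonglongrightarrow> g w"
    using isCont_tendsto_compose[OF g] by simp
  show "\<exists>N. \<forall>n\<ge>N. 0 \<le> g (complex_of_real (1 - 1 / real (n + 2)) * w)"
    by (intro exI[of _ 0] allI impI pos) (auto simp: field_simps)
qed

text \<open>
  A minimum principle in the style of Jack's lemma for the Briot--Bouquet operator
  \<open>P + z P' / (1 + P)\<close>: at a zero of \<open>Re P\<close> of smallest modulus, \<open>z P'\<close> is real and nonpositive.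
\<close>

lemma Briot_Bouquet_pos:
  assumes hol: "P holomorphic_on ball 0 1" and P0: "P 0 = 1"
    and Q: "\<And>z. z \<in> ball 0 1 \<Longrightarrow> 0 < Re (P z + z * deriv P z / (1 + P z))"
    and z: "z \<in> ball 0 1"
  shows "0 < Re (P z)"
proof (rule ccontr)
  assume neg: "\<not> 0 < Re (P z)"
  have cont: "continuous_on (cball 0 (norm z)) P"
    by (rule continuous_on_subset[OF holomorphic_on_imp_continuous_on[OF hol]]) (use z in auto)
  define S where "S = cball 0 (norm z) \<inter> (\<lambda>w. Re (P w)) -` {..0}"
  have "closed S"
    unfolding S_def by (intro continuous_closed_preimage continuous_intros cont closed_cball closed_atMost)
  moreover have "bounded S"
    by (rule bounded_subset[OF bounded_cball[of 0 "norm z"]]) (auto simp: S_def)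
  ultimately have "compact S" by (simp add: compact_eq_bounded_closed)
  moreover have "z \<in> S" using neg by (auto simp: S_def)
  ultimately have "\<exists>x\<in>S. \<forall>y\<in>S. norm x \<le> norm y"
    by (intro continuous_attains_inf) (auto intro!: continuous_intros)
  then obtain z0 where z0: "z0 \<in> S" "\<And>y. y \<in> S \<Longrightarrow> norm z0 \<le> norm y" by blast
  have n0: "norm z0 \<le> norm z" "norm z < 1" "Re (P z0) \<le> 0" using z0 z by (auto simp: S_def)
  have nz: "z0 \<noteq> 0" using P0 n0 by auto
  have inner: "0 < Re (P w)" if "norm w < norm z0" for w
    using z0(2)[of w] that n0 unfolding S_def by force
  have deriv: "(P has_field_derivative deriv P w) (at w)" if "norm w \<le> norm z0" for w
    using holomorphic_derivI[OF hol open_ball] that n0 by auto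
  have circle: "0 \<le> Re (P w)" if w: "norm w = norm z0" for w
  proof (rule radial_limit_nonneg[where g = "\<lambda>w. Re (P w)"])
    show "isCont (\<lambda>w. Re (P w)) w"
      using DERIV_isCont[OF deriv] w by (intro isCont_Re) auto
    show "0 \<le> Re (P (of_real s * w))" if "0 < s" "s < 1" for s
      using inner[of "of_real s * w"] that w nz by (simp add: norm_mult less_imp_le)
  qed
  have P_0: "Re (P z0) = 0" using circle[of z0] n0 by simp
  define d where "d = z0 * deriv P z0"
  \<comment> \<open>On the circle through \<open>z0\<close> the function Re P is nonnegative and
    vanishes at \<open>z0\<close>, so its tangential derivative is 0 there. The radial derivative is
    treated below.\<close>
  have "Re (\<i> * d) = 0"
  proof (rule DERIV_local_min[where x = 0 and d = 1 and f = "\<lambda>t. Re (P (z0 * exp (\<i> * of_real t)))"])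
    have "((\<lambda>z. z0 * exp (\<i> * z)) has_field_derivative z0 * \<i>) (at (of_real 0))"
      by (auto intro!: derivative_eq_intros)
    then have "((\<lambda>t. z0 * exp (\<i> * of_real t)) has_vector_derivative z0 * \<i>) (at 0)"
      by (rule has_vector_derivative_real_field)
    then have "((P \<circ> (\<lambda>t. z0 * exp (\<i> * of_real t))) has_vector_derivative z0 * \<i> * deriv P z0) (at 0)"
      by (rule field_vector_diff_chain_at) (use deriv[of z0] in simp)
    then have "((\<lambda>t. Re ((P \<circ> (\<lambda>t. z0 * exp (\<i> * of_real t))) t)) has_vector_derivative Re (z0 * \<i> * deriv P z0)) (at 0)"
      by (rule bounded_linear.has_vector_derivative[OF bounded_linear_Re])
    moreover have "z0 * \<i> * deriv P z0 = \<i> * d" by (simp add: d_def)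
    ultimately show "((\<lambda>t. Re (P (z0 * exp (\<i> * of_real t)))) has_real_derivative Re (\<i> * d)) (at 0)"
      by (simp only: has_real_derivative_iff_has_vector_derivative o_def)
    show "\<forall>y. \<bar>0 - y\<bar> < 1 \<longrightarrow> Re (P (z0 * exp (\<i> * of_real 0))) \<le> Re (P (z0 * exp (\<i> * of_real y)))"
      using circle P_0 by (simp add: norm_mult)
  qed simp
  then have Im_d: "Im d = 0" by simp
  have Re_d: "Re d \<le> 0"
  proof (rule ccontr)
    assume pos: "\<not> Re d \<le> 0"
    have "((\<lambda>z. z * z0) has_field_derivative z0) (at (of_real 1))"
      by (auto intro!: derivative_eq_intros)
    then have "((\<lambda>t. of_real t * z0) has_vector_derivative z0) (at 1)"
      by (rule has_vector_derivative_real_field)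
    then have "((P \<circ> (\<lambda>t. of_real t * z0)) has_vector_derivative z0 * deriv P z0) (at 1)"
      by (rule field_vector_diff_chain_at) (use deriv[of z0] in simp)
    then have "((\<lambda>t. Re ((P \<circ> (\<lambda>t. of_real t * z0)) t)) has_vector_derivative Re (z0 * deriv P z0)) (at 1)"
      by (rule bounded_linear.has_vector_derivative[OF bounded_linear_Re])
    then have D: "((\<lambda>t. Re (P (of_real t * z0))) has_real_derivative Re d) (at 1)"
      by (simp only: has_real_derivative_iff_has_vector_derivative o_def d_def)
    obtain e where e: "0 < e" "\<And>h. 0 < h \<Longrightarrow> h < e \<Longrightarrow> Re (P (of_real (1 - h) * z0)) < Re (P (of_real 1 * z0))"
      using DERIV_pos_inc_left[OF D] pos by auto
    define h where "h = min (e / 2) (1 / 2)"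
    have h: "0 < h" "h < e" "h < 1" using e(1) by (auto simp: h_def)
    have "Re (P (of_real (1 - h) * z0)) < 0" using e(2)[OF h(1,2)] P_0 by simp
    moreover have "norm (of_real (1 - h) * z0) < norm z0"
      unfolding norm_mult norm_of_real using h nz by simp
    ultimately show False using inner by fastforce
  qed
  have "Re (P z0 + z0 * deriv P z0 / (1 + P z0)) = Re (d / (1 + P z0))"
    using P_0 by (simp add: d_def)
  also have "d = of_real (Re d)" using Im_d by (simp add: complex_eq_iff)
  also have "Re (of_real (Re d) / (1 + P z0)) = Re d * Re (1 / (1 + P z0))"
    using Re_divide_of_real[of 1] times_divide_eq_right[of "of_real (Re d)" 1 "1 + P z0"]
    by (metis Re_complex_of_real Im_complex_of_real mult.right_neutral mult_zero_left diff_zero times_complex.sel(1))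
  also have "\<dots> \<le> 0"
    using Re_d P_0 by (intro mult_nonpos_nonneg) (auto simp: Re_divide)
  finally show False using Q[of z0] n0 by auto
qed

text \<open>The integrand on the right is the derivative of t^2 \<open>ker z t\<close>, so its mean
  over [0,s] is \<open>s * ker z s\<close>: the differential form of reading a digit 0.\<close>

lemma qLiS_rec_M0:
  assumes k: "1 < k 0" and z: "z \<in> slit_plane"
  shows "qLiS (k(0 := k 0 - 1)) z = dLiS k z + qLiS k z"
proof -
  have c: "cont01 (\<lambda>t. of_real t * (ker z t)\<^sup>2)" "cont01 (\<lambda>t. of_real t * ker z t)"
    by (intro continuous_intros z)+
  define f where "f = (\<lambda>t. of_real t * (ker z t)\<^sup>2 + of_real t * ker z t)"
  have f: "cont01 f" unfolding f_def by (intro continuous_intros c)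
  have "M0 f s = of_real s * ker z s" if s: "s \<in> {0..1}" for s
  proof (cases "s = 0")
    case False
    have "of_real (s - 0) * avg 0 s f = (of_real s)\<^sup>2 * ker z s - (of_real 0)\<^sup>2 * ker z 0"
    proof (rule avg_FTC)
      fix t :: real assume t: "t \<in> {0..1}"
      have nz: "1 - of_real t * z \<noteq> 0" using slit_plane_denom[OF z t] .
      have "((\<lambda>w. w\<^sup>2 * (1 / (1 - w * z))) has_field_derivative
          2 * of_real t * (1 / (1 - of_real t * z)) + (of_real t)\<^sup>2 * (z / (1 - of_real t * z)\<^sup>2)) (at (of_real t))"
        using nz by (auto intro!: derivative_eq_intros simp: power2_eq_square divide_simps)
      moreover have "2 * of_real t * (1 / (1 - of_real t * z)) + (of_real t)\<^sup>2 * (z / (1 - of_real t * z)\<^sup>2) = f t"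
        unfolding f_def ker_def using nz by (simp add: divide_simps) (simp add: algebra_simps power2_eq_square)
      ultimately show "((\<lambda>t. (of_real t)\<^sup>2 * ker z t) has_vector_derivative f t) (at t within {0..1})"
        unfolding ker_def using has_vector_derivative_real_field by fastforce
    qed (use s in auto)
    then show ?thesis using False by (simp add: M0_def power2_eq_square)
  qed (simp add: f_def)
  then have "E k f = qLiS (k(0 := k 0 - 1)) z"
    unfolding E_M0[where k = k, OF f k] qLiS_def
    by (intro E.cong continuous_intros f)
  then show ?thesis
    unfolding f_def dLiS_def qLiS_def using c by (simp add: E.add)
qed

text \<open>The analogous form of reading a digit 1. The primitive -(1 - t) t \<open>ker z t\<close>
  is chosen to vanish at 1, so the mean over [s,1] is again \<open>s * ker z s\<close>.\<close>

lemma qLiS_rec_M1: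
  assumes k: "k 0 = 1" and z: "z \<in> slit_plane"
  shows "(1 - z) * dLiS k z = qLiS (shift k) z + (LiS k z - qLiS k z)"
proof -
  have c: "cont01 (\<lambda>t. of_real t * (ker z t)\<^sup>2)" "cont01 (\<lambda>t. of_real t * ker z t)"
      "cont01 (ker z)"
    by (intro continuous_intros z)+
  define f where "f = (\<lambda>t. (1 - z) * (of_real t * (ker z t)\<^sup>2) - (ker z t - of_real t * ker z t))"
  have f: "cont01 f" unfolding f_def by (intro continuous_intros c)
  have "M1 f s = of_real s * ker z s" if s: "s \<in> {0..1}" for s
  proof (cases "s = 1")
    case False
    define G where "G = (\<lambda>w. - ((1 - w) * w * (1 / (1 - w * z))))"
    have "of_real (1 - s) * avg s 1 f = G (of_real 1) - G (of_real s)"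
    proof (rule avg_FTC)
      fix t :: real assume t: "t \<in> {0..1}"
      have nz: "1 - of_real t * z \<noteq> 0" using slit_plane_denom[OF z t] .
      have "(G has_field_derivative
          - ((1 - 2 * of_real t) * (1 / (1 - of_real t * z)) + (1 - of_real t) * of_real t * (z / (1 - of_real t * z)\<^sup>2))) (at (of_real t))"
        unfolding G_def using nz
        by (auto intro!: derivative_eq_intros simp: power2_eq_square divide_simps)
      moreover have "- ((1 - 2 * of_real t) * (1 / (1 - of_real t * z)) + (1 - of_real t) * of_real t * (z / (1 - of_real t * z)\<^sup>2)) = f t"
        unfolding f_def ker_def using nz by (simp add: divide_simps) (simp add: algebra_simps power2_eq_square)
      ultimately show "((\<lambda>t. G (of_real t)) has_vector_derivative f t) (at t within {0..1})"
        using has_vector_derivative_real_field by fastforce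
    qed (use s in auto)
    then have "(1 - of_real s) * M1 f s = (1 - of_real s) * (of_real s * ker z s)"
      by (simp add: M1_def G_def ker_def)
    moreover have "1 - complex_of_real s \<noteq> 0" using False by auto
    ultimately show ?thesis using mult_left_cancel by blast
  next
    case True
    have "1 - z \<noteq> 0" using slit_plane_denom[OF z, of 1] by simp
    then show ?thesis using True by (simp add: f_def ker_def power2_eq_square)
  qed
  then have "E k f = qLiS (shift k) z"
    unfolding E_M1[where k = k, OF f k] qLiS_def shift_def
    by (intro E.cong continuous_intros f)
  moreover have "E k f = (1 - z) * dLiS k z - (LiS k z - qLiS k z)"
    unfolding f_def dLiS_def qLiS_def LiS_def using c
    by (simp add: E.diff E.scale continuous_intros)
  ultimately show ?thesis by (simp add: algebra_simps)
qed

lemma ball_slit: "z \<in> ball 0 1 \<Longrightarrow> z \<in> slit_plane \<and> Re z < 1"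
  using complex_Re_le_cmod[of z] by (auto simp: slit_plane_iff)

text \<open>With \<open>A\<close> and \<open>B\<close> as in the proof, \<open>dLiS\<close> is (A +
  B)/(1 - z). Both lie in the closed first quadrant with argument at most that of
  \<open>qLiS k z\<close>: for \<open>A\<close> by symmetrisation, for \<open>B\<close> by the order
  property, since deleting a leading digit 1 does not raise beta. So (A + B) times the conjugate of
  \<open>qLiS k z\<close> lies in the fourth quadrant, and the factor 1/(1 - z) from the first keeps
  its real part positive.\<close>

lemma starlike_M1_upper:
  assumes k: "k \<in> That" "k 0 = 1" and z: "Re z < 1" "0 \<le> Im z"
  shows "0 < Re (dLiS k z * cnj (qLiS k z))"
proof -
  have zs: "z \<in> slit_plane" using z by (simp add: slit_plane_iff)
  define A B where "A = LiS k z - qLiS k z" and "B = qLiS (shift k) z"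
  have sh: "shift k \<in> That" "beta (shift k) \<le> beta k"
    using shift_That[OF k(1)] beta_rec[OF k(1)] beta_le_1[of "shift k"] k by auto
  have "A = E k (\<lambda>t. (1 - of_real t) * ker z t)"
    unfolding A_def LiS_def qLiS_def
    by (subst state.diff[OF state_E, symmetric]) (auto intro!: continuous_intros zs simp: algebra_simps)
  moreover have "cont01 (\<lambda>t. (1 - of_real t) * ker z t)" by (intro continuous_intros zs)
  moreover have "0 \<le> Re ((1 - of_real t) * ker z t)" "0 \<le> Im ((1 - of_real t) * ker z t)" if "t \<in> {0..1}" for t
    using Re_ker_pos[OF z(1) that] Im_ker_nonneg[OF z(2), of t] that by auto
  ultimately have A: "0 \<le> Re A" "0 \<le> Im A"
    by (auto intro!: E.pos Im_nonneg[OF state_E])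
  have B: "0 < Re B" "0 \<le> Im B" and Hp: "0 < Re (qLiS k z)" "0 \<le> Im (qLiS k z)"
    unfolding B_def using Re_qLiS_pos Im_qLiS_nonneg k sh z zs by auto
  have AH: "0 \<le> Im (cnj A * qLiS k z)"
    using Im_cnj_LiS_qLiS[OF zs z(2), of k] by (simp add: A_def algebra_simps)
  have BH: "0 \<le> Im (cnj B * qLiS k z)"
    unfolding B_def using E_cross_le[OF sh(1) k(1) sh(2) _ ccw_qLiS[OF zs z(2)]] zs
    by (simp add: qLiS_def continuous_intros)
  define Z where "Z = (A + B) * cnj (qLiS k z)"
  have Z: "0 < Re Z" "Im Z \<le> 0"
  proof -
    have "Re Z = Re A * Re (qLiS k z) + Im A * Im (qLiS k z) + (Re B * Re (qLiS k z) + Im B * Im (qLiS k z))"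
      by (simp add: Z_def algebra_simps)
    moreover have "0 \<le> Re A * Re (qLiS k z)" "0 \<le> Im A * Im (qLiS k z)" "0 < Re B * Re (qLiS k z)" "0 \<le> Im B * Im (qLiS k z)"
      using A B Hp by simp_all
    ultimately show "0 < Re Z" by linarith
    show "Im Z \<le> 0" using AH BH by (simp add: Z_def algebra_simps)
  qed
  have "1 - z \<noteq> 0" using z by auto
  then have "dLiS k z = (A + B) / (1 - z)"
    using qLiS_rec_M1[where k = k, OF k(2) zs] by (simp add: A_def B_def field_simps)
  then have "dLiS k z * cnj (qLiS k z) = Z * ker z 1" by (simp add: Z_def ker_def)
  then have "Re (dLiS k z * cnj (qLiS k z)) = Re Z * Re (ker z 1) - Im Z * Im (ker z 1)" by simp
  moreover have "0 < Re Z * Re (ker z 1)" using Z Re_ker_pos[OF z(1), of 1] by simp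
  moreover have "Im Z * Im (ker z 1) \<le> 0"
    using Z Im_ker_nonneg[OF z(2), of 1] by (intro mult_nonpos_nonneg) auto
  ultimately show ?thesis by linarith
qed

text \<open>Induction on the first entry, ending at a leading digit 1. For P =
  \<open>dLiS / qLiS\<close>, deleting a leading digit 0 multiplies \<open>qLiS\<close> by 1 + P and
  therefore changes P into P + z P'/(1 + P). Positivity for the shortened index thus returns to
  \<open>k\<close> through \<open>Briot_Bouquet_pos\<close>.\<close>

lemma starlike:
  assumes "k \<in> That" "z \<in> ball 0 1"
  shows "0 < Re (dLiS k z * cnj (qLiS k z))"
  using assms
proof (induction "k 0" arbitrary: k z)
  case 0
  then show ?case using That_simps(2)[of k 0] by simp
next
  case (Suc n)
  show ?case
  proof (cases "n = 0")
    case True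
    then have k0: "k 0 = 1" using Suc.hyps(2) by simp
    show ?thesis
    proof (cases "0 \<le> Im z")
      case True
      then show ?thesis using starlike_M1_upper[OF Suc.prems(1) k0] ball_slit[OF Suc.prems(2)] by simp
    next
      case False
      have "0 < Re (dLiS k (cnj z) * cnj (qLiS k (cnj z)))"
        using starlike_M1_upper[OF Suc.prems(1) k0, of "cnj z"] ball_slit[OF Suc.prems(2)] False by simp
      then show ?thesis using ball_slit[OF Suc.prems(2)] by (simp add: dLiS_cnj qLiS_cnj)
    qed
  next
    case False
    define l where "l = k(0 := k 0 - 1)"
    have k0: "1 < k 0" using False Suc.hyps(2) by simp
    have l: "l \<in> That" "n = l 0"
      unfolding l_def using k0 Suc.hyps(2) Suc.prems by (auto intro: That_simps(3))
    define P where "P = (\<lambda>z. dLiS k z / qLiS k z)"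
    have Hnz: "qLiS m z \<noteq> 0" if "m \<in> That" "z \<in> ball 0 1" for m z
      using Re_qLiS_pos[OF that(1), of z] ball_slit[OF that(2)] by auto
    have hol: "P holomorphic_on ball 0 1"
      unfolding P_def using Hnz[OF Suc.prems(1)] ball_slit
      by (intro holomorphic_intros holomorphic_on_subset[OF dLiS_holomorphic] holomorphic_on_subset[OF qLiS_holomorphic]) auto
    have conv: "Re (dLiS m z / qLiS m z) = Re (dLiS m z * cnj (qLiS m z)) / (norm (qLiS m z))\<^sup>2" for m z
      by (subst complex_div_cnj) (simp add: Re_divide_of_real del: of_real_power)
    have "0 < Re (P z)"
    proof (rule Briot_Bouquet_pos[OF hol _ _ Suc.prems(2)])
      show "P 0 = 1" using dLiS_eq_qLiS[of 0 k] Hnz[OF Suc.prems(1), of 0] by (simp add: P_def slit_plane_iff)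
      fix w :: complex assume w: "w \<in> ball 0 1"
      have ws: "w \<in> slit_plane" using ball_slit[OF w] by blast
      have Hl: "qLiS l v = qLiS k v * (1 + P v)" if "v \<in> ball 0 1" for v
        using qLiS_rec_M0[where k = k and z = v, OF k0] ball_slit[OF that] Hnz[OF Suc.prems(1) that]
        by (simp add: l_def P_def field_simps)
      have "((\<lambda>v. qLiS k v * (1 + P v)) has_field_derivative deriv (qLiS k) w * (1 + P w) + deriv P w * qLiS k w) (at w)"
        using holomorphic_derivI[OF qLiS_holomorphic open_slit_plane ws] holomorphic_derivI[OF hol open_ball w]
        by (auto intro!: derivative_eq_intros)
      then have "(qLiS l has_field_derivative deriv (qLiS k) w * (1 + P w) + deriv P w * qLiS k w) (at w)"
        by (rule has_field_derivative_transform_within_open[OF _ open_ball w]) (simp add: Hl)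
      then have "deriv (qLiS l) w = deriv (qLiS k) w * (1 + P w) + deriv P w * qLiS k w"
        by (rule DERIV_imp_deriv)
      then have "dLiS l w = qLiS k w * (1 + P w) + w * (deriv (qLiS k) w * (1 + P w) + deriv P w * qLiS k w)"
        using dLiS_eq_qLiS[OF ws, of l] Hl[OF w] by simp
      also have "\<dots> = (1 + P w) * (qLiS k w + w * deriv (qLiS k) w) + w * deriv P w * qLiS k w"
        by (simp add: algebra_simps)
      also have "qLiS k w + w * deriv (qLiS k) w = qLiS k w * P w"
        using dLiS_eq_qLiS[OF ws, of k] Hnz[OF Suc.prems(1) w] by (simp add: P_def)
      finally have Kl: "dLiS l w = (1 + P w) * (qLiS k w * P w) + w * deriv P w * qLiS k w" .
      have "qLiS l w \<noteq> 0" using Hnz[OF l(1) w] .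
      then have "1 + P w \<noteq> 0" using Hl[OF w] by auto
      then have "dLiS l w / qLiS l w = P w + w * deriv P w / (1 + P w)"
        unfolding Kl Hl[OF w] using Hnz[OF Suc.prems(1) w] by (simp add: add_divide_distrib)
      moreover have "0 < Re (dLiS l w / qLiS l w)"
        unfolding conv using Suc.hyps(1)[OF l(2) l(1) w] Hnz[OF l(1) w] by simp
      ultimately show "0 < Re (P w + w * deriv P w / (1 + P w))" by simp
    qed
    then show ?thesis
      unfolding P_def conv using Hnz[OF Suc.prems] by (simp add: zero_less_divide_iff)
  qed
qed

lemma starlike_boundary:
  assumes k: "k \<in> That" and z: "norm z = 1" "z \<noteq> 1"
  shows "0 \<le> Re (dLiS k z * cnj (qLiS k z))"
proof (rule radial_limit_nonneg[where g = "\<lambda>z. Re (dLiS k z * cnj (qLiS k z))"])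
  have "Re z \<noteq> 1 \<or> Im z \<noteq> 0" using z by (auto simp: complex_eq_iff)
  moreover have "Re z \<le> 1" using complex_Re_le_cmod[of z] z by simp
  ultimately have zs: "z \<in> slit_plane" by (auto simp: slit_plane_iff)
  have "isCont (dLiS k) z" "isCont (qLiS k) z"
    using zs holomorphic_on_imp_continuous_on dLiS_holomorphic qLiS_holomorphic open_slit_plane
    by (metis continuous_on_eq_continuous_at)+
  then show "isCont (\<lambda>z. Re (dLiS k z * cnj (qLiS k z))) z"
    unfolding isCont_def by (intro tendsto_intros)
  show "0 \<le> Re (dLiS k (of_real s * z) * cnj (qLiS k (of_real s * z)))" if "0 < s" "s < 1" for s
    using starlike[OF k, of "of_real s * z"] that z by (simp add: norm_mult less_imp_le)
qed

section \<open>Injectivity on the upper semicircle\<close>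

lemma Im_of_real_mult: "Im (of_real r * z) = r * Im z"
  by simp

lemma E_Im_pos_right:
  assumes k: "k \<in> That" and f: "cont01 f" "\<And>t. t \<in> {0..1} \<Longrightarrow> 0 \<le> Im (f t)"
    and pos: "\<And>t. t \<in> {0<..1} \<Longrightarrow> 0 < Im (f t)"
  shows "0 < Im (E k f)"
proof -
  have "0 < Re (E k (\<lambda>t. - \<i> * f t))"
    using f pos by (intro E_pos_right[OF k] continuous_intros) auto
  then show ?thesis unfolding E.scale[OF f(1)] by simp
qed

lemma E_Im_pos_mid:
  assumes k: "k \<in> That" "k i \<noteq> 1" and f: "cont01 f" "\<And>t. t \<in> {0..1} \<Longrightarrow> 0 \<le> Im (f t)"
    and pos: "\<And>t. t \<in> {0<..<1} \<Longrightarrow> 0 < Im (f t)"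
  shows "0 < Im (E k f)"
proof -
  have "0 < Re (E k (\<lambda>t. - \<i> * f t))"
    using f pos by (intro E_pos_mid[OF k] continuous_intros) auto
  then show ?thesis unfolding E.scale[OF f(1)] by simp
qed

lemma Im_LiS_pos:
  assumes k: "k \<in> That" and z: "0 < Im z"
  shows "0 < Im (LiS k z)"
  unfolding LiS_def
proof (rule E_Im_pos_right[OF k])
  have zs: "z \<in> slit_plane" using z by (simp add: slit_plane_iff)
  show "cont01 (ker z)" using zs by (rule ker_cont)
  show "0 \<le> Im (ker z t)" if "t \<in> {0..1}" for t using z that Im_ker_nonneg by simp
  show "0 < Im (ker z t)" if "t \<in> {0<..1}" for t
    unfolding Im_ker using slit_plane_denom[OF zs, of t] z that by simp
qed

lemma cis_slit: "0 < a \<Longrightarrow> a < pi \<Longrightarrow> cis a \<in> slit_plane \<and> Re (cis a) < 1 \<and> 0 < Im (cis a)"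
  by (simp add: slit_plane_iff sin_gt_zero cos_monotone_0_pi[of 0 a, simplified])

text \<open>By starlikeness the argument of \<open>LiS - 1 = z qLiS\<close>, namely \<open>a + Im (Ln qLiS)\<close>, increases along the semicircle.\<close>

lemma arg_mono:
  assumes k: "k \<in> That" and ab: "0 < a" "a \<le> b" "b < pi"
  shows "0 \<le> Im (cnj (LiS k (cis a) - 1) * (LiS k (cis b) - 1))"
proof -
  define A where "A = (\<lambda>x. x + Im (Ln (qLiS k (exp (\<i> * of_real x)))))"
  have cis: "exp (\<i> * of_real x) = cis x" for x by (simp add: cis_conv_exp)
  have cs: "cis x \<in> slit_plane" "Re (cis x) < 1" "0 < Im (cis x)" if "0 < x" "x < pi" for x
    using cis_slit[OF that] by auto
  have Hp: "0 < Re (qLiS k (cis x))" if "0 < x" "x < pi" for x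
    using Re_qLiS_pos[OF k] cs(2)[OF that] by blast
  have mono: "A a \<le> A b"
  proof (rule DERIV_nonneg_imp_nondecreasing[OF ab(2)])
    fix x assume "a \<le> x" "x \<le> b"
    then have x: "0 < x" "x < pi" using ab by auto
    define z where "z = cis x"
    have Imz: "0 < Im z" using cs(3)[OF x] unfolding z_def .
    have z: "z \<in> slit_plane" "norm z = 1"
      using cs[OF x] by (auto simp: z_def)
    have z1: "z \<noteq> 1" using Imz by auto
    have nz: "qLiS k z \<noteq> 0" using Hp[OF x] by (auto simp: z_def)
    have "qLiS k z \<notin> \<real>\<^sub>\<le>\<^sub>0" using Hp[OF x] by (auto simp: z_def complex_nonpos_Reals_iff)
    moreover have "(qLiS k has_field_derivative deriv (qLiS k) z) (at z)"
      by (rule holomorphic_derivI[OF qLiS_holomorphic open_slit_plane z(1)])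
    moreover have zx: "z = exp (\<i> * of_real x)" by (simp add: z_def cis)
    ultimately have "((\<lambda>w. Ln (qLiS k (exp (\<i> * w)))) has_field_derivative
        inverse (qLiS k z) * (deriv (qLiS k) z * (z * \<i>))) (at (of_real x))"
      by (auto intro!: derivative_eq_intros DERIV_chain'[where g = "qLiS k"] simp: field_simps)
    then have "((\<lambda>x. Ln (qLiS k (exp (\<i> * of_real x)))) has_vector_derivative
        inverse (qLiS k z) * (deriv (qLiS k) z * (z * \<i>))) (at x)"
      by (rule has_vector_derivative_real_field)
    then have "((\<lambda>x. Im (Ln (qLiS k (exp (\<i> * of_real x))))) has_vector_derivative
        Im (inverse (qLiS k z) * (deriv (qLiS k) z * (z * \<i>)))) (at x)"
      by (rule bounded_linear.has_vector_derivative[OF bounded_linear_Im])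
    then have "((\<lambda>x. Im (Ln (qLiS k (exp (\<i> * of_real x))))) has_real_derivative
        Im (inverse (qLiS k z) * (deriv (qLiS k) z * (z * \<i>)))) (at x)"
      by (simp only: has_real_derivative_iff_has_vector_derivative)
    then have "(A has_real_derivative 1 + Im (inverse (qLiS k z) * (deriv (qLiS k) z * (z * \<i>)))) (at x)"
      unfolding A_def by (rule DERIV_add[OF DERIV_ident])
    moreover have "1 + Im (inverse (qLiS k z) * (deriv (qLiS k) z * (z * \<i>))) = Re (dLiS k z / qLiS k z)"
    proof -
      have "inverse (qLiS k z) * (deriv (qLiS k) z * (z * \<i>)) = \<i> * (z * deriv (qLiS k) z / qLiS k z)"
        by (simp add: field_simps)
      moreover have "dLiS k z / qLiS k z = 1 + z * deriv (qLiS k) z / qLiS k z"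
        using dLiS_eq_qLiS[OF z(1)] nz by (simp add: field_simps)
      ultimately show ?thesis by (simp only: plus_complex.sel one_complex.sel Im_i_times)
    qed
    moreover have "0 \<le> Re (dLiS k z / qLiS k z)"
      using starlike_boundary[OF k z(2) z1]
      by (subst complex_div_cnj) (simp add: Re_divide_of_real del: of_real_power)
    ultimately show "\<exists>y. (A has_real_derivative y) (at x) \<and> 0 \<le> y" by auto
  qed
  have polar: "\<exists>r>0. LiS k (cis x) - 1 = of_real r * cis (A x)" and A: "0 < A x" "A x < pi" if x: "0 < x" "x < pi" for x
  proof -
    have nz: "qLiS k (cis x) \<noteq> 0" using Hp[OF x] by auto
    have "qLiS k (cis x) = of_real (exp (Re (Ln (qLiS k (cis x))))) * cis (Im (Ln (qLiS k (cis x))))"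
      using exp_Ln[OF nz] exp_eq_polar by metis
    then have eq: "LiS k (cis x) - 1 = of_real (exp (Re (Ln (qLiS k (cis x))))) * cis (A x)"
      using LiS_eq_qLiS[OF cs(1)[OF x], of k] cis_mult[of x "Im (Ln (qLiS k (cis x)))"] unfolding A_def cis
      by (metis add_diff_cancel_left' mult.left_commute)
    then show "\<exists>r>0. LiS k (cis x) - 1 = of_real r * cis (A x)"
      by (intro exI[of _ "exp (Re (Ln (qLiS k (cis x))))"]) simp
    have "\<bar>Im (Ln (qLiS k (cis x)))\<bar> < pi / 2" using Re_Ln_pos_lt nz Hp[OF x] by blast
    moreover have "0 \<le> Im (Ln (qLiS k (cis x)))"
      using Im_Ln_pos_le[OF nz] Im_qLiS_nonneg[OF cs(1)[OF x]] cs(3)[OF x] by simp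
    ultimately have bnd: "0 < A x" "A x < 2 * pi" using x unfolding A_def cis by auto
    then show "0 < A x" by simp
    \<comment> \<open>The crude bound leaves the range (0, 2 pi); the positive imaginary part cuts
      it to (0, pi), so that differences of \<open>A\<close> have nonnegative sine when they are
      nonnegative.\<close>
    have "0 < Im (LiS k (cis x) - 1)" using Im_LiS_pos[OF k cs(3)[OF x]] by simp
    then have "0 < sin (A x)" unfolding eq by (simp add: zero_less_mult_iff)
    then show "A x < pi" using sin_le_zero[of "A x"] bnd by fastforce
  qed
  obtain r r' where r: "0 < r" "LiS k (cis a) - 1 = of_real r * cis (A a)"
      "0 < r'" "LiS k (cis b) - 1 = of_real r' * cis (A b)"
    using polar[of a] polar[of b] ab by auto
  have "Im (cnj (LiS k (cis a) - 1) * (LiS k (cis b) - 1)) = r * r' * sin (A b - A a)"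
    unfolding r(2,4) by (simp add: sin_diff algebra_simps)
  moreover have "0 \<le> sin (A b - A a)"
    using mono A[of a] A[of b] ab by (intro sin_ge_zero) auto
  ultimately show ?thesis using r by simp
qed

text \<open>
  The two terms with the factor \<open>N\<close> have opposite signs, but they combine to a multiple of
  \<open>(t - s)\<^sup>2\<close>.
\<close>

lemma chord_polynomial:
  fixes t s c N R sg C1 :: real
  defines "d \<equiv> \<lambda>t. 1 - 2 * t * C1 + t\<^sup>2"
  shows "t * (1 - s) * d s * ((1 - t) * c * ((t - s) * N) + (1 + t) * sg * R)
      + s * (1 - t) * d t * ((1 - s) * c * ((s - t) * N) + (1 + s) * sg * R)
    = R * sg * (t * (1 - s) * (1 + t) * d s + s * (1 - t) * (1 + s) * d t)
      + c * N * ((t - s)\<^sup>2 * ((1 - t) * (1 - s) * (1 - t * s)))"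
  unfolding d_def by algebra

section \<open>The chord estimate\<close>

text \<open>The divided difference of the kernel in the variable z.\<close>

definition chord_g :: "complex \<Rightarrow> complex \<Rightarrow> real \<Rightarrow> complex" where
  "chord_g z1 z2 t = of_real t * (ker z1 t * ker z2 t)"

text \<open>Up to the factor z/(1 - z), the gap between \<open>ker z t\<close> and 1/(1 - z), the
  value belonging to the all-ones index.\<close>

definition chord_q :: "complex \<Rightarrow> real \<Rightarrow> complex" where
  "chord_q z t = (1 - of_real t) * ker z t"

text \<open>Half-angles are used because \<open>cis a\<close> times the conjugate of 1 - x
  \<open>z1\<close> has the simple coordinates (1 - x) cos a and (1 + x) sin a; the same factor
  \<open>cis a\<close> is the phase that appears in \<open>chord\<close>. After clearing the
  positive denominators the numerator is the one in \<open>chord_polynomial\<close>.\<close>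

lemma chord_kernel:
  assumes a: "0 < a" "a < pi / 2" and b: "0 < b" "b < pi / 2" and t: "t \<in> {0..1}" and s: "s \<in> {0..1}"
  defines "z1 \<equiv> cis (2 * a)" and "z2 \<equiv> cis (2 * b)"
  defines "S \<equiv> Im (cis a * (chord_g z1 z2 t * cnj (chord_q z2 s) + chord_g z1 z2 s * cnj (chord_q z2 t)))"
  shows "0 \<le> S" and "t \<in> {0<..<1} \<Longrightarrow> s \<in> {0<..<1} \<Longrightarrow> 0 < S"
proof -
  have zs: "z1 \<in> slit_plane" "z2 \<in> slit_plane" "0 < Im z2"
    using cis_slit[of "2 * a"] cis_slit[of "2 * b"] a b by (auto simp: z1_def z2_def)
  define D A where "D = (\<lambda>t. 1 - of_real t * z1)" and "A = (\<lambda>t. 1 - of_real t * z2)"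
  define d where "d = (\<lambda>t. 1 - 2 * t * Re z1 + t\<^sup>2)"
  define e where "e = (\<lambda>t. (norm (A t))\<^sup>2)"
  have n1: "(Re z1)\<^sup>2 + (Im z1)\<^sup>2 = 1" "(Re z2)\<^sup>2 + (Im z2)\<^sup>2 = 1" by (simp_all add: z1_def z2_def)
  have d: "d t = (norm (D t))\<^sup>2" for t
  proof -
    have "(norm (D t))\<^sup>2 = (1 - t * Re z1)\<^sup>2 + (t * Im z1)\<^sup>2" by (simp add: D_def cmod_power2)
    also have "\<dots> = 1 - 2 * t * Re z1 + t\<^sup>2 * ((Re z1)\<^sup>2 + (Im z1)\<^sup>2)" by algebra
    finally show ?thesis by (simp add: n1 d_def)
  qed
  have pos: "0 < d x" "0 < e x" if "x \<in> {0..1}" for x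
    using slit_plane_denom[OF zs(1) that] slit_plane_denom[OF zs(2) that] by (auto simp: d e_def D_def A_def)
  have ker: "ker z1 x = cnj (D x) / of_real (d x)" "ker z2 x = cnj (A x) / of_real (e x)" for x
    unfolding d e_def by (simp_all add: ker_eq D_def A_def)
  have z1_sq: "z1 = cis a * cis a" by (simp add: z1_def cis_mult)
  have X: "cis a * cnj (D x) = Complex ((1 - x) * cos a) ((1 + x) * sin a)" for x
  proof -
    have "cis a * cnj (D x) = cis a - of_real x * ((cis a * cnj (cis a)) * cnj (cis a))"
      unfolding D_def z1_sq by (simp add: algebra_simps)
    also have "cis a * cnj (cis a) = 1" by (simp add: complex_norm_square[symmetric])
    finally show ?thesis by (simp add: complex_eq_iff algebra_simps)
  qed
  define R where "R = (\<lambda>x y. (1 - x) * (1 - y) + (x + y) * (1 - Re z2))"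
  have Y: "cnj (A x) * A y = Complex (R x y) ((x - y) * Im z2)" for x y
  proof -
    have "Re (cnj (A x) * A y) = 1 - (x + y) * Re z2 + x * y * ((Re z2)\<^sup>2 + (Im z2)\<^sup>2)"
      unfolding A_def by (simp add: algebra_simps power2_eq_square)
    moreover have "Im (cnj (A x) * A y) = (x - y) * Im z2"
      unfolding A_def by (simp add: algebra_simps)
    ultimately show ?thesis unfolding n1 by (simp add: complex_eq_iff R_def algebra_simps)
  qed
  have R_sym: "R s t = R t s" by (simp add: R_def algebra_simps)
  define P where "P = (\<lambda>x y. x * (1 - y) * d y * ((1 - x) * cos a * ((x - y) * Im z2) + (1 + x) * sin a * R x y))"
  have prod_eq: "cis a * (chord_g z1 z2 x * cnj (chord_q z2 y))
      = of_real (x * (1 - y) * d y / (d x * d y * e x * e y)) * ((cis a * cnj (D x)) * (cnj (A x) * A y))"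
    if "x \<in> {0..1}" "y \<in> {0..1}" for x y
    unfolding chord_g_def chord_q_def ker using pos[OF that(1)] pos[OF that(2)] by (simp add: field_simps)
  have Im_prod: "Im (cis a * (chord_g z1 z2 x * cnj (chord_q z2 y))) = P x y / (d x * d y * e x * e y)"
    if "x \<in> {0..1}" "y \<in> {0..1}" for x y
    unfolding prod_eq[OF that] X Y by (simp add: P_def)
  have "S = P t s / (d t * d s * e t * e s) + P s t / (d s * d t * e s * e t)"
    unfolding S_def distrib_left plus_complex.sel Im_prod[OF t s] Im_prod[OF s t] ..
  also have "\<dots> = (P t s + P s t) / (d t * d s * e t * e s)"
    by (simp add: add_divide_distrib mult.commute mult.left_commute)
  also have "P t s + P s t = R t s * sin a * (t * (1 - s) * (1 + t) * d s + s * (1 - t) * (1 + s) * d t)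
      + cos a * Im z2 * ((t - s)\<^sup>2 * ((1 - t) * (1 - s) * (1 - t * s)))"
    unfolding P_def R_sym d_def by (rule chord_polynomial)
  finally have S: "S = \<dots> / (d t * d s * e t * e s)" .
  have trig: "0 < sin a" "0 < cos a" using a by (auto intro!: sin_gt_zero cos_gt_zero)
  have Rz: "Re z2 < 1" using cis_slit[of "2 * b"] b by (simp add: z2_def)
  have R0: "0 \<le> R t s" using t s Rz by (simp add: R_def)
  have ts: "t * s \<le> 1" using t s mult_le_one[of t s] by simp
  have denom: "0 < d t * d s * e t * e s" using pos t s by simp
  have second: "0 \<le> cos a * Im z2 * ((t - s)\<^sup>2 * ((1 - t) * (1 - s) * (1 - t * s)))"
    using trig zs ts t s by (intro mult_nonneg_nonneg) auto
  show "0 \<le> S"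
    unfolding S using R0 trig t s pos[OF t] pos[OF s] denom second zs(3) ts
    by (intro divide_nonneg_pos add_nonneg_nonneg mult_nonneg_nonneg) auto
  assume ts': "t \<in> {0<..<1}" "s \<in> {0<..<1}"
  have "0 < R t s" using ts' Rz by (auto simp: R_def intro!: add_pos_pos mult_pos_pos)
  then show "0 < S"
    unfolding S using trig ts' pos[OF t] pos[OF s] denom second
    by (intro divide_pos_pos add_pos_nonneg mult_pos_pos add_pos_pos) auto
qed

lemma chord_cont:
  assumes "z1 \<in> slit_plane" "z2 \<in> slit_plane"
  shows "cont01 (chord_g z1 z2)" "cont01 (chord_q z2)"
  unfolding chord_g_def[abs_def] chord_q_def[abs_def] by (intro continuous_intros assms)+

text \<open>The symmetrised kernel is integrated once in each variable. It is known to be strictly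
  positive only inside the unit square, so a digit 0 in \<open>k\<close> is required twice through
  \<open>E_Im_pos_mid\<close>.\<close>

lemma chord_pair:
  assumes k: "k \<in> That" "k i \<noteq> 1" and a: "0 < a" "a < pi / 2" and b: "0 < b" "b < pi / 2"
  defines "z1 \<equiv> cis (2 * a)" and "z2 \<equiv> cis (2 * b)"
  shows "0 < Im (cis a * (E k (chord_g z1 z2) * cnj (E k (chord_q z2))))"
proof -
  have zs: "z1 \<in> slit_plane" "z2 \<in> slit_plane"
    using cis_slit[of "2 * a"] cis_slit[of "2 * b"] a b by (auto simp: z1_def z2_def)
  define g q where "g = chord_g z1 z2" and "q = chord_q z2"
  have c: "cont01 g" "cont01 q"
    unfolding g_def q_def using chord_cont[OF zs] by auto
  note S = chord_kernel[OF a b, folded z1_def z2_def, folded g_def q_def]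
  have inner: "E k (\<lambda>s. cis a * (g t * cnj (q s) + g s * cnj (q t)))
      = cis a * (g t * cnj (E k q) + E k g * cnj (q t))" for t
    using c by (simp add: E.scale E.scale' E.add
        E.cnj continuous_intros)
  have outer: "E k (\<lambda>t. cis a * (g t * cnj (E k q) + E k g * cnj (q t)))
      = cis a * (E k g * cnj (E k q) + E k g * cnj (E k q))"
    using c by (simp add: E.scale E.scale' E.add
        E.cnj continuous_intros)
  have 1: "0 \<le> Im (cis a * (g t * cnj (E k q) + E k g * cnj (q t)))" if "t \<in> {0..1}" for t
    unfolding inner[symmetric] using S(1)[OF that] c
    by (intro Im_nonneg[OF state_E] continuous_intros) auto
  have 2: "0 < Im (cis a * (g t * cnj (E k q) + E k g * cnj (q t)))" if t: "t \<in> {0<..<1}" for t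
    unfolding inner[symmetric]
  proof (rule E_Im_pos_mid[OF k])
    show "cont01 (\<lambda>s. cis a * (g t * cnj (q s) + g s * cnj (q t)))"
      by (intro continuous_intros c)
    show "0 \<le> Im (cis a * (g t * cnj (q s) + g s * cnj (q t)))" if "s \<in> {0..1}" for s
      using S(1)[of t s] that t by simp
    show "0 < Im (cis a * (g t * cnj (q s) + g s * cnj (q t)))" if "s \<in> {0<..<1}" for s
      using S(2)[of t s] that t by simp
  qed
  have "0 < Im (E k (\<lambda>t. cis a * (g t * cnj (E k q) + E k g * cnj (q t))))"
    using 1 2 by (intro E_Im_pos_mid[OF k] continuous_intros c) auto
  moreover have "cis a * (E k g * cnj (E k q) + E k g * cnj (E k q)) = of_real 2 * (cis a * (E k g * cnj (E k q)))"
    by (simp add: algebra_simps)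
  ultimately have "0 < 2 * Im (cis a * (E k g * cnj (E k q)))"
    unfolding outer by (simp only: Im_of_real_mult)
  then show ?thesis unfolding g_def q_def by linarith
qed

lemma LiS_diff:
  assumes z: "z1 \<in> slit_plane" "z2 \<in> slit_plane"
  shows "LiS k z1 - LiS k z2 = (z1 - z2) * E k (chord_g z1 z2)"
proof -
  have "LiS k z1 - LiS k z2 = E k (\<lambda>t. ker z1 t - ker z2 t)"
    unfolding LiS_def by (intro state.diff[OF state_E, symmetric] ker_cont z)
  also have "\<dots> = E k (\<lambda>t. (z1 - z2) * chord_g z1 z2 t)"
  proof (rule E.cong)
    show "cont01 (\<lambda>t. ker z1 t - ker z2 t)" by (intro continuous_intros z)
    show "ker z1 t - ker z2 t = (z1 - z2) * chord_g z1 z2 t" if "t \<in> {0..1}" for t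
      using slit_plane_denom[OF z(1) that] slit_plane_denom[OF z(2) that]
      by (simp add: ker_def chord_g_def divide_simps) (simp add: algebra_simps)
  qed
  also have "\<dots> = (z1 - z2) * E k (chord_g z1 z2)"
    by (rule E.scale[OF chord_cont(1)[OF z]])
  finally show ?thesis .
qed

lemma LiS_compl:
  assumes z: "z \<in> slit_plane"
  shows "1 / (1 - z) - LiS k z = z / (1 - z) * E k (chord_q z)"
proof -
  have nz: "1 - z \<noteq> 0" using slit_plane_denom[OF z, of 1] by simp
  have "1 / (1 - z) - LiS k z = E k (\<lambda>t. 1 / (1 - z) - ker z t)"
    unfolding LiS_def by (simp add: E.diff E.const continuous_intros z)
  also have "\<dots> = E k (\<lambda>t. z / (1 - z) * chord_q z t)"
  proof (rule E.cong)
    show "cont01 (\<lambda>t. 1 / (1 - z) - ker z t)" by (intro continuous_intros z)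
    show "1 / (1 - z) - ker z t = z / (1 - z) * chord_q z t" if "t \<in> {0..1}" for t
      using slit_plane_denom[OF z that] nz
      by (simp add: ker_def chord_q_def divide_simps) (simp add: algebra_simps)
  qed
  also have "\<dots> = z / (1 - z) * E k (chord_q z)"
    by (rule E.scale[OF chord_cont(2)[OF z z]])
  finally show ?thesis .
qed

text \<open>On the unit circle the conjugate of z2/(1 - z2) is 1/(z2 - 1), and (z1 - z2)/(z2 - 1)
  equals \<open>cis a\<close> times the positive number sin(a - b)/sin b. What remains is exactly
  the product treated in \<open>chord_pair\<close>.\<close>

lemma chord:
  assumes k: "k \<in> That" "k i \<noteq> 1" and ab: "0 < b" "b < a" "a < pi / 2"
  defines "z1 \<equiv> cis (2 * a)" and "z2 \<equiv> cis (2 * b)"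
  shows "0 < Im ((LiS k z1 - LiS k z2) * cnj (1 / (1 - z2) - LiS k z2))"
proof -
  have zs: "z1 \<in> slit_plane" "z2 \<in> slit_plane"
    using cis_slit[of "2 * a"] cis_slit[of "2 * b"] ab by (auto simp: z1_def z2_def)
  define r where "r = sin (a - b) / sin b"
  have r: "0 < r" unfolding r_def using ab by (intro divide_pos_pos sin_gt_zero) auto
  have sb: "sin b \<noteq> 0" using sin_gt_zero[of b] ab by auto
  have nz: "z2 \<noteq> 0" "cnj z2 = 1 / z2"
    by (simp_all add: z2_def cis_cnj divide_inverse)
  have nz1: "1 - z2 \<noteq> 0" "z2 - 1 \<noteq> 0" using slit_plane_denom[OF zs(2), of 1] by auto
  have D: "z2 - 1 = cis b * (2 * \<i> * of_real (sin b))"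
    unfolding z2_def by (simp add: complex_eq_iff cos_double_sin sin_double power2_eq_square)
  have N: "z1 - z2 = cis (a + b) * (2 * \<i> * of_real (sin (a - b)))"
  proof -
    have "cis (a + b) * cis (a - b) = z1" "cis (a + b) * cnj (cis (a - b)) = z2"
      by (simp_all add: z1_def z2_def cis_mult cis_cnj)
    moreover have "cis (a - b) - cnj (cis (a - b)) = 2 * \<i> * of_real (sin (a - b))"
      by (simp add: complex_eq_iff)
    ultimately show ?thesis by (metis right_diff_distrib)
  qed
  have "(z1 - z2) * cnj (z2 / (1 - z2)) = (z1 - z2) / (z2 - 1)"
  proof -
    have "cnj (z2 / (1 - z2)) = (1 / z2) / (1 - 1 / z2)" by (simp only: complex_cnj_divide complex_cnj_diff nz complex_cnj_one)
    also have "\<dots> = 1 / (z2 - 1)" using nz nz1 by (simp add: field_simps)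
    finally show ?thesis by simp
  qed
  also have "\<dots> = of_real r * cis a"
  proof -
    have "cis (a + b) = cis a * cis b" by (simp add: cis_mult)
    then show ?thesis unfolding N D r_def using sb by (simp add: field_simps)
  qed
  finally have fac: "(z1 - z2) * cnj (z2 / (1 - z2)) = of_real r * cis a" .
  have "(LiS k z1 - LiS k z2) * cnj (1 / (1 - z2) - LiS k z2)
      = ((z1 - z2) * cnj (z2 / (1 - z2))) * (E k (chord_g z1 z2) * cnj (E k (chord_q z2)))"
    unfolding LiS_diff[OF zs] LiS_compl[OF zs(2)] by simp
  also have "\<dots> = of_real r * (cis a * (E k (chord_g z1 z2) * cnj (E k (chord_q z2))))"
    unfolding fac by simp
  finally have "Im ((LiS k z1 - LiS k z2) * cnj (1 / (1 - z2) - LiS k z2))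
      = r * Im (cis a * (E k (chord_g z1 z2) * cnj (E k (chord_q z2))))"
    by (simp only: Im_of_real_mult)
  then show ?thesis
    using chord_pair[OF k _ ab(3) ab(1), folded z1_def z2_def] r ab by simp
qed

lemma ccw_chord_q:
  assumes z: "z \<in> slit_plane" "0 \<le> Im z"
  shows "ccw (chord_q z)"
  unfolding ccw_def
proof (intro ballI impI)
  fix s t :: real assume st: "s \<in> {0..1}" "t \<in> {0..1}" "s < t"
  have "cnj (chord_q z s) * chord_q z t = of_real ((1 - s) * (1 - t)) * (cnj (ker z s) * ker z t)"
    by (simp add: chord_q_def)
  then have "Im (cnj (chord_q z s) * chord_q z t) = (1 - s) * (1 - t) * Im (cnj (ker z s) * ker z t)"
    by (simp only: Im_of_real_mult)
  also have "\<dots> \<ge> 0"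
    using ker_cross_nonneg[OF z(1) st(1,2) _ z(2)] st by (intro mult_nonneg_nonneg) auto
  finally show "0 \<le> Im (cnj (chord_q z s) * chord_q z t)" .
qed

lemma cis_upper:
  assumes "norm z = 1" "0 < Im z"
  obtains a where "0 < a" "a < pi" "z = cis a"
proof -
  have "z \<noteq> 0" using assms by auto
  then have z: "z = cis (Arg z)" using Arg_eq[of z] assms by (simp add: cis_conv_exp)
  have "0 < Arg z" "Arg z < pi" using assms Arg_lt_pi[of z] by auto
  then show ?thesis using that z by blast
qed

section \<open>Separation of values on the upper semicircle\<close>

lemma LiS_upper_neq:
  assumes k: "k \<in> That" "k' \<in> That" "beta k < beta k'"
    and z: "norm z1 = 1" "0 < Im z1" "norm z2 = 1" "0 < Im z2"
  shows "LiS k z1 \<noteq> LiS k' z2"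
proof
  assume eq: "LiS k z1 = LiS k' z2"
  obtain a b where a: "0 < a" "a < pi" "z1 = cis a" and b: "0 < b" "b < pi" "z2 = cis b"
    using cis_upper z by metis
  have zs: "z1 \<in> slit_plane" "z2 \<in> slit_plane" using cis_slit a b by auto
  show False
  proof (cases "a \<le> b")
    case True
    \<comment> \<open>The common value minus 1 is strictly counterclockwise of
      \<open>LiS k z2 - 1\<close>. As it also equals \<open>LiS k z1 - 1\<close> with
      \<open>a \<le> b\<close>, \<open>arg_mono\<close> gives the opposite weak inequality.\<close>
    have "0 < Im (cnj (qLiS k z2) * qLiS k' z2)"
      using E_cross_less[OF k _ strict_ccw_qLiS[OF zs(2) z(4)]] zs by (simp add: qLiS_def continuous_intros)
    moreover have "cnj (LiS k z2 - 1) * (LiS k' z2 - 1) = (cnj z2 * z2) * (cnj (qLiS k z2) * qLiS k' z2)"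
      by (simp add: LiS_eq_qLiS[OF zs(2)])
    moreover have "cnj z2 * z2 = 1" using z by (simp add: complex_norm_square[symmetric] mult.commute)
    ultimately have "0 < Im (cnj (LiS k z2 - 1) * (LiS k z1 - 1))" using eq by simp
    moreover have "0 \<le> Im (cnj (LiS k z1 - 1) * (LiS k z2 - 1))"
      using arg_mono[OF k(1) a(1) True b(2)] a b by simp
    ultimately show False by (simp add: algebra_simps)
  next
    case False
    \<comment> \<open>The all-ones index has the largest beta, so the smaller index \<open>k\<close>
      contains a digit 0, as the strict chord inequality demands.\<close>
    obtain i where i: "k i \<noteq> 1"
    proof (rule ccontr)
      assume "\<not> thesis"
      then have "k j = 1" for j using that by blast
      moreover have "first_larger k k'" using k beta_less_iff by blast
      ultimately obtain j where "k' j < 1" by (auto simp: first_larger_def)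
      then show False using That_simps(2)[OF k(2), of j] by simp
    qed
    define p where "p = 1 / (1 - z2)"
    \<comment> \<open>Relative to the direction \<open>p - LiS k z2\<close>, the chord puts the
      common value strictly on the left, whereas the order property for \<open>chord_q\<close> puts
      it weakly on the right.\<close>
    have 1: "0 < Im ((LiS k z1 - LiS k z2) * cnj (p - LiS k z2))"
      using chord[OF k(1) i, of "b / 2" "a / 2"] a b False by (simp add: p_def)
    have "0 \<le> Im (cnj (E k (chord_q z2)) * E k' (chord_q z2))"
      using E_cross_le[OF k(1,2) _ _ ccw_chord_q] chord_cont(2)[OF zs] zs(2) z k by simp
    moreover have "cnj (p - LiS k z2) * (p - LiS k' z2)
        = of_real ((norm (z2 / (1 - z2)))\<^sup>2) * (cnj (E k (chord_q z2)) * E k' (chord_q z2))"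
      unfolding p_def LiS_compl[OF zs(2)] complex_norm_square by (simp add: algebra_simps)
    ultimately have "0 \<le> Im (cnj (p - LiS k z2) * (p - LiS k' z2))"
      by (simp only: Im_of_real_mult) simp
    then have "0 \<le> Im (cnj (p - LiS k z2) * (p - LiS k z1))" using eq by simp
    moreover have "Im (cnj (p - LiS k z2) * (p - LiS k z1)) = - Im ((LiS k z1 - LiS k z2) * cnj (p - LiS k z2))"
      by (simp add: algebra_simps)
    ultimately show False using 1 by simp
  qed
qed

text \<open>Once the indices agree, the divided difference of \<open>LiS k\<close> integrates t
  times a product of two kernels from the first quadrant. Its imaginary part is positive, so it
  cannot vanish.\<close>

lemma LiS_upper_inj:
  assumes k: "k \<in> That" "k' \<in> That"
    and z: "norm z1 = 1" "0 < Im z1" "norm z2 = 1" "0 < Im z2"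
    and eq: "LiS k z1 = LiS k' z2"
  shows "k = k' \<and> z1 = z2"
proof -
  have zs: "z1 \<in> slit_plane" "z2 \<in> slit_plane" "Re z1 < 1" "Re z2 < 1"
  proof -
    obtain a b where "0 < a" "a < pi" "z1 = cis a" "0 < b" "b < pi" "z2 = cis b"
      using cis_upper z by metis
    then show "z1 \<in> slit_plane" "z2 \<in> slit_plane" "Re z1 < 1" "Re z2 < 1"
      using cis_slit by auto
  qed
  have "beta k = beta k'"
    using LiS_upper_neq[OF k _ z] LiS_upper_neq[OF k(2,1) _ z(3,4,1,2)] eq by (metis linorder_neqE_linordered_idom)
  then have index_of: "k = k'" using k beta_inj by (auto dest: inj_onD)
  have Im_g: "Im (chord_g z1 z2 t)
      = t * (Re (ker z1 t) * Im (ker z2 t) + Im (ker z1 t) * Re (ker z2 t))" for t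
    by (simp add: chord_g_def)
  have "0 < Im (E k (chord_g z1 z2))"
  proof (rule E_Im_pos_right[OF k(1) chord_cont(1)[OF zs(1,2)]])
    show "0 \<le> Im (chord_g z1 z2 t)" if "t \<in> {0..1}" for t
      unfolding Im_g using Re_ker_pos[OF zs(3) that] Re_ker_pos[OF zs(4) that]
        Im_ker_nonneg[of z1 t] Im_ker_nonneg[of z2 t] z that
      by (intro mult_nonneg_nonneg add_nonneg_nonneg) auto
    show "0 < Im (chord_g z1 z2 t)" if t: "t \<in> {0<..1}" for t
    proof -
      have "0 < Im (ker z1 t)" "0 < Im (ker z2 t)"
        unfolding Im_ker using slit_plane_denom[OF zs(1), of t] slit_plane_denom[OF zs(2), of t] z t by auto
      then show ?thesis
        unfolding Im_g using Re_ker_pos[OF zs(3), of t] Re_ker_pos[OF zs(4), of t] t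
        by (intro mult_pos_pos add_pos_pos) auto
    qed
  qed
  then have "E k (chord_g z1 z2) \<noteq> 0" by auto
  then show ?thesis using LiS_diff[OF zs(1,2), of k] eq index_of by simp
qed

section \<open>Star sums\<close>

text \<open>Moments of a finite index, the walk starting at 0. The argument \<open>n\<close> stands
  for the outer summation variable minus 1, hence the \<open>Suc n\<close> in the
  denominator.\<close>

fun momF :: "nat list \<Rightarrow> nat \<Rightarrow> real" where
  "momF [] n = (if n = 0 then 1 else 0)"
| "momF (k # ks) n = (\<Sum>j\<le>n. momF ks j) / real (Suc n) ^ k"

lemma momF_nonneg: "0 \<le> momF ks n"
  by (induction ks arbitrary: n) (auto intro!: divide_nonneg_nonneg sum_nonneg)

lemma M0_funpow_of_real_pow:
  "s \<in> {0..1} \<Longrightarrow> (M0 ^^ m) (\<lambda>t. of_real t ^ n) s = (1 / of_nat (Suc n) ^ m) * of_real s ^ n"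
proof (induction m arbitrary: s)
  case (Suc m)
  have "(M0 ^^ Suc m) (\<lambda>t. of_real t ^ n) s = M0 ((M0 ^^ m) (\<lambda>t. of_real t ^ n)) s" by simp
  also have "\<dots> = M0 (\<lambda>t. (1 / of_nat (Suc n) ^ m) * of_real t ^ n) s"
    by (rule state.cong[OF state_M0[OF Suc.prems]])
      (use Suc.IH in \<open>auto intro!: continuous_intros simp del: of_nat_Suc\<close>)
  also have "\<dots> = (1 / of_nat (Suc n) ^ m) * (of_real s ^ n / of_nat (Suc n))"
    by (simp only: state.scale[OF state_M0[OF Suc.prems] cont_of_real_pow] M0_of_real_pow[OF Suc.prems])
  finally show ?case by (simp del: of_nat_Suc)
qed simp

lemma block_of_real_pow:
  assumes k: "1 \<le> k" and s: "s \<in> {0..1}"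
  shows "block k (\<lambda>t. of_real t ^ n) s = (1 / of_nat (Suc n) ^ k) * (\<Sum>j\<le>n. of_real s ^ j)"
proof -
  have "block k (\<lambda>t. of_real t ^ n) s = M1 (\<lambda>t. (1 / of_nat (Suc n) ^ (k - 1)) * of_real t ^ n) s"
    unfolding block_def
  proof (rule state.cong[OF state_M1[OF s]])
    show "cont01 ((M0 ^^ (k - 1)) (\<lambda>t. complex_of_real t ^ n))"
      by (intro continuous_intros)
  qed (rule M0_funpow_of_real_pow)
  also have "\<dots> = (1 / of_nat (Suc n) ^ (k - 1)) * ((\<Sum>j\<le>n. of_real s ^ j) / of_nat (Suc n))"
    by (simp only: state.scale[OF state_M1[OF s] cont_of_real_pow] M1_of_real_pow[OF s])
  also have "\<dots> = (1 / of_nat (Suc n) ^ k) * (\<Sum>j\<le>n. of_real s ^ j)"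
    using k by (simp add: power_eq_if del: of_nat_Suc)
  finally show ?thesis .
qed

lemma state_block_pow:
  assumes L: "state L" and k: "1 \<le> k"
  shows "L (block k (\<lambda>t. of_real t ^ n)) = (1 / of_nat (Suc n) ^ k) * (\<Sum>j\<le>n. L (\<lambda>t. of_real t ^ j))"
proof -
  have "L (block k (\<lambda>t. of_real t ^ n)) = L (\<lambda>s. (1 / of_nat (Suc n) ^ k) * (\<Sum>j\<le>n. of_real s ^ j))"
    by (intro state.cong[OF L] continuous_on_block cont_of_real_pow block_of_real_pow k)
  also have "\<dots> = (1 / of_nat (Suc n) ^ k) * (\<Sum>j\<le>n. L (\<lambda>t. of_real t ^ j))"
    by (subst state.scale[OF L], intro continuous_intros, subst state.sum[OF L])
      (auto intro!: continuous_intros)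
  finally show ?thesis .
qed

lemma EF_pow:
  assumes "\<forall>k\<in>set ks. 1 \<le> k"
  shows "EF ks (\<lambda>t. of_real t ^ n) = of_real (momF ks n)"
  using assms
proof (induction ks arbitrary: n)
  case (Cons k ks)
  have "EF (k # ks) (\<lambda>t. of_real t ^ n) = EF ks (block k (\<lambda>t. of_real t ^ n))"
    by (simp add: EF_def)
  also have "\<dots> = (1 / of_nat (Suc n) ^ k) * (\<Sum>j\<le>n. of_real (momF ks j))"
    using Cons by (subst state_block_pow[OF state_EF]) auto
  finally show ?case by (simp del: of_nat_Suc)
qed (simp add: EF_def)

lemma mom_block:
  assumes "k \<in> That"
  shows "mom k n = (\<Sum>j\<le>n. mom (shift k) j) / real (Suc n) ^ k 0"
proof -
  have "of_real (mom k n) = E (shift k) (block (k 0) (\<lambda>t. of_real t ^ n))"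
    unfolding E_of_real_pow[symmetric] shift_def by (rule E_block[OF cont_of_real_pow])
  also have "\<dots> = (1 / of_nat (Suc n) ^ k 0) * (\<Sum>j\<le>n. of_real (mom (shift k) j))"
    using That_simps(2)[OF assms, of 0] by (subst state_block_pow[OF state_E]) (auto simp: E_of_real_pow)
  also have "\<dots> = of_real ((\<Sum>j\<le>n. mom (shift k) j) / real (Suc n) ^ k 0)"
    by (simp del: of_nat_Suc)
  finally show ?thesis by (simp only: of_real_eq_iff)
qed

text \<open>The point mass at 0 has the smallest moments, and the recursion is monotone. The bound
  is uniform in \<open>r\<close> and serves as the majorant for passing to the limit under the
  sum.\<close>

lemma momF_le_mom: "k \<in> That \<Longrightarrow> momF (index_prefix k r) n \<le> mom k n"
proof (induction r arbitrary: k n)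
  case 0
  then show ?case using mom_bounds(1)[of k n] by (simp add: index_prefix_def)
next
  case (Suc r)
  have "momF (index_prefix k (Suc r)) n = (\<Sum>j\<le>n. momF (index_prefix (shift k) r) j) / real (Suc n) ^ k 0"
    by (simp add: index_prefix_Suc shift_def)
  also have "\<dots> \<le> (\<Sum>j\<le>n. mom (shift k) j) / real (Suc n) ^ k 0"
    using Suc.IH[OF shift_That[OF Suc.prems]] by (intro divide_right_mono sum_mono) auto
  also have "\<dots> = mom k n" using mom_block[OF Suc.prems] by simp
  finally show ?case .
qed

lemma set_index_prefix_That: "k \<in> That \<Longrightarrow> \<forall>j\<in>set (index_prefix k r). 1 \<le> j"
  by (auto simp: index_prefix_def That_def)

lemma momF_tendsto_mom: "k \<in> That \<Longrightarrow> (\<lambda>r. momF (index_prefix k r) n) \<longlonglongrightarrow> mom k n"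
  using tendsto_Re[OF EF_tendsto_E[OF cont_of_real_pow, of k n]]
  by (simp add: EF_pow[OF set_index_prefix_That] mom_def)

text \<open>The empty index is admitted to make the recursion uniform.\<close>

definition star_upto :: "nat \<Rightarrow> nat \<Rightarrow> nat list set" where
  "star_upto r n = {ns \<in> star_indices r. \<forall>m\<in>set ns. m \<le> Suc n}"

lemma star_upto_0: "star_upto 0 n = {[]}"
  by (auto simp: star_upto_def star_indices_def)

lemma star_upto_Suc: "star_upto (Suc r) n = (\<Union>j\<in>{..n}. (#) (Suc j) ` star_upto r j)"
proof (intro equalityI subsetI)
  fix ns assume ns: "ns \<in> star_upto (Suc r) n"
  then obtain m ms where m: "ns = m # ms" by (cases ns) (auto simp: star_upto_def star_indices_def)
  then obtain j where "m = Suc j" using ns by (cases m) (auto simp: star_upto_def star_indices_def)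
  then show "ns \<in> (\<Union>j\<in>{..n}. (#) (Suc j) ` star_upto r j)"
    using ns m by (auto simp: star_upto_def star_indices_def)
next
  fix ns assume "ns \<in> (\<Union>j\<in>{..n}. (#) (Suc j) ` star_upto r j)"
  then show "ns \<in> star_upto (Suc r) n"
    by (auto simp: star_upto_def star_indices_def intro: order_trans)
qed

lemma finite_star_upto: "finite (star_upto r n)"
  by (induction r arbitrary: n) (auto simp: star_upto_0 star_upto_Suc)

lemma star_denom_Cons: "star_denom (k # ks) (m # ms) = m ^ k * star_denom ks ms"
  unfolding star_denom_def length_Cons prod.lessThan_Suc_shift by simp

lemma sum_star_upto:
  "(\<Sum>ns\<in>star_upto (length ks) n. 1 / real (star_denom ks ns)) = (\<Sum>j\<le>n. momF ks j)"
proof (induction ks arbitrary: n)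
  case Nil
  then show ?case by (simp add: star_upto_0 star_denom_def)
next
  case (Cons k ks)
  have "(\<Sum>ns\<in>star_upto (length (k # ks)) n. 1 / real (star_denom (k # ks) ns))
      = (\<Sum>j\<le>n. \<Sum>ns\<in>(#) (Suc j) ` star_upto (length ks) j. 1 / real (star_denom (k # ks) ns))"
    unfolding length_Cons star_upto_Suc
    by (rule sum.UNION_disjoint) (auto simp: finite_star_upto)
  also have "\<dots> = (\<Sum>j\<le>n. \<Sum>ns\<in>star_upto (length ks) j. (1 / real (star_denom ks ns)) / real (Suc j) ^ k)"
  proof (rule sum.cong[OF refl])
    fix j
    have "inj_on ((#) (Suc j)) (star_upto (length ks) j)" by simp
    then show "(\<Sum>ns\<in>(#) (Suc j) ` star_upto (length ks) j. 1 / real (star_denom (k # ks) ns))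
        = (\<Sum>ns\<in>star_upto (length ks) j. (1 / real (star_denom ks ns)) / real (Suc j) ^ k)"
      by (simp add: sum.reindex star_denom_Cons mult.commute del: of_nat_Suc)
  qed
  also have "\<dots> = (\<Sum>j\<le>n. momF (k # ks) j)"
    by (simp only: sum_divide_distrib[symmetric] Cons.IH momF.simps)
  finally show ?case .
qed

lemma star_indices_Suc:
  "bij_betw (\<lambda>(n, ns). Suc n # ns) (Sigma UNIV (star_upto r)) (star_indices (Suc r))"
  unfolding bij_betw_def
proof
  show "inj_on (\<lambda>(n, ns). Suc n # ns) (Sigma UNIV (star_upto r))" by (auto simp: inj_on_def)
  have "ns \<in> (\<lambda>(n, ns). Suc n # ns) ` Sigma UNIV (star_upto r)" if ns: "ns \<in> star_indices (Suc r)" for ns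
  proof -
    obtain m ms where m: "ns = m # ms" using ns by (cases ns) (auto simp: star_indices_def)
    then obtain j where "m = Suc j" using ns by (cases m) (auto simp: star_indices_def)
    then show ?thesis
      using ns m by (auto simp: star_upto_def star_indices_def image_iff)
  qed
  then show "(\<lambda>(n, ns). Suc n # ns) ` Sigma UNIV (star_upto r) = star_indices (Suc r)"
    by (auto simp: star_upto_def star_indices_def)
qed

text \<open>The outer weight is left general so that powers of z and the constant 1 are covered
  together. Absolute summability justifies grouping the tuples by their first entry.\<close>

lemma star_has_sum:
  fixes w :: "nat \<Rightarrow> complex"
  assumes w: "summable (\<lambda>n. norm (w n) * momF (k # ks) n)"
  shows "((\<lambda>ns. w (hd ns - 1) / of_nat (star_denom (k # ks) ns)) has_sum (\<Sum>n. w n * of_real (momF (k # ks) n)))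
           (star_indices (Suc (length ks)))"
proof -
  define c where "c = (\<lambda>(n, ns). 1 / (real (Suc n) ^ k * real (star_denom ks ns)))"
  define f where "f = (\<lambda>(n, ns). w n * of_real (c (n, ns)))"
  have cs: "(\<Sum>ns\<in>star_upto (length ks) n. c (n, ns)) = momF (k # ks) n" for n
  proof -
    have "(\<Sum>ns\<in>star_upto (length ks) n. c (n, ns))
        = (\<Sum>ns\<in>star_upto (length ks) n. (1 / real (star_denom ks ns)) / real (Suc n) ^ k)"
      by (simp add: c_def mult.commute del: of_nat_Suc)
    then show ?thesis by (simp only: sum_divide_distrib[symmetric] sum_star_upto momF.simps)
  qed
  have c0: "0 \<le> c x" for x by (simp add: c_def case_prod_beta)
  have "(\<lambda>x. norm (f x)) summable_on Sigma UNIV (star_upto (length ks))"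
  proof (rule summable_on_SigmaI)
    show "((\<lambda>ns. norm (f (n, ns))) has_sum norm (w n) * momF (k # ks) n) (star_upto (length ks) n)" for n
    proof (rule has_sum_finiteI[OF finite_star_upto])
      show "norm (w n) * momF (k # ks) n = (\<Sum>ns\<in>star_upto (length ks) n. norm (f (n, ns)))"
        unfolding cs[symmetric] sum_distrib_left by (simp add: f_def norm_mult c0)
    qed
    show "(\<lambda>n. norm (w n) * momF (k # ks) n) summable_on UNIV"
      by (rule summable_nonneg_imp_summable_on[OF w]) (simp add: momF_nonneg del: momF.simps)
  qed auto
  then have sm: "f summable_on Sigma UNIV (star_upto (length ks))" by (rule abs_summable_summable)
  have "(f has_sum (\<Sum>n. w n * of_real (momF (k # ks) n))) (Sigma UNIV (star_upto (length ks)))"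
  proof (rule has_sum_SigmaI[OF _ _ sm])
    show "((\<lambda>ns. f (n, ns)) has_sum w n * of_real (momF (k # ks) n)) (star_upto (length ks) n)" for n
    proof (rule has_sum_finiteI[OF finite_star_upto])
      show "w n * of_real (momF (k # ks) n) = (\<Sum>ns\<in>star_upto (length ks) n. f (n, ns))"
        unfolding cs[symmetric] of_real_sum sum_distrib_left by (simp add: f_def)
    qed
    have ns: "summable (\<lambda>n. norm (w n * of_real (momF (k # ks) n)))"
      using w by (simp add: norm_mult momF_nonneg del: momF.simps)
    show "((\<lambda>n. w n * of_real (momF (k # ks) n)) has_sum (\<Sum>n. w n * of_real (momF (k # ks) n))) UNIV"
      by (rule norm_summable_imp_has_sum[OF ns summable_sums[OF summable_norm_cancel[OF ns]]])
  qed
  moreover have "(\<lambda>x. (\<lambda>ns. w (hd ns - 1) / of_nat (star_denom (k # ks) ns)) ((\<lambda>(n, ns). Suc n # ns) x)) = f"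
    by (rule ext) (simp add: f_def c_def case_prod_beta star_denom_Cons del: of_nat_Suc)
  ultimately show ?thesis
    using has_sum_reindex_bij_betw[OF star_indices_Suc,
        of "\<lambda>ns. w (hd ns - 1) / of_nat (star_denom (k # ks) ns)"] by (simp only:)
qed

section \<open>Kernel expansion and analytic continuation\<close>

text \<open>The remainder of the geometric series is (tz)^n \<open>ker z t\<close>, bounded by |z|^n
  t^n / d with \<open>d\<close> independent of t. Decay of the moments therefore gives convergence
  on the unit circle as well as inside it.\<close>

lemma (in state) ker_sums:
  assumes z: "z \<in> slit_plane" and lim: "(\<lambda>n. norm z ^ n * Re (L (\<lambda>t. of_real t ^ n))) \<longlonglongrightarrow> 0"
  shows "(\<lambda>n. z ^ n * L (\<lambda>t. of_real t ^ n)) sums L (ker z)"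
proof -
  obtain d where d: "0 < d" "\<And>t. t \<in> {0..1} \<Longrightarrow> d \<le> norm (1 - of_real t * z)"
    using slit_plane_denom_bound[OF z] by blast
  have c: "cont01 (\<lambda>t. complex_of_real t ^ n)" for n by (rule cont_of_real_pow)
  have "(\<lambda>n. L (ker z) - (\<Sum>i<n. z ^ i * L (\<lambda>t. of_real t ^ i))) \<longlonglongrightarrow> 0"
  proof (rule Lim_null_comparison)
    show "(\<lambda>n. (1 / d) * (norm z ^ n * Re (L (\<lambda>t. of_real t ^ n)))) \<longlonglongrightarrow> 0"
      using tendsto_mult_right_zero[OF lim] by blast
    show "\<forall>\<^sub>F n in sequentially. norm (L (ker z) - (\<Sum>i<n. z ^ i * L (\<lambda>t. of_real t ^ i)))
        \<le> (1 / d) * (norm z ^ n * Re (L (\<lambda>t. of_real t ^ n)))"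
    proof (intro always_eventually allI)
      fix n
      have "L (ker z) - (\<Sum>i<n. z ^ i * L (\<lambda>t. of_real t ^ i)) = L (\<lambda>t. ker z t - (\<Sum>i<n. z ^ i * of_real t ^ i))"
        using z c by (simp add: diff sum scale continuous_intros)
      also have "norm \<dots> \<le> Re (L (\<lambda>t. of_real (norm z ^ n / d) * of_real t ^ n))"
      proof (rule norm_le)
        fix t :: real assume t: "t \<in> {0..1}"
        have "(\<Sum>i<n. z ^ i * of_real t ^ i) = (1 - (of_real t * z) ^ n) / (1 - of_real t * z)"
          using slit_plane_denom[OF z t] by (simp add: power_mult_distrib[symmetric] mult.commute sum_gp_strict)
        then have "ker z t - (\<Sum>i<n. z ^ i * of_real t ^ i) = (of_real t * z) ^ n * ker z t"
          by (simp add: ker_def diff_divide_distrib)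
        then have "norm (ker z t - (\<Sum>i<n. z ^ i * of_real t ^ i)) = (t * norm z) ^ n * (1 / norm (1 - of_real t * z))"
          using t by (simp add: ker_def norm_mult norm_power norm_divide)
        also have "\<dots> \<le> (t * norm z) ^ n * (1 / d)"
          using d t by (intro mult_left_mono frac_le) auto
        finally show "norm (ker z t - (\<Sum>i<n. z ^ i * of_real t ^ i)) \<le> Re (of_real (norm z ^ n / d) * of_real t ^ n)"
          by (simp add: power_mult_distrib mult.commute flip: of_real_power of_real_mult)
      qed (use z d(1) in \<open>auto intro!: continuous_intros\<close>)
      also have "\<dots> = (1 / d) * (norm z ^ n * Re (L (\<lambda>t. of_real t ^ n)))"
        by (subst scale[OF c]) (simp flip: of_real_power of_real_divide)
      finally show "norm (L (ker z) - (\<Sum>i<n. z ^ i * L (\<lambda>t. of_real t ^ i))) \<le> \<dots>" .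
    qed
  qed
  then have "(\<lambda>n. \<Sum>i<n. z ^ i * L (\<lambda>t. of_real t ^ i)) \<longlonglongrightarrow> L (ker z)"
    using tendsto_diff[OF tendsto_const[of "L (ker z)"]] by force
  then show ?thesis by (simp add: sums_def)
qed

lemma momF_le_1: "\<forall>k\<in>set ks. 1 \<le> k \<Longrightarrow> momF ks n \<le> 1"
proof -
  assume ks: "\<forall>k\<in>set ks. 1 \<le> k"
  have "norm (EF ks (\<lambda>t. of_real t ^ n)) \<le> 1"
    by (rule state.norm_bound[OF state_EF cont_of_real_pow]) (auto simp: norm_power power_le_one)
  then show ?thesis using EF_pow[OF ks, of n] by simp
qed

lemma connected_slit_plane: "connected slit_plane"
proof (rule starlike_imp_connected, unfold starlike_def, intro bexI ballI subsetI)
  fix z w assume z: "z \<in> slit_plane" and "w \<in> closed_segment 0 z"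
  then obtain u where u: "0 \<le> u" "u \<le> 1" "w = u *\<^sub>R z" by (auto simp: closed_segment_def)
  show "w \<in> slit_plane"
  proof (cases "u = 0")
    case False
    then show ?thesis using z u mult_less_1[of u "Re z"] by (auto simp: slit_plane_iff)
  qed (use u in \<open>simp add: slit_plane_iff\<close>)
qed (simp add: slit_plane_iff)

lemma is_Li_star_EF:
  assumes ks: "\<forall>k\<in>set ks. 1 \<le> k" "ks \<noteq> []"
  shows "is_Li_star ks (\<lambda>z. EF ks (ker z))"
  unfolding is_Li_star_def
proof (intro conjI ballI)
  have "((\<lambda>z. EF ks (ker z)) has_field_derivative EF ks (\<lambda>t. of_real t * (ker z t)\<^sup>2)) (at z)" if "z \<in> slit_plane" for z
    using state.ker_deriv[OF state_EF, of "\<lambda>t. 1" z ks] that by simp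
  then show "(\<lambda>z. EF ks (ker z)) holomorphic_on slit_plane"
    using open_slit_plane by (auto simp: holomorphic_on_open)
  fix z :: complex assume z: "z \<in> ball 0 1"
  obtain k ks' where k: "ks = k # ks'" using ks by (cases ks) auto
  have bnd: "norm z ^ n * momF ks n \<le> norm z ^ n" for n
    using momF_le_1[OF ks(1), of n] mult_left_mono[of "momF ks n" 1 "norm z ^ n"] by simp
  have sm: "summable (\<lambda>n. norm (z ^ n) * momF ks n)"
    by (rule summable_comparison_test'[of "\<lambda>n. norm z ^ n" 0])
      (use z bnd momF_nonneg[of ks] in \<open>auto simp: norm_power summable_geometric\<close>)
  have "(\<lambda>n. z ^ n * EF ks (\<lambda>t. of_real t ^ n)) sums EF ks (ker z)"
    using ball_slit[OF z] summable_LIMSEQ_zero[OF sm]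
    by (intro state.ker_sums[OF state_EF]) (auto simp: EF_pow[OF ks(1)] norm_power)
  then have "(\<Sum>n. z ^ n * of_real (momF ks n)) = EF ks (ker z)"
    by (simp add: EF_pow[OF ks(1)] sums_iff)
  then show "((\<lambda>ns. z ^ (hd ns - 1) / of_nat (star_denom ks ns)) has_sum EF ks (ker z)) (star_indices (length ks))"
    using star_has_sum[of "\<lambda>n. z ^ n" k ks'] sm unfolding k by (simp del: momF.simps)
qed

text \<open>\<open>is_Li_star_EF\<close> supplies a witness for the choice, and any other choice has
  the same sum on the unit disc, hence the same continuation to the connected slit plane.\<close>

lemma Li_star_eq:
  assumes ks: "\<forall>k\<in>set ks. 1 \<le> k" "ks \<noteq> []" and z: "z \<in> slit_plane"
  shows "Li_star ks z = EF ks (ker z)"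
proof -
  have 1: "is_Li_star ks (Li_star ks)"
    unfolding Li_star_def by (rule someI[of "is_Li_star ks", OF is_Li_star_EF[OF ks]])
  show ?thesis
  proof (rule analytic_continuation_open[where f = "Li_star ks" and g = "\<lambda>z. EF ks (ker z)" and s = "ball 0 1"])
    show "Li_star ks holomorphic_on slit_plane" "(\<lambda>z. EF ks (ker z)) holomorphic_on slit_plane"
      using 1 is_Li_star_EF[OF ks] by (auto simp: is_Li_star_def)
    show "Li_star ks w = EF ks (ker w)" if "w \<in> ball 0 1" for w
      using 1 is_Li_star_EF[OF ks] that unfolding is_Li_star_def by (blast intro: has_sum_unique)
  qed (use z ball_slit open_slit_plane connected_slit_plane in auto)
qed

lemma zeta_star_eq:
  assumes ks: "ks \<noteq> []" and sm: "summable (momF ks)"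
  shows "(\<lambda>ns. 1 / real (star_denom ks ns)) summable_on star_indices (length ks)"
    and "zeta_star ks = (\<Sum>n. momF ks n)"
proof -
  obtain k ks' where k: "ks = k # ks'" using ks by (cases ks) auto
  have "((\<lambda>ns. 1 / of_nat (star_denom ks ns)) has_sum (\<Sum>n. complex_of_real (momF ks n))) (star_indices (length ks))"
    using star_has_sum[of "\<lambda>n. 1" k ks'] sm unfolding k by (simp del: momF.simps)
  from has_sum_Re[OF this] have "((\<lambda>ns. 1 / real (star_denom ks ns)) has_sum (\<Sum>n. momF ks n)) (star_indices (length ks))"
    by (simp add: Re_divide_of_nat suminf_of_real[OF sm, symmetric])
  then show "(\<lambda>ns. 1 / real (star_denom ks ns)) summable_on star_indices (length ks)"
    and "zeta_star ks = (\<Sum>n. momF ks n)"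
    by (auto simp: zeta_star_def has_sum_imp_summable infsumI)
qed

text \<open>The numbers \<open>beta (two_ones_two m)\<close> tend to \<open>1/2\<close> from below, and the moments of these indices
  are \<open>O(n powr (-3/2))\<close>.\<close>

definition ones_two :: "nat \<Rightarrow> nat \<Rightarrow> nat" where
  "ones_two m i = (if i = m then 2 else 1)"

definition two_ones_two :: "nat \<Rightarrow> nat \<Rightarrow> nat" where
  "two_ones_two m = (ones_two (Suc m))(0 := 2)"

lemma ones_That: "(\<lambda>i. 1) \<in> That" and ones_two_That: "ones_two m \<in> That" and two_ones_two_That: "two_ones_two m \<in> That"
  by (auto simp: That_def ones_two_def two_ones_two_def)

lemma beta_ones: "beta (\<lambda>i. 1) = 1"
  using beta_rec[OF ones_That] by (simp add: shift_def)

lemma shift_ones_two: "shift (ones_two 0) = (\<lambda>i. 1)" "shift (ones_two (Suc m)) = ones_two m"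
  by (auto simp: shift_def ones_two_def)

lemma beta_ones_two: "beta (ones_two m) = 1 - 1 / 2 ^ Suc m"
proof (induction m)
  case 0
  show ?case using beta_rec[OF ones_two_That, of 0] beta_ones by (simp add: shift_ones_two ones_two_def[of 0 0])
next
  case (Suc m)
  then show ?case using beta_rec[OF ones_two_That, of "Suc m"] 
    by (simp add: shift_ones_two ones_two_def[of "Suc m" 0] add_divide_distrib diff_divide_distrib)
qed

lemma beta_two_ones_two: "beta (two_ones_two m) = 1 / 2 - 1 / 2 ^ (m + 3)"
proof -
  have "shift (two_ones_two m) = ones_two m" by (auto simp: shift_def two_ones_two_def ones_two_def)
  then show ?thesis
    using beta_rec[OF two_ones_two_That, of m] beta_ones_two[of m]
    by (simp add: two_ones_two_def field_simps power_add power3_eq_cube)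
qed

lemma sum_inv_sqrt: "(\<Sum>j\<le>n. 1 / sqrt (real (Suc j))) \<le> 2 * sqrt (real (Suc n))"
proof (induction n)
  case (Suc n)
  have "2 * sqrt (real (Suc n)) + 1 / sqrt (real (Suc (Suc n))) \<le> 2 * sqrt (real (Suc (Suc n)))"
  proof -
    define a b where "a = sqrt (real (Suc n))" and "b = sqrt (real (Suc (Suc n)))"
    have ab: "0 < a" "0 < b" "b\<^sup>2 = a\<^sup>2 + 1" by (auto simp: a_def b_def)
    have "0 \<le> (b - a)\<^sup>2" by simp
    then have "2 * a * b + 1 \<le> 2 * b * b" using ab by (simp add: power2_eq_square algebra_simps)
    then have "2 * a + 1 / b \<le> 2 * b" using ab by (simp add: field_simps)
    then show ?thesis by (simp add: a_def b_def)
  qed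
  then show ?case using Suc by simp
qed simp

text \<open>Averaging preserves the rate 1/sqrt(n+1) up to a factor 2, whereas 1/(n+1) would acquire
  a logarithm at every step; the base case is weakened for that reason. One further digit 0 divides
  by n+1 and makes the rate summable.\<close>

lemma mom_ones_two_bound: "\<exists>C>0. \<forall>n. mom (ones_two m) n \<le> C / sqrt (real (Suc n))"
proof (induction m)
  case 0
  have "mom (ones_two 0) n \<le> 1 / sqrt (real (Suc n))" for n
  proof -
    have "mom (ones_two 0) n \<le> 1 / real (Suc n)"
      using mom_M0[of "ones_two 0" n] mom_bounds(2)[of "(ones_two 0)(0 := ones_two 0 0 - 1)" n]
      by (simp add: ones_two_def[of 0 0] divide_right_mono)
    also have "\<dots> \<le> 1 / sqrt (real (Suc n))"
      by (intro frac_le) (auto simp: real_sqrt_le_iff sqrt_le_D real_le_lsqrt power2_eq_square)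
    finally show ?thesis .
  qed
  then show ?case by (intro exI[of _ 1]) auto
next
  case (Suc m)
  then obtain C where C: "0 < C" "\<And>n. mom (ones_two m) n \<le> C / sqrt (real (Suc n))" by blast
  have "mom (ones_two (Suc m)) n \<le> 2 * C / sqrt (real (Suc n))" for n
  proof -
    have "mom (ones_two (Suc m)) n = (\<Sum>j\<le>n. mom (ones_two m) j) / real (Suc n)"
      using mom_M1[of "ones_two (Suc m)" n] by (simp add: shift_ones_two ones_two_def[of "Suc m" 0])
    also have "\<dots> \<le> (\<Sum>j\<le>n. C * (1 / sqrt (real (Suc j)))) / real (Suc n)"
      using C(2) by (intro divide_right_mono sum_mono) auto
    also have "\<dots> = C * (\<Sum>j\<le>n. 1 / sqrt (real (Suc j))) / real (Suc n)"
      by (simp only: sum_distrib_left)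
    also have "\<dots> \<le> C * (2 * sqrt (real (Suc n))) / real (Suc n)"
      using C(1) sum_inv_sqrt[of n] by (intro divide_right_mono mult_left_mono) auto
    also have "\<dots> = 2 * C / sqrt (real (Suc n))"
    proof -
      have "real (Suc n) = sqrt (real (Suc n)) * sqrt (real (Suc n))" by simp
      then show ?thesis by (simp add: divide_simps del: of_nat_Suc)
    qed
    finally show ?thesis .
  qed
  then show ?case using C by (intro exI[of _ "2 * C"]) auto
qed

lemma summable_mom_two_ones_two: "summable (mom (two_ones_two m))"
proof -
  obtain C where C: "0 < C" "\<And>n. mom (ones_two (Suc m)) n \<le> C / sqrt (real (Suc n))"
    using mom_ones_two_bound by blast
  have "summable (\<lambda>n. C * real (Suc n) powr (- 3 / 2))"
    using summable_real_powr_iff[of "- 3 / 2"]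
    by (intro summable_mult) (subst (asm) summable_Suc_iff[symmetric], simp)
  moreover have "norm (mom (two_ones_two m) n) \<le> C * real (Suc n) powr (- 3 / 2)" for n
  proof -
    have "(two_ones_two m)(0 := 1) = ones_two (Suc m)" by (auto simp: two_ones_two_def ones_two_def)
    then have "mom (two_ones_two m) n = mom (ones_two (Suc m)) n / real (Suc n)"
      using mom_M0[of "two_ones_two m" n] by (simp add: two_ones_two_def)
    also have "\<dots> \<le> C / sqrt (real (Suc n)) / real (Suc n)"
      using C by (intro divide_right_mono) auto
    also have "\<dots> = C * real (Suc n) powr (- 3 / 2)"
    proof -
      have "real (Suc n) powr (- 3 / 2) = real (Suc n) powr (- (1 / 2)) * real (Suc n) powr (- 1)"
        by (subst powr_add[symmetric]) simp
      also have "\<dots> = 1 / sqrt (real (Suc n)) * (1 / real (Suc n))"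
        unfolding powr_minus_divide by (subst powr_half_sqrt) auto
      finally show ?thesis by simp
    qed
    finally show ?thesis using mom_bounds(1)[of "two_ones_two m" n] by simp
  qed
  ultimately show ?thesis by (rule summable_comparison_test'[where N = 0])
qed

lemma mom_mono:
  assumes "k \<in> That" "k' \<in> That" "beta k \<le> beta k'"
  shows "mom k n \<le> mom k' n"
proof -
  have "Re (E k (\<lambda>t. of_real (t ^ n))) \<le> Re (E k' (\<lambda>t. of_real (t ^ n)))"
    by (rule E_mono[OF assms]) (auto intro!: continuous_intros power_mono)
  then show ?thesis by (simp add: mom_def)
qed

lemma two_ones_two_above:
  assumes "x < 1 / 2"
  obtains m where "x < beta (two_ones_two m)"
proof -
  have "(\<lambda>m. 1 / 2 - 1 / 2 ^ (m + 3)) \<longlonglongrightarrow> (1 / 2 :: real)" by real_asymp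
  then have "eventually (\<lambda>m. x < 1 / 2 - 1 / 2 ^ (m + 3)) sequentially"
    using assms by (rule order_tendstoD)
  then obtain m where "x < 1 / 2 - 1 / 2 ^ (m + 3)" using eventually_happens by fastforce
  then show ?thesis using that beta_two_ones_two by metis
qed

lemma summable_mom:
  assumes k: "k \<in> That" "beta k < 1 / 2"
  shows "summable (mom k)"
proof -
  obtain m where m: "beta k < beta (two_ones_two m)" using two_ones_two_above[OF k(2)] .
  show ?thesis
    by (rule summable_comparison_test'[OF summable_mom_two_ones_two[of m], of 0])
      (use mom_mono[OF k(1) two_ones_two_That less_imp_le[OF m]] mom_bounds(1) in auto)
qed

section \<open>Existence and values of the map on its domain\<close>

text \<open>A leading entry 1 forces beta above 1/2 and (2,1,1,...) has beta equal to 1/2, so the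
  indices excluded at z = 1 are precisely those over the slit.\<close>

lemma ST_iff:
  "(z, k) \<in> ST \<longleftrightarrow> norm z = 1 \<and> k \<in> That \<and> (z = 1 \<longrightarrow> beta k < 1 / 2)"
proof -
  define e where "e = (\<lambda>i::nat. if i = 0 then 2 else 1 :: nat)"
  have e: "e \<in> That" "beta e = 1 / 2"
  proof -
    show "e \<in> That" by (auto simp: That_def e_def)
    moreover have "shift e = (\<lambda>i. 1)" by (auto simp: shift_def e_def)
    ultimately show "beta e = 1 / 2" using beta_rec[of e] beta_ones by (simp add: e_def)
  qed
  have "2 \<le> k 0 \<and> k \<noteq> e \<longleftrightarrow> beta k < 1 / 2" if k: "k \<in> That"
  proof
    assume *: "2 \<le> k 0 \<and> k \<noteq> e"
    then have "(2::real) ^ 2 \<le> 2 ^ k 0" by (intro power_increasing) auto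
    then have "2 / 2 ^ k 0 \<le> (1::real) / 2" by (simp add: field_simps)
    then have "beta k \<le> 1 / 2" using beta_bounds(2)[OF k] by linarith
    moreover have "beta k \<noteq> 1 / 2" using * e k inj_onD[OF beta_inj, of k e] by auto
    ultimately show "beta k < 1 / 2" by simp
  next
    assume *: "beta k < 1 / 2"
    have "k 0 \<noteq> 1" using beta_bounds(1)[OF k] * by auto
    then show "2 \<le> k 0 \<and> k \<noteq> e" using That_simps(2)[OF k, of 0] * e by auto
  qed
  then show ?thesis unfolding ST_def e_def by (auto simp: dist_norm)
qed

lemma circle_slit: "norm z = 1 \<Longrightarrow> z \<noteq> 1 \<Longrightarrow> z \<in> slit_plane \<and> Re z < 1"
proof -
  assume z: "norm z = 1" "z \<noteq> 1"
  have "Re z \<le> 1" using complex_Re_le_cmod[of z] z by simp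
  moreover have "Re z \<noteq> 1"
  proof
    assume "Re z = 1"
    moreover from this have "Im z = 0" using z(1) cmod_power2[of z] by simp
    ultimately show False using z(2) by (simp add: complex_eq_iff)
  qed
  ultimately show ?thesis by (auto simp: slit_plane_iff)
qed

lemma Li_star_prefix:
  assumes "k \<in> That" "z \<in> slit_plane"
  shows "(\<lambda>r. Li_star (index_prefix k (Suc r)) z) \<longlonglongrightarrow> LiS k z"
proof -
  have "Li_star (index_prefix k (Suc r)) z = EF (index_prefix k (Suc r)) (ker z)" for r
    by (rule Li_star_eq[OF set_index_prefix_That[OF assms(1)] _ assms(2)]) (simp add: index_prefix_def)
  then show ?thesis
    using LIMSEQ_Suc[OF EF_tendsto_E[OF ker_cont[OF assms(2)], of k]] by (simp add: LiS_def)
qed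

text \<open>Summability of the moments for beta below 1/2 allows Tannery's theorem to exchange the
  limit over prefixes with the sum over n.\<close>

lemma zeta_star_prefix:
  assumes k: "k \<in> That" "beta k < 1 / 2"
  shows "(\<lambda>ns. 1 / real (star_denom (index_prefix k (Suc r)) ns)) summable_on star_indices (Suc r)"
    and "(\<lambda>r. zeta_star (index_prefix k (Suc r))) \<longlonglongrightarrow> (\<Sum>n. mom k n)"
proof -
  have sm: "summable (momF (index_prefix k r))" for r
    by (rule summable_comparison_test'[OF summable_mom[OF k], of 0])
      (use momF_le_mom[OF k(1)] momF_nonneg in auto)
  have ne: "index_prefix k (Suc r) \<noteq> []" for r by (simp add: index_prefix_def)
  show "(\<lambda>ns. 1 / real (star_denom (index_prefix k (Suc r)) ns)) summable_on star_indices (Suc r)"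
    using zeta_star_eq(1)[OF ne sm, of r] by simp
  have "(\<lambda>r. \<Sum>n. momF (index_prefix k r) n) \<longlonglongrightarrow> (\<Sum>n. mom k n)"
  proof (rule tannerys_theorem[THEN conjunct2, THEN conjunct2])
    show "(\<lambda>r. momF (index_prefix k r) n) \<longlonglongrightarrow> mom k n" for n by (rule momF_tendsto_mom[OF k(1)])
    show "summable (mom k)" by (rule summable_mom[OF k])
    show "\<forall>\<^sub>F (n, r) in sequentially \<times>\<^sub>F sequentially. norm (momF (index_prefix k r) n) \<le> mom k n"
      by (intro always_eventually) (use momF_le_mom[OF k(1)] momF_nonneg in auto)
  qed simp
  then show "(\<lambda>r. zeta_star (index_prefix k (Suc r))) \<longlonglongrightarrow> (\<Sum>n. mom k n)"
    using LIMSEQ_Suc[of "\<lambda>r. \<Sum>n. momF (index_prefix k r) n"] by (simp add: zeta_star_eq(2)[OF ne sm])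
qed

lemma eta_S_defined_ST: "p \<in> ST \<Longrightarrow> eta_S_defined p"
proof (cases p)
  case (Pair z k)
  assume "p \<in> ST"
  then have p: "norm z = 1" "k \<in> That" "z = 1 \<Longrightarrow> beta k < 1 / 2" using ST_iff Pair by auto
  show ?thesis
  proof (cases "z = 1")
    case True
    then show ?thesis
      using zeta_star_prefix[OF p(2)] p(3) by (auto simp: eta_S_defined_def Pair convergent_def)
  next
    case False
    have "\<exists>f. is_Li_star (index_prefix k (Suc r)) f" for r
      using is_Li_star_EF[OF set_index_prefix_That[OF p(2)], of "Suc r"] by (auto simp: index_prefix_def)
    then show ?thesis
      using Li_star_prefix[OF p(2)] circle_slit[OF p(1) False] False
      by (auto simp: eta_S_defined_def Pair convergent_def)
  qed
qed

lemma eta_S_eq: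
  assumes "norm z = 1" "k \<in> That" "z = 1 \<longrightarrow> beta k < 1 / 2"
  shows "eta_S (z, k) = (if z = 1 then of_real (\<Sum>n. mom k n) else LiS k z)"
  using assms limI[OF zeta_star_prefix(2)] limI[OF Li_star_prefix] circle_slit
  by (auto simp: eta_S_def)

lemma mom_sums_LiS:
  assumes k: "k \<in> That" "beta k < 1 / 2" and z: "norm z = 1" "z \<noteq> 1"
  shows "(\<lambda>n. z ^ n * of_real (mom k n)) sums LiS k z"
  using state.ker_sums[OF state_E, of z k] circle_slit[OF z] summable_LIMSEQ_zero[OF summable_mom[OF k]] z
  by (simp add: E_of_real_pow LiS_def)

section \<open>Polar coordinates and continuity\<close>

definition index_of :: "real \<Rightarrow> nat \<Rightarrow> nat" where
  "index_of = the_inv_into That beta"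

lemma index_of: "0 < x \<Longrightarrow> x \<le> 1 \<Longrightarrow> index_of x \<in> That \<and> beta (index_of x) = x"
  using the_inv_into_into[OF beta_inj, of x That] f_the_inv_into_f[OF beta_inj, of x]
  by (auto simp: index_of_def beta_image)

lemma index_of_beta: "k \<in> That \<Longrightarrow> index_of (beta k) = k"
  by (simp add: index_of_def the_inv_into_f_f[OF beta_inj])

lemma cut_disc_iff:
  "u \<in> cut_disc \<longleftrightarrow> u \<noteq> 0 \<and> norm u \<le> 1 \<and> (sgn u = 1 \<longrightarrow> norm u < 1 / 2)"
proof -
  have "u \<in> complex_of_real ` {1/2..1} \<longleftrightarrow> sgn u = 1 \<and> 1 / 2 \<le> norm u \<and> norm u \<le> 1" (is "?l \<longleftrightarrow> ?r")
  proof
    assume ?l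
    then show ?r by (auto simp: sgn_of_real)
  next
    assume r: ?r
    then have "u = of_real (norm u)" using sgn_eq[of u] by (auto simp: field_simps split: if_splits)
    then show ?l using r by (metis atLeastAtMost_iff image_eqI)
  qed
  then show ?thesis by (auto simp: cut_disc_def)
qed

definition polar_inv :: "complex \<Rightarrow> complex \<times> (nat \<Rightarrow> nat)" where
  "polar_inv u = (sgn u, index_of (norm u))"

lemma tau_S_facts:
  assumes "p \<in> ST"
  shows "tau_S p \<in> cut_disc" "norm (tau_S p) = beta (snd p)" "sgn (tau_S p) = fst p" "polar_inv (tau_S p) = p"
proof -
  obtain z k where p: "p = (z, k)" by (cases p)
  then have *: "norm z = 1" "k \<in> That" "z = 1 \<longrightarrow> beta k < 1 / 2" using assms ST_iff by auto
  note b = beta_pos[OF *(2)] beta_le_1[OF *(2)]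
  show 1: "norm (tau_S p) = beta (snd p)" using * b by (simp add: p tau_S_def norm_mult)
  have "sgn z = z" using * by (simp add: sgn_eq)
  then show 2: "sgn (tau_S p) = fst p" using b by (simp add: p tau_S_def sgn_mult sgn_of_real)
  show "tau_S p \<in> cut_disc" unfolding cut_disc_iff 1 2 using * b by (auto simp: p tau_S_def)
  show "polar_inv (tau_S p) = p" unfolding polar_inv_def 1 2 using * by (simp add: p index_of_beta)
qed

lemma polar_inv_facts:
  assumes "u \<in> cut_disc"
  shows "polar_inv u \<in> ST" "tau_S (polar_inv u) = u"
proof -
  have u: "u \<noteq> 0" "norm u \<le> 1" "sgn u = 1 \<longrightarrow> norm u < 1 / 2" using assms cut_disc_iff by auto
  then have k: "index_of (norm u) \<in> That" "beta (index_of (norm u)) = norm u" using index_of[of "norm u"] by auto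
  show "polar_inv u \<in> ST" unfolding polar_inv_def ST_iff using u k by (simp add: norm_sgn)
  show "tau_S (polar_inv u) = u" unfolding polar_inv_def tau_S_def using u k by (simp add: sgn_eq)
qed

section \<open>The polar homeomorphism\<close>

lemma tau_S_bij: "bij_betw tau_S ST cut_disc"
  by (rule bij_betw_byWitness[where f' = polar_inv]) (use tau_S_facts polar_inv_facts in auto)

lemma the_inv_tau_S: "u \<in> cut_disc \<Longrightarrow> the_inv_into ST tau_S u = polar_inv u"
  using tau_S_bij polar_inv_facts by (intro the_inv_into_f_eq) (auto simp: bij_betw_def)

lemma topspace_That: "topspace That_topology = That"
  unfolding That_topology_def topspace_pullback_topology using beta_pos beta_le_1 by auto

lemma topspace_ST: "topspace ST_topology = ST"
  unfolding ST_topology_def by (auto simp: topspace_That ST_iff)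

text \<open>A map into a pullback topology is continuous as soon as its composite with
  \<open>beta\<close> is, so the index coordinate of the inverse only has to be checked through the
  norm.\<close>

lemma homeomorphic_map_tau_S: "homeomorphic_map ST_topology (top_of_set cut_disc) tau_S"
proof (rule homeomorphic_maps_imp_map)
  have f: "continuous_map ST_topology (top_of_set (sphere 0 1)) fst"
    unfolding ST_topology_def by (intro continuous_map_from_subtopology continuous_map_fst)
  have s: "continuous_map ST_topology That_topology snd"
    unfolding ST_topology_def by (intro continuous_map_from_subtopology continuous_map_snd)
  have "continuous_map That_topology (top_of_set {0<..1}) (id \<circ> beta)"
    unfolding That_topology_def by (intro continuous_map_pullback) auto
  then have "continuous_map That_topology euclideanreal beta"
    by (simp add: continuous_map_in_subtopology)
  then have b: "continuous_map ST_topology euclideanreal (\<lambda>p. beta (snd p))"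
    using continuous_map_compose[OF s] by (simp add: o_def)
  have c: "continuous_map ST_topology euclidean (\<lambda>p. complex_of_real (beta (snd p)))"
    using continuous_map_compose[OF b, of euclidean complex_of_real]
    by (simp add: o_def continuous_on_of_real_id)
  have tau_eq: "tau_S = (\<lambda>p. fst p * complex_of_real (beta (snd p)))"
    by (auto simp: tau_S_def)
  have m: "continuous_map (prod_topology euclidean euclidean) euclidean (\<lambda>p::complex \<times> complex. fst p * snd p)"
    unfolding euclidean_product_topology by (auto intro!: continuous_intros)
  have "continuous_map ST_topology (prod_topology euclidean euclidean) (\<lambda>p. (fst p, complex_of_real (beta (snd p))))"
    using f c by (intro continuous_map_pairedI) (auto simp: continuous_map_in_subtopology)
  from continuous_map_compose[OF this m]
  have "continuous_map ST_topology euclidean (\<lambda>p. fst p * complex_of_real (beta (snd p)))"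
    by (simp add: o_def)
  then have 1: "continuous_map ST_topology (top_of_set cut_disc) tau_S"
    using tau_S_facts(1) unfolding tau_eq[symmetric] by (auto simp: continuous_map_in_subtopology topspace_ST)
  have n: "continuous_map (top_of_set cut_disc) That_topology (\<lambda>u. index_of (norm u))"
    unfolding That_topology_def
  proof (rule continuous_map_pullback')
    have "continuous_map (top_of_set cut_disc) (top_of_set {0<..1}) norm"
      by (auto simp: continuous_map_in_subtopology cut_disc_iff intro!: continuous_intros)
    then show "continuous_map (top_of_set cut_disc) (top_of_set {0<..1}) (beta \<circ> (\<lambda>u. index_of (norm u)))"
      by (rule continuous_map_eq) (use index_of in \<open>auto simp: cut_disc_iff\<close>)
  qed (use index_of in \<open>auto simp: cut_disc_iff\<close>)
  have g: "continuous_map (top_of_set cut_disc) (top_of_set (sphere 0 1)) sgn"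
    by (auto simp: continuous_map_in_subtopology cut_disc_iff norm_sgn intro!: continuous_intros)
  have 2: "continuous_map (top_of_set cut_disc) ST_topology polar_inv"
    unfolding ST_topology_def continuous_map_in_subtopology polar_inv_def[abs_def]
    using g n polar_inv_facts(1) by (auto intro!: continuous_map_pairedI simp: polar_inv_def)
  show "homeomorphic_maps ST_topology (top_of_set cut_disc) tau_S polar_inv"
    unfolding homeomorphic_maps_def using 1 2 tau_S_facts(4) polar_inv_facts(2) by (auto simp: topspace_ST)
qed

section \<open>Continuity on the slit disc\<close>

definition eta_disc :: "complex \<Rightarrow> complex" where
  "eta_disc u = eta_S (polar_inv u)"

lemma eta_disc_eq:
  assumes "u \<in> cut_disc"
  shows "eta_disc u = (if sgn u = 1 then of_real (\<Sum>n. mom (index_of (norm u)) n) else LiS (index_of (norm u)) (sgn u))"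
  unfolding eta_disc_def polar_inv_def using assms index_of[of "norm u"]
  by (intro eta_S_eq) (auto simp: cut_disc_iff norm_sgn)

lemma eta_disc_series:
  assumes u: "u \<noteq> 0" "norm u < 1 / 2"
  shows "eta_disc u = (\<Sum>n. sgn u ^ n * of_real (mom (index_of (norm u)) n))"
proof -
  have k: "index_of (norm u) \<in> That" "beta (index_of (norm u)) < 1 / 2" using index_of[of "norm u"] u by auto
  have "u \<in> cut_disc" using u by (simp add: cut_disc_iff)
  note eta_disc_eq[OF this]
  moreover have "of_real (\<Sum>n. mom (index_of (norm u)) n) = (\<Sum>n. complex_of_real (mom (index_of (norm u)) n))"
    by (rule suminf_of_real[OF summable_mom[OF k]])
  moreover have "sgn u \<noteq> 1 \<Longrightarrow> LiS (index_of (norm u)) (sgn u) = (\<Sum>n. sgn u ^ n * of_real (mom (index_of (norm u)) n))"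
    using mom_sums_LiS[OF k, of "sgn u"] u by (simp add: norm_sgn sums_iff)
  ultimately show ?thesis by simp
qed

lemma ker_diff_z:
  assumes z: "z \<in> slit_plane" "z0 \<in> slit_plane" and t: "t \<in> {0..1}"
    and d: "d \<le> norm (1 - of_real t * z0)" "0 < d" and dz: "norm (z - z0) \<le> d / 2"
  shows "norm (ker z t - ker z0 t) \<le> 2 / d\<^sup>2 * norm (z - z0)"
proof -
  define a b where "a = 1 - of_real t * z" and "b = 1 - of_real t * z0"
  have nz: "a \<noteq> 0" "b \<noteq> 0" using slit_plane_denom z t unfolding a_def b_def by auto
  have tz: "norm (of_real t * (z - z0)) \<le> norm (z - z0)"
    unfolding norm_mult using t mult_right_mono[of t 1 "norm (z - z0)"] by simp
  have ab: "a = b - of_real t * (z - z0)" by (simp add: a_def b_def algebra_simps)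
  have na: "d / 2 \<le> norm a"
    using norm_triangle_ineq2[of b "of_real t * (z - z0)"] tz d dz unfolding ab b_def by linarith
  have "ker z t - ker z0 t = of_real t * (z - z0) / (a * b)"
    unfolding ker_def a_def[symmetric] b_def[symmetric] using nz by (simp add: ab field_simps)
  then have "norm (ker z t - ker z0 t) = norm (of_real t * (z - z0)) / (norm a * norm b)"
    by (simp add: norm_divide norm_mult)
  also have "\<dots> \<le> norm (z - z0) / (d / 2 * d)"
    using tz na d by (intro frac_le mult_mono mult_pos_pos) (auto simp: b_def)
  also have "\<dots> = 2 / d\<^sup>2 * norm (z - z0)" by (simp add: power2_eq_square)
  finally show ?thesis .
qed

lemma ker_lipschitz:
  assumes z: "z \<in> slit_plane" and d: "0 < d" "\<And>t. t \<in> {0..1} \<Longrightarrow> d \<le> norm (1 - of_real t * z)"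
    and st: "s \<in> {0..1}" "t \<in> {0..1}"
  shows "norm (ker z s - ker z t) \<le> norm z / d\<^sup>2 * \<bar>s - t\<bar>"
proof -
  define a b where "a = 1 - of_real s * z" and "b = 1 - of_real t * z"
  have nz: "a \<noteq> 0" "b \<noteq> 0" using slit_plane_denom z st unfolding a_def b_def by auto
  have "ker z s - ker z t = of_real (s - t) * z / (a * b)"
    unfolding ker_def a_def[symmetric] b_def[symmetric] using nz
    by (simp add: divide_simps) (simp add: a_def b_def algebra_simps)
  then have "norm (ker z s - ker z t) = \<bar>s - t\<bar> * norm z / (norm a * norm b)"
    by (simp add: norm_divide norm_mult flip: of_real_diff)
  also have "\<dots> \<le> \<bar>s - t\<bar> * norm z / (d * d)"
    using d st by (intro frac_le mult_mono) (auto simp: a_def b_def)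
  finally show ?thesis by (simp add: power2_eq_square mult.commute)
qed

text \<open>\<open>d\<close> depends on \<open>z0\<close> alone. Uniformity in the index matters
  because angle and index vary simultaneously when a point of the disc is approached.\<close>

lemma LiS_joint:
  assumes z0: "z0 \<in> slit_plane"
  obtains d where "0 < d" "\<And>k k0 z. \<lbrakk>k \<in> That; k0 \<in> That; z \<in> slit_plane; norm (z - z0) \<le> d / 2\<rbrakk> \<Longrightarrow>
      norm (LiS k z - LiS k0 z0) \<le> 2 / d\<^sup>2 * norm (z - z0) + 2 * (norm z0 / d\<^sup>2) * \<bar>beta k - beta k0\<bar>"
proof -
  obtain d where d: "0 < d" "\<And>t. t \<in> {0..1} \<Longrightarrow> d \<le> norm (1 - of_real t * z0)"
    using slit_plane_denom_bound[OF z0] by blast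
  have "norm (LiS k z - LiS k0 z0) \<le> 2 / d\<^sup>2 * norm (z - z0) + 2 * (norm z0 / d\<^sup>2) * \<bar>beta k - beta k0\<bar>"
    if k: "k \<in> That" "k0 \<in> That" and z: "z \<in> slit_plane" "norm (z - z0) \<le> d / 2" for k k0 z
  proof -
    have "LiS k z - LiS k z0 = E k (\<lambda>t. ker z t - ker z0 t)"
      unfolding LiS_def by (intro state.diff[OF state_E, symmetric] ker_cont z z0)
    also have "norm \<dots> \<le> 2 / d\<^sup>2 * norm (z - z0)"
      using ker_diff_z[OF z(1) z0 _ d(2) d(1) z(2)]
      by (intro E.norm_bound continuous_intros z z0) auto
    finally have "norm (LiS k z - LiS k z0) \<le> 2 / d\<^sup>2 * norm (z - z0)" .
    moreover have "norm (LiS k z0 - LiS k0 z0) \<le> 2 * (norm z0 / d\<^sup>2) * \<bar>beta k - beta k0\<bar>"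
      unfolding LiS_def by (rule E_lipschitz[OF k ker_cont[OF z0] ker_lipschitz[OF z0 d]])
    ultimately show ?thesis
      using norm_triangle_ineq[of "LiS k z - LiS k z0" "LiS k z0 - LiS k0 z0"] by simp
  qed
  then show ?thesis using that d(1) by blast
qed

lemma mom_lipschitz:
  assumes "k \<in> That" "k' \<in> That"
  shows "\<bar>mom k n - mom k' n\<bar> \<le> 2 * real n * \<bar>beta k - beta k'\<bar>"
proof -
  have "norm (E k (\<lambda>t. of_real t ^ n) - E k' (\<lambda>t. of_real t ^ n)) \<le> 2 * real n * \<bar>beta k - beta k'\<bar>"
  proof (rule E_lipschitz[OF assms cont_of_real_pow])
    fix s t :: real assume "s \<in> {0..1}" "t \<in> {0..1}"
    then show "norm (complex_of_real s ^ n - of_real t ^ n) \<le> real n * \<bar>s - t\<bar>"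
      using norm_power_diff[of "complex_of_real s" "of_real t" n] by (simp flip: of_real_diff)
  qed
  then show ?thesis by (simp add: E_of_real_pow flip: of_real_diff)
qed

lemma continuous_on_mom_index_of: "continuous_on {0<..1} (\<lambda>x. mom (index_of x) n)"
proof (rule lipschitz_on_continuous_on)
  show "(2 * real n)-lipschitz_on {0<..1} (\<lambda>x. mom (index_of x) n)"
  proof (rule lipschitz_onI)
    fix x y :: real assume "x \<in> {0<..1}" "y \<in> {0<..1}"
    then show "dist (mom (index_of x) n) (mom (index_of y) n) \<le> 2 * real n * dist x y"
      using mom_lipschitz[of "index_of x" "index_of y" n] index_of[of x] index_of[of y] by (simp add: dist_real_def)
  qed simp
qed

text \<open>Near the positive axis the kernel admits no uniform bound, so continuity comes from the
  M-test. Moments increase with beta, hence those of the single index \<open>two_ones_two m\<close>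
  dominate on the whole set.\<close>

lemma continuous_on_eta_disc_series:
  "continuous_on {u. u \<noteq> 0 \<and> norm u < beta (two_ones_two m)} eta_disc"
proof -
  define V where "V = {u::complex. u \<noteq> 0 \<and> norm u < beta (two_ones_two m)}"
  have b: "beta (two_ones_two m) < 1 / 2" by (simp add: beta_two_ones_two)
  have V: "u \<noteq> 0" "norm u < 1 / 2" "index_of (norm u) \<in> That" "beta (index_of (norm u)) \<le> beta (two_ones_two m)" if "u \<in> V" for u
    using that b index_of[of "norm u"] by (auto simp: V_def)
  have "continuous_on V (\<lambda>u. \<Sum>n. sgn u ^ n * of_real (mom (index_of (norm u)) n))"
  proof (rule uniform_limit_theorem)
    show "uniform_limit V (\<lambda>N u. \<Sum>n<N. sgn u ^ n * of_real (mom (index_of (norm u)) n))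
        (\<lambda>u. \<Sum>n. sgn u ^ n * of_real (mom (index_of (norm u)) n)) sequentially"
    proof (rule Weierstrass_m_test[OF _ summable_mom_two_ones_two[of m]])
      fix n u assume u: "u \<in> V"
      show "norm (sgn u ^ n * complex_of_real (mom (index_of (norm u)) n)) \<le> mom (two_ones_two m) n"
        using mom_mono[OF V(3)[OF u] two_ones_two_That V(4)[OF u], of n] V(1)[OF u] mom_bounds(1)[of "index_of (norm u)" n]
        by (simp add: norm_mult norm_power norm_sgn)
    qed
    have "continuous_on V (\<lambda>u. mom (index_of (norm u)) n)" for n
      by (rule continuous_on_compose2[OF continuous_on_mom_index_of]) (use V in \<open>force intro!: continuous_intros\<close>)+
    then show "\<forall>\<^sub>F N in sequentially. continuous_on V (\<lambda>u. \<Sum>n<N. sgn u ^ n * of_real (mom (index_of (norm u)) n))"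
      using V(1) by (intro always_eventually allI continuous_intros) auto
  qed simp
  then show ?thesis
    unfolding V_def[symmetric] by (rule continuous_on_eq) (use V eta_disc_series in auto)
qed

lemma continuous_on_eta_disc: "continuous_on cut_disc eta_disc"
  unfolding continuous_on_def
proof
  fix u0 assume u0: "u0 \<in> cut_disc"
  show "(eta_disc \<longlongrightarrow> eta_disc u0) (at u0 within cut_disc)"
  proof (cases "sgn u0 = 1")
    case True
    \<comment> \<open>On the positive axis the series is used in a neighbourhood; at all other
      points nearby angles stay away from 1 and the kernel estimate applies.\<close>
    then have "norm u0 < 1 / 2" using u0 by (simp add: cut_disc_iff)
    then obtain m where m: "norm u0 < beta (two_ones_two m)" using two_ones_two_above by blast
    have "open {u::complex. u \<noteq> 0 \<and> norm u < beta (two_ones_two m)}"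
      by (intro open_Collect_conj open_Collect_less open_Collect_neq continuous_intros)
    then have "isCont eta_disc u0"
      using continuous_on_eta_disc_series[of m] u0 m by (auto simp: continuous_on_eq_continuous_at cut_disc_iff)
    then show ?thesis unfolding isCont_def by (rule tendsto_within_subset) simp
  next
    case False
    have u0': "u0 \<noteq> 0" "norm u0 \<le> 1" using u0 by (auto simp: cut_disc_iff)
    have z0: "sgn u0 \<in> slit_plane" using circle_slit[OF _ False] u0' by (simp add: norm_sgn)
    obtain d where d: "0 < d" "\<And>k k0 z. \<lbrakk>k \<in> That; k0 \<in> That; z \<in> slit_plane; norm (z - sgn u0) \<le> d / 2\<rbrakk> \<Longrightarrow>
      norm (LiS k z - LiS k0 (sgn u0)) \<le> 2 / d\<^sup>2 * norm (z - sgn u0) + 2 * (norm (sgn u0) / d\<^sup>2) * \<bar>beta k - beta k0\<bar>"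
      using LiS_joint[OF z0] by blast
    have sgn_lim: "(sgn \<longlongrightarrow> sgn u0) (at u0 within cut_disc)"
      using u0' by (intro tendsto_intros) auto
    have "((\<lambda>u. eta_disc u - eta_disc u0) \<longlongrightarrow> 0) (at u0 within cut_disc)"
    proof (rule Lim_null_comparison)
      show "((\<lambda>u. 2 / d\<^sup>2 * norm (sgn u - sgn u0) + 2 * (norm (sgn u0) / d\<^sup>2) * \<bar>norm u - norm u0\<bar>) \<longlongrightarrow> 0)
          (at u0 within cut_disc)"
        by (rule tendsto_eq_intros sgn_lim refl tendsto_ident_at | simp)+
      have "\<forall>\<^sub>F u in at u0 within cut_disc. sgn u \<in> - {1} \<and> dist (sgn u) (sgn u0) < d / 2 \<and> u \<in> cut_disc"
        using topological_tendstoD[OF sgn_lim, of "- {1}"] tendstoD[OF sgn_lim, of "d / 2"] False d(1)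
        by (auto simp: eventually_conj_iff eventually_at_filter)
      then show "\<forall>\<^sub>F u in at u0 within cut_disc. norm (eta_disc u - eta_disc u0)
          \<le> 2 / d\<^sup>2 * norm (sgn u - sgn u0) + 2 * (norm (sgn u0) / d\<^sup>2) * \<bar>norm u - norm u0\<bar>"
      proof eventually_elim
        case (elim u)
        have u: "u \<noteq> 0" "norm u \<le> 1" "u \<in> cut_disc" "sgn u \<noteq> 1" using elim by (auto simp: cut_disc_iff)
        have "sgn u \<in> slit_plane" using circle_slit[OF _ u(4)] u by (simp add: norm_sgn)
        then show ?case
          using d(2)[of "index_of (norm u)" "index_of (norm u0)" "sgn u"] index_of[of "norm u"] index_of[of "norm u0"] u u0' elim
            eta_disc_eq[OF u(3)] eta_disc_eq[OF u0] False
          by (simp add: dist_norm)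
      qed
    qed
    then show ?thesis by (simp add: LIM_zero_iff)
  qed
qed

section \<open>Injectivity and range\<close>

lemma LiS_real_at_minus_1: "LiS k (- 1) = of_real (Re (E k (\<lambda>t. of_real (1 / (1 + t)))))"
proof -
  have c: "cont01 (\<lambda>t. complex_of_real (1 / (1 + t)))"
    by (intro continuous_intros) auto
  have "LiS k (- 1) = E k (\<lambda>t. of_real (1 / (1 + t)))"
    unfolding LiS_def by (rule arg_cong[of _ _ "E k"]) (simp add: ker_def fun_eq_iff)
  then show ?thesis using E.real[OF c, of k] by (simp add: complex_eq_iff)
qed

lemma LiS_minus_1_less_1:
  assumes k: "k \<in> That"
  shows "Re (LiS k (- 1)) < 1"
proof -
  have z: "- 1 \<in> slit_plane" by (simp add: slit_plane_iff)
  have "0 < Re (E k (\<lambda>t. 1 - ker (- 1) t))"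
  proof (rule E_pos_right[OF k])
    show "cont01 (\<lambda>t. 1 - ker (- 1) t)" by (intro continuous_intros z)
    have *: "Re (ker (- 1) t) = 1 / (1 + t)" for t
      by (simp add: ker_def Re_divide power2_eq_square)
    show "0 \<le> Re (1 - ker (- 1) t)" if "t \<in> {0..1}" for t
      using that by (simp add: *)
    show "0 < Re (1 - ker (- 1) t)" if "t \<in> {0<..1}" for t
      using that by (simp add: *)
  qed
  then show ?thesis
    by (simp add: LiS_def E.diff E.unit continuous_intros z)
qed

lemma sum_mom_greater_1:
  assumes k: "k \<in> That" "beta k < 1 / 2"
  shows "1 < (\<Sum>n. mom k n)"
proof -
  have "(\<Sum>n<2. mom k n) \<le> (\<Sum>n. mom k n)"
    by (rule sum_le_suminf[OF summable_mom[OF k]]) (auto simp: mom_bounds)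
  moreover have "(\<Sum>n<2. mom k n) = 1 + beta k"
    using mom_1[OF k(1)] by (simp add: numeral_2_eq_2)
  ultimately show ?thesis using beta_pos[OF k(1)] by simp
qed

lemma sum_mom_strict_mono:
  assumes k: "k \<in> That" "k' \<in> That" "beta k < beta k'" "beta k' < 1 / 2"
  shows "(\<Sum>n. mom k n) < (\<Sum>n. mom k' n)"
proof -
  have sm: "summable (mom k)" "summable (mom k')" using k by (auto intro: summable_mom)
  have "0 < (\<Sum>n. mom k' n - mom k n)"
    using mom_mono[OF k(1,2)] k mom_1[OF k(1)] mom_1[OF k(2)]
    by (intro suminf_pos2[where i = 1] summable_diff sm) auto
  then show ?thesis using suminf_diff[OF sm(2,1)] by simp
qed

lemma LiS_minus_1_strict_antimono:
  assumes k: "k \<in> That" "k' \<in> That" "beta k < beta k'"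
  shows "Re (LiS k' (- 1)) < Re (LiS k (- 1))"
proof -
  have c: "cont01 (\<lambda>t. complex_of_real (1 / (1 + t)))"
    by (intro continuous_intros) auto
  have "Re (E k (\<lambda>t. of_real (- (1 / (1 + t))))) < Re (E k' (\<lambda>t. of_real (- (1 / (1 + t)))))"
    by (rule E_strict_mono[OF k]) (auto intro!: continuous_intros simp: frac_less2)
  then show ?thesis
    unfolding LiS_real_at_minus_1 of_real_minus E.minus[OF c] by simp
qed

lemma Im_LiS_sgn:
  assumes "k \<in> That" "z \<in> slit_plane"
  shows "0 < Im z \<Longrightarrow> 0 < Im (LiS k z)" "Im z < 0 \<Longrightarrow> Im (LiS k z) < 0"
  using Im_LiS_pos[OF assms(1), of z] Im_LiS_pos[OF assms(1), of "cnj z"] LiS_cnj[OF assms(2)] by auto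

lemma circle_cases:
  assumes "norm z = 1"
  obtains "z = 1" | "z = -1" | "0 < Im z" | "Im z < 0"
proof -
  have "z = 1 \<or> z = -1" if "Im z = 0"
    using assms that cmod_power2[of z] by (auto simp: complex_eq_iff power2_eq_1_iff)
  then show ?thesis using that by fastforce
qed

lemma eta_inj:
  assumes p: "norm z = 1" "k \<in> That" "z = 1 \<longrightarrow> beta k < 1 / 2"
    and p': "norm z' = 1" "k' \<in> That" "z' = 1 \<longrightarrow> beta k' < 1 / 2"
    and eq: "eta_S (z, k) = eta_S (z', k')"
  shows "z = z' \<and> k = k'"
proof -
  note e = eta_S_eq[OF p] eta_S_eq[OF p']
  have k_eq: "k = k'" if "\<not> beta k < beta k'" "\<not> beta k' < beta k"
    using that p(2) p'(2) inj_onD[OF beta_inj, of k k'] by simp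
  \<comment> \<open>The imaginary part of the value has the sign of that of the point, and the real
    values taken at 1 and -1 lie on different sides of 1. Equal values therefore put both points
    into the same one of four classes.\<close>
  have vals: "(w = 1 \<longrightarrow> Im (eta_S (w, l)) = 0 \<and> 1 < Re (eta_S (w, l))) \<and>
      (w = -1 \<longrightarrow> Im (eta_S (w, l)) = 0 \<and> Re (eta_S (w, l)) < 1) \<and>
      (0 < Im w \<longrightarrow> 0 < Im (eta_S (w, l))) \<and> (Im w < 0 \<longrightarrow> Im (eta_S (w, l)) < 0)"
    if w: "norm w = 1" "l \<in> That" "w = 1 \<longrightarrow> beta l < 1 / 2" for w l
  proof (cases "w = 1")
    case True
    then show ?thesis using sum_mom_greater_1[OF w(2)] w(3) eta_S_eq[OF w] by simp
  next
    case False
    have "eta_S (w, l) = LiS l w" using eta_S_eq[OF w] False by simp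
    moreover have "Im (LiS l (- 1)) = 0" unfolding LiS_real_at_minus_1 by (rule Im_complex_of_real)
    ultimately show ?thesis
      using Im_LiS_sgn[OF w(2), of w] circle_slit[OF w(1) False] LiS_minus_1_less_1[OF w(2)] False by auto
  qed
  note v = vals[OF p] vals[OF p', folded eq]
  from p(1) show ?thesis
  proof (cases rule: circle_cases)
    case 1
    then have z': "z' = 1" using p'(1) v by (cases rule: circle_cases[OF p'(1)]) auto
    have "(\<Sum>n. mom k n) = (\<Sum>n. mom k' n)" using e eq 1 z' by simp
    then have "k = k'"
      using sum_mom_strict_mono[OF p(2) p'(2)] sum_mom_strict_mono[OF p'(2) p(2)] p(3) p'(3) 1 z' k_eq by force
    then show ?thesis using 1 z' by simp
  next
    case 2
    then have z': "z' = -1" using p'(1) v by (cases rule: circle_cases[OF p'(1)]) auto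
    have "LiS k (-1) = LiS k' (-1)" using e eq 2 z' by simp
    then have "k = k'"
      using LiS_minus_1_strict_antimono[OF p(2) p'(2)] LiS_minus_1_strict_antimono[OF p'(2) p(2)] k_eq by force
    then show ?thesis using 2 z' by simp
  next
    case 3
    then have z': "0 < Im z'" using p'(1) v by (cases rule: circle_cases[OF p'(1)]) auto
    have "z \<noteq> 1" "z' \<noteq> 1" using 3 z' by auto
    then have "LiS k z = LiS k' z'" using e eq by simp
    then show ?thesis using LiS_upper_inj[OF p(2) p'(2) p(1) 3 p'(1) z'] by blast
  next
    case 4
    then have z': "Im z' < 0" using p'(1) v by (cases rule: circle_cases[OF p'(1)]) auto
    have n: "z \<noteq> 1" "z' \<noteq> 1" using 4 z' by auto
    then have "LiS k (cnj z) = LiS k' (cnj z')"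
      using e eq LiS_cnj circle_slit[OF p(1)] circle_slit[OF p'(1)] by simp
    then have "k = k' \<and> cnj z = cnj z'"
      using LiS_upper_inj[OF p(2) p'(2), of "cnj z" "cnj z'"] p p' 4 z' by simp
    then show ?thesis by simp
  qed
qed

lemma inj_on_eta_S: "inj_on eta_S ST"
  by (rule inj_onI) (metis ST_iff eta_inj surj_pair)

lemma inj_on_eta_disc: "inj_on eta_disc cut_disc"
proof (rule inj_onI)
  fix u v assume *: "u \<in> cut_disc" "v \<in> cut_disc" "eta_disc u = eta_disc v"
  then have "polar_inv u = polar_inv v"
    using inj_onD[OF inj_on_eta_S] polar_inv_facts(1) unfolding eta_disc_def by blast
  then show "u = v" using polar_inv_facts(2) * by metis
qed

section \<open>Range and growth\<close>

text \<open>The origin of the half plane: for z on the circle the kernel has real part above 1/2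
  except at t = 1, where the boundary line is attained.\<close>

lemma Re_ker_circle:
  assumes z: "norm z = 1" "z \<noteq> 1" and t: "t \<in> {0..1}"
  shows "Re (ker z t) - 1 / 2 = (1 - t\<^sup>2) / (2 * (norm (1 - of_real t * z))\<^sup>2)"
proof -
  have nz: "1 - of_real t * z \<noteq> 0" using slit_plane_denom[OF _ t] circle_slit[OF z] by blast
  have "(norm (1 - of_real t * z))\<^sup>2 = 1 - 2 * t * Re z + t\<^sup>2 * ((Re z)\<^sup>2 + (Im z)\<^sup>2)"
    unfolding cmod_power2 by (simp add: power2_eq_square algebra_simps)
  also have "(Re z)\<^sup>2 + (Im z)\<^sup>2 = 1" using z(1) cmod_power2[of z] by simp
  finally have "(norm (1 - of_real t * z))\<^sup>2 = 1 - 2 * t * Re z + t\<^sup>2" by simp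
  then show ?thesis unfolding Re_ker using nz by (simp add: field_simps)
qed

lemma not_ones:
  assumes "k \<in> That" "beta k < 1"
  obtains i where "k i \<noteq> 1"
  using assms beta_ones by (metis ext less_irrefl)

lemma Re_LiS_greater_half:
  assumes k: "k \<in> That" "beta k < 1" and z: "norm z = 1" "z \<noteq> 1"
  shows "1 / 2 < Re (LiS k z)"
proof -
  obtain i where i: "k i \<noteq> 1" using not_ones[OF k] .
  have zs: "z \<in> slit_plane" using circle_slit[OF z] by blast
  have "0 < Re (E k (\<lambda>t. ker z t - 1 / 2))"
  proof (rule E_pos_left[OF k(1) i])
    show "cont01 (\<lambda>t. ker z t - 1 / 2)" by (intro continuous_intros zs)
    show "0 \<le> Re (ker z t - 1 / 2)" if "t \<in> {0..1}" for t
      using Re_ker_circle[OF z that] that by (simp add: power_le_one)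
    show "0 < Re (ker z t - 1 / 2)" if "t \<in> {0..<1}" for t
    proof -
      have "t\<^sup>2 < 1" using that by (simp add: power_less_one_iff abs_square_less_1)
      moreover have "1 - of_real t * z \<noteq> 0" using slit_plane_denom[OF zs, of t] that by simp
      ultimately show ?thesis using Re_ker_circle[OF z, of t] that by simp
    qed
  qed
  then show ?thesis
    by (simp add: LiS_def E.diff E.const continuous_intros zs)
qed

text \<open>The mean for the all-ones index is 1, so the nonnegative function 1 - t integrates to 0
  and anything bounded by a multiple of it does too.\<close>

lemma E_ones:
  assumes f: "cont01 f"
    and C: "\<And>t. t \<in> {0..1} \<Longrightarrow> norm (f t - f 1) \<le> C * (1 - t)"
  shows "E (\<lambda>i. 1) f = f 1"
proof -
  have "norm (E (\<lambda>i. 1) (\<lambda>t. f t - f 1)) \<le> Re (E (\<lambda>i. 1) (\<lambda>t. of_real C * (1 - of_real t ^ 1)))"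
    by (rule E.norm_le) (use C in \<open>auto intro!: continuous_intros f simp flip: of_real_diff\<close>)
  also have "E (\<lambda>i. 1) (\<lambda>t. of_real C * (1 - of_real t ^ 1)) = of_real C * (1 - E (\<lambda>i. 1) (\<lambda>t. of_real t ^ 1))"
    by (subst E.scale, intro continuous_intros, subst E.diff)
      (auto intro!: continuous_intros simp: E.unit)
  also have "\<dots> = 0" unfolding E_of_real_pow mom_1[OF ones_That] beta_ones by simp
  finally show ?thesis using f by (simp add: E.diff E.const)
qed

lemma LiS_ones:
  assumes z: "z \<in> slit_plane"
  shows "LiS (\<lambda>i. 1) z = 1 / (1 - z)"
proof -
  obtain d where d: "0 < d" "\<And>t. t \<in> {0..1} \<Longrightarrow> d \<le> norm (1 - of_real t * z)"
    using slit_plane_denom_bound[OF z] by blast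
  have "E (\<lambda>i. 1) (ker z) = ker z 1"
  proof (rule E_ones[OF ker_cont[OF z]])
    fix t :: real assume t: "t \<in> {0..1}"
    show "norm (ker z t - ker z 1) \<le> norm z / d\<^sup>2 * (1 - t)"
      using ker_lipschitz[OF z d t, of 1] t by simp
  qed
  then show ?thesis by (simp add: LiS_def ker_def)
qed

lemma mom_ones: "mom (\<lambda>i. 1) n = 1"
proof -
  have "E (\<lambda>i. 1) (\<lambda>t. of_real t ^ n) = of_real 1 ^ n"
  proof (rule E_ones[OF cont_of_real_pow, where C = "real n"])
    fix t :: real assume t: "t \<in> {0..1}"
    show "norm (complex_of_real t ^ n - of_real 1 ^ n) \<le> real n * (1 - t)"
      using norm_power_diff[of "complex_of_real t" "of_real 1" n] t
      unfolding of_real_diff[symmetric] norm_of_real by simp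
  qed
  then show ?thesis by (simp add: mom_def)
qed

lemma eta_disc_inner:
  assumes u: "u \<in> cut_disc" "norm u < 1"
  shows "1 / 2 < Re (eta_disc u) \<and> eta_disc u \<noteq> 1"
proof -
  have u': "u \<noteq> 0" "norm u \<le> 1" "sgn u = 1 \<longrightarrow> norm u < 1 / 2" using u by (auto simp: cut_disc_iff)
  have k: "index_of (norm u) \<in> That" "beta (index_of (norm u)) = norm u" using index_of[of "norm u"] u' by auto
  have n: "norm (sgn u) = 1" using u' by (simp add: norm_sgn)
  show ?thesis
  proof (cases "sgn u = 1")
    case True
    then show ?thesis using sum_mom_greater_1[OF k(1)] k u' eta_disc_eq[OF u(1)] by (auto simp: complex_eq_iff)
  next
    case False
    have zs: "sgn u \<in> slit_plane" using circle_slit[OF n False] by blast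
    have "LiS (index_of (norm u)) (sgn u) \<noteq> 1"
      using n
    proof (cases rule: circle_cases)
      case 2
      then show ?thesis using LiS_minus_1_less_1[OF k(1)] by auto
    next
      case 3
      then show ?thesis using Im_LiS_sgn(1)[OF k(1) zs] by auto
    next
      case 4
      then show ?thesis using Im_LiS_sgn(2)[OF k(1) zs] by auto
    qed (use False in auto)
    then show ?thesis using Re_LiS_greater_half[OF k(1) _ n False] k u(2) eta_disc_eq[OF u(1)] False by simp
  qed
qed

lemma eta_disc_outer:
  assumes u: "u \<in> cut_disc" "norm u = 1"
  shows "eta_disc u = 1 / (1 - u) \<and> u \<noteq> 1"
proof -
  have sgn: "sgn u = u" using u by (simp add: sgn_eq)
  have u1: "u \<noteq> 1" using u sgn by (auto simp: cut_disc_iff)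
  have "index_of 1 = (\<lambda>i. 1)" using index_of_beta[OF ones_That] beta_ones by simp
  then show ?thesis using eta_disc_eq[OF u(1)] u sgn u1 LiS_ones circle_slit[OF u(2) u1] by simp
qed

lemma Re_inv_circle: "norm u = 1 \<Longrightarrow> u \<noteq> 1 \<Longrightarrow> Re (1 / (1 - u)) = 1 / 2"
  using Re_ker_circle[of u 1] by (simp add: ker_def)

lemma eta_disc_in_Hplane: "u \<in> cut_disc \<Longrightarrow> eta_disc u \<in> Hplane - {1}"
proof (cases "norm u = 1")
  case True
  assume u: "u \<in> cut_disc"
  then have "Re (eta_disc u) = 1 / 2" using eta_disc_outer[OF u True] Re_inv_circle[OF True] by simp
  then show ?thesis by (auto simp: Hplane_def)
next
  case False
  assume u: "u \<in> cut_disc"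
  then have "norm u < 1" using False by (simp add: cut_disc_iff)
  then show ?thesis using eta_disc_inner[OF u] by (auto simp: Hplane_def)
qed

text \<open>For this \<open>r\<close> the function r/(1 - rt) equals 1/(1 - t + |1 - z|), a lower
  bound for the modulus of the kernel. In the closed upper half plane the kernel lies in the first
  quadrant, so its modulus is at most Re + Im, the real part of (1 - i) times the kernel, and this
  survives integration. The lower half plane follows by conjugation.\<close>

lemma LiS_lower_bound:
  assumes k: "k \<in> That" and z: "norm z = 1" "z \<noteq> 1"
  defines "r \<equiv> 1 / (1 + norm (1 - z))"
  shows "1 / 2 * (r * (\<Sum>i<N. r ^ i * mom k i)) \<le> norm (LiS k z)"
proof -
  have main: "1 / 2 * (r * (\<Sum>i<N. r ^ i * mom k i)) \<le> norm (LiS k w)"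
    if w: "norm w = 1" "w \<noteq> 1" "0 \<le> Im w" "norm (1 - w) = norm (1 - z)" for w
  proof -
    have ws: "w \<in> slit_plane" "Re w < 1" using circle_slit[OF w(1,2)] by auto
    have r: "0 < r" "r < 1" unfolding r_def using z by (auto simp: add_pos_nonneg divide_less_eq)
    have "Re (E k (\<lambda>t. of_real r * (\<Sum>i<N. of_real (r ^ i) * of_real t ^ i))) \<le> Re (E k (\<lambda>t. (1 - \<i>) * ker w t))"
    proof (rule E.mono)
      fix t :: real assume t: "t \<in> {0..1}"
      have rt: "r * t < 1" using r mult_less_1[OF t, of r] by (simp add: mult.commute)
      have "(\<Sum>i<N. (r * t) ^ i) = (1 - (r * t) ^ N) / (1 - r * t)"
        using rt by (simp add: sum_gp_strict)
      also have "\<dots> \<le> 1 / (1 - r * t)"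
        using rt r t by (intro divide_right_mono) auto
      finally have "r * (\<Sum>i<N. (r * t) ^ i) \<le> r * (1 / (1 - r * t))"
        using r by (intro mult_left_mono) auto
      also have "\<dots> = 1 / (1 - t + norm (1 - w))"
      proof -
        have "1 - r * t = r * (1 - t + norm (1 - w))"
        proof -
          have "1 + norm (1 - z) \<noteq> 0" using norm_ge_zero[of "1 - z"] by linarith
          then show ?thesis unfolding r_def w(4) by (simp add: field_simps)
        qed
        then show ?thesis using r by simp
      qed
      also have "\<dots> \<le> 1 / norm (1 - of_real t * w)"
      proof (intro divide_left_mono mult_pos_pos)
        have "1 - of_real t * w = of_real (1 - t) + of_real t * (1 - w)" by (simp add: algebra_simps)
        then have "norm (1 - of_real t * w) \<le> \<bar>1 - t\<bar> + \<bar>t\<bar> * norm (1 - w)"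
          by (metis norm_mult norm_of_real norm_triangle_ineq)
        also have "\<dots> \<le> 1 - t + 1 * norm (1 - w)"
          using t by (intro add_mono mult_right_mono) auto
        finally show "norm (1 - of_real t * w) \<le> 1 - t + norm (1 - w)" by simp
        have "0 < norm (1 - w)" using w(2) by simp
        moreover have "t \<le> 1" using t by simp
        ultimately show "0 < 1 - t + norm (1 - w)" by linarith
      qed (use slit_plane_denom[OF ws(1) t] in auto)
      also have "\<dots> = norm (ker w t)" by (simp add: ker_def norm_divide)
      also have "\<dots> \<le> Re (ker w t) + Im (ker w t)"
        using cmod_le[of "ker w t"] Re_ker_pos[OF ws(2) t] Im_ker_nonneg[OF w(3), of t] t by simp
      finally show "Re (of_real r * (\<Sum>i<N. of_real (r ^ i) * of_real t ^ i)) \<le> Re ((1 - \<i>) * ker w t)"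
        by (simp add: power_mult_distrib flip: of_real_power of_real_mult of_real_sum)
    qed (auto intro!: continuous_intros ws)
    also have "E k (\<lambda>t. (1 - \<i>) * ker w t) = (1 - \<i>) * LiS k w"
      unfolding LiS_def by (rule E.scale[OF ker_cont[OF ws(1)]])
    also have "E k (\<lambda>t. of_real r * (\<Sum>i<N. of_real (r ^ i) * of_real t ^ i)) = of_real (r * (\<Sum>i<N. r ^ i * mom k i))"
    proof -
      have "E k (\<lambda>t. of_real r * (\<Sum>i<N. of_real (r ^ i) * of_real t ^ i))
          = of_real r * (\<Sum>i<N. E k (\<lambda>t. of_real (r ^ i) * of_real t ^ i))"
        by (subst E.scale, intro continuous_intros, subst E.sum)
          (auto intro!: continuous_intros)
      then show ?thesis by (simp add: E.scale[OF cont_of_real_pow] E_of_real_pow)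
    qed
    finally have "r * (\<Sum>i<N. r ^ i * mom k i) \<le> Re (LiS k w) + Im (LiS k w)" by simp
    also have "\<dots> \<le> norm (LiS k w) + norm (LiS k w)"
      using abs_Re_le_cmod[of "LiS k w"] abs_Im_le_cmod[of "LiS k w"] by linarith
    finally show ?thesis by simp
  qed
  show ?thesis
  proof (cases "0 \<le> Im z")
    case True
    then show ?thesis using main[of z] z by simp
  next
    case False
    have n: "norm (1 - cnj z) = norm (1 - z)" by (metis complex_cnj_diff complex_cnj_one complex_mod_cnj)
    have "1 / 2 * (r * (\<Sum>i<N. r ^ i * mom k i)) \<le> norm (LiS k (cnj z))"
    proof (rule main[of "cnj z"])
      show "cnj z \<noteq> 1" using z(2) by (metis complex_cnj_cnj complex_cnj_one)
    qed (use z False n in auto)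
    then show ?thesis using LiS_cnj circle_slit[OF z] by simp
  qed
qed

text \<open>On the positive axis \<open>r\<close> is 1 and the bound becomes a partial sum of
  moments, so one formula holds on all approaches to the slit.\<close>

lemma eta_disc_lower_bound:
  assumes u: "u \<in> cut_disc"
  defines "r \<equiv> 1 / (1 + norm (1 - sgn u))"
  shows "1 / 2 * (r * (\<Sum>i<N. r ^ i * mom (index_of (norm u)) i)) \<le> norm (eta_disc u)"
proof -
  have u': "u \<noteq> 0" "norm u \<le> 1" "sgn u = 1 \<longrightarrow> norm u < 1 / 2" using u by (auto simp: cut_disc_iff)
  have k: "index_of (norm u) \<in> That" "beta (index_of (norm u)) = norm u" using index_of[of "norm u"] u' by auto
  show ?thesis
  proof (cases "sgn u = 1")
    case True
    then have sm: "summable (mom (index_of (norm u)))" using summable_mom k u' by simp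
    have "(\<Sum>i<N. mom (index_of (norm u)) i) \<le> (\<Sum>i. mom (index_of (norm u)) i)"
      by (rule sum_le_suminf[OF sm]) (auto simp: mom_bounds)
    moreover have "0 \<le> (\<Sum>i<N. mom (index_of (norm u)) i)" by (intro sum_nonneg mom_bounds)
    ultimately show ?thesis using True eta_disc_eq[OF u] by (simp add: r_def)
  next
    case False
    then show ?thesis
      using LiS_lower_bound[OF k(1) _ False, of N] u' eta_disc_eq[OF u] by (simp add: r_def norm_sgn)
  qed
qed

section \<open>Properness and the homeomorphism\<close>

text \<open>Every moment of positive order is at most the first one, which is beta, here the modulus
  of the point. Only the constant term survives in the limit.\<close>

lemma eta_disc_tendsto_0:
  assumes c: "\<And>n. c n \<in> cut_disc" "c \<longlonglongrightarrow> 0"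
  shows "(\<lambda>n. eta_disc (c n)) \<longlonglongrightarrow> 1"
proof -
  define a where "a = (\<lambda>i n. sgn (c n) ^ i * complex_of_real (mom (index_of (norm (c n))) i))"
  have c0: "c n \<noteq> 0" "norm (c n) \<le> 1" for n using c(1)[of n] by (auto simp: cut_disc_iff)
  have k: "index_of (norm (c n)) \<in> That" "beta (index_of (norm (c n))) = norm (c n)" for n
    using index_of[of "norm (c n)"] c0[of n] by auto
  define x where "x = beta (two_ones_two 0)"
  have x: "0 < x" "x < 1 / 2" by (simp_all add: x_def beta_two_ones_two)
  have ev: "\<forall>\<^sub>F n in sequentially. norm (c n) < x"
    using tendstoD[OF c(2) x(1)] by simp
  have norm_a: "norm (a i n) = mom (index_of (norm (c n))) i" for i n
    using c0 mom_bounds(1) by (simp add: a_def norm_mult norm_power norm_sgn)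
  have "(\<lambda>n. \<Sum>i. a i n) \<longlonglongrightarrow> (\<Sum>i. if i = 0 then 1 else 0)"
  proof (rule tannerys_theorem[THEN conjunct2, THEN conjunct2])
    show "(\<lambda>n. a i n) \<longlonglongrightarrow> (if i = 0 then 1 else 0)" for i
    proof (cases "i = 0")
      case False
      have "norm (a i n) \<le> norm (c n)" for n
      proof -
        have "Re (E (index_of (norm (c n))) (\<lambda>t. of_real t ^ i)) \<le> Re (E (index_of (norm (c n))) (\<lambda>t. of_real t ^ 1))"
        proof (rule E.mono[OF cont_of_real_pow cont_of_real_pow])
          fix t :: real assume t: "t \<in> {0..1}"
          then have "t ^ i \<le> t ^ 1" using False by (intro power_decreasing) auto
          then show "Re (complex_of_real t ^ i) \<le> Re (complex_of_real t ^ 1)" by (simp flip: of_real_power)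
        qed
        then show ?thesis unfolding norm_a using k(2)[of n] mom_1[OF k(1)[of n]] by (simp add: mom_def)
      qed
      then show ?thesis
        using False tendsto_norm_zero[OF c(2)] by (auto intro!: Lim_null_comparison[of _ "\<lambda>n. norm (c n)"])
    qed (simp add: a_def)
    show "summable (mom (two_ones_two 0))" by (rule summable_mom_two_ones_two)
    have "\<forall>\<^sub>F n in sequentially. \<forall>i. norm (a i n) \<le> mom (two_ones_two 0) i"
      using ev
    proof eventually_elim
      case (elim n)
      then show ?case
        unfolding norm_a using mom_mono[OF k(1) two_ones_two_That, of n 0] k(2)[of n] by (simp add: x_def)
    qed
    then show "\<forall>\<^sub>F (i, n) in sequentially \<times>\<^sub>F sequentially. norm (a i n) \<le> mom (two_ones_two 0) i"
      unfolding eventually_prod_filter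
      by (intro exI[of _ "\<lambda>_. True"] exI[of _ "\<lambda>n. \<forall>i. norm (a i n) \<le> mom (two_ones_two 0) i"]) auto
  qed simp
  moreover have "(\<Sum>i. if i = 0 then 1 else 0 :: complex) = 1"
    using suminf_finite[of "{0}" "\<lambda>i. if i = 0 then 1 else 0 :: complex"] by simp
  moreover have "\<forall>\<^sub>F n in sequentially. (\<Sum>i. a i n) = eta_disc (c n)"
    using ev
  proof eventually_elim
    case (elim n)
    then show ?case using eta_disc_series[OF c0(1)[of n]] x by (simp add: a_def)
  qed
  ultimately show ?thesis using Lim_transform_eventually by fastforce
qed

lemma harmonic_unbounded: "\<exists>N. B < (\<Sum>i<N. 1 / real (Suc i))"
proof (rule ccontr)
  assume "\<not> ?thesis"
  then have "summable (\<lambda>i. 1 / real (Suc i))"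
    by (intro bounded_imp_summable[where B = B]) (auto simp: not_less lessThan_Suc_atMost[symmetric] simp del: sum.lessThan_Suc of_nat_Suc)
  then have "summable (\<lambda>i. inverse (real (Suc i)))" by (simp add: inverse_eq_divide del: of_nat_Suc)
  then show False
    using not_summable_harmonic[where 'a = real] summable_Suc_iff[of "\<lambda>i. inverse (real i)"] by simp
qed

text \<open>The comparison index (2,1,1,...) has beta 1/2 and moments 1/(n+1): one digit 0 in front
  of the point mass at 1.\<close>

lemma mom_half:
  assumes "0 < x" "1 / 2 \<le> x" "x \<le> 1"
  shows "1 / real (Suc n) \<le> mom (index_of x) n"
proof -
  define e where "e = (\<lambda>i::nat. if i = 0 then 2 else 1 :: nat)"
  have e: "e \<in> That" by (auto simp: That_def e_def)
  have "shift e = (\<lambda>i. 1)" by (auto simp: shift_def e_def)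
  then have b: "beta e = 1 / 2" using beta_rec[OF e] beta_ones by (simp add: e_def)
  have "e(0 := 1) = (\<lambda>i. 1)" by (auto simp: e_def)
  then have "mom e n = 1 / real (Suc n)" using mom_M0[of e n] mom_ones by (simp add: e_def)
  then show ?thesis using mom_mono[OF e, of "index_of x" n] index_of[of x] assms b by simp
qed

text \<open>Near the slit \<open>[1/2, 1]\<close> the function \<open>eta_disc\<close> dominates partial sums of the harmonic series.\<close>

lemma eta_disc_proper:
  assumes c: "\<And>n. c n \<in> cut_disc" and lim: "(\<lambda>n. eta_disc (c n)) \<longlonglongrightarrow> w" and w: "w \<noteq> 1"
  obtains l where "l \<in> cut_disc" "eta_disc l = w" "\<And>C. closed C \<Longrightarrow> (\<And>n. c n \<in> C) \<Longrightarrow> l \<in> C"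
proof -
  have "c n \<in> cball 0 1" for n using c by (simp add: cut_disc_iff)
  then obtain l r where r: "strict_mono (r :: nat \<Rightarrow> nat)" "(c \<circ> r) \<longlonglongrightarrow> l" and l: "l \<in> cball 0 1"
    using compact_cball[of "0::complex" 1, unfolded compact_def] by blast
  have cr: "(\<lambda>n. c (r n)) \<longlonglongrightarrow> l" using r by (simp add: o_def)
  have Gr: "(\<lambda>n. eta_disc (c (r n))) \<longlonglongrightarrow> w" using LIMSEQ_subseq_LIMSEQ[OF lim r(1)] by (simp add: o_def)
  have l0: "l \<noteq> 0"
  proof
    assume "l = 0"
    then have "(\<lambda>n. eta_disc (c (r n))) \<longlonglongrightarrow> 1" using eta_disc_tendsto_0[of "\<lambda>n. c (r n)"] c cr by simp
    then show False using LIMSEQ_unique[OF Gr] w by simp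
  qed
  have "l \<in> cut_disc"
  proof (rule ccontr)
    assume "l \<notin> cut_disc"
    then have sl: "sgn l = 1" and nl: "1 / 2 \<le> norm l" using l l0 by (auto simp: cut_disc_iff)
    have bound: "1 / 2 * (\<Sum>i<N. 1 / real (Suc i)) \<le> norm w" for N
    proof -
      define \<rho> where "\<rho> = (\<lambda>n. 1 / (1 + norm (1 - sgn (c (r n)))))"
      have sg: "(\<lambda>n. sgn (c (r n))) \<longlonglongrightarrow> sgn l" using cr l0 by (intro tendsto_intros)
      have "\<rho> \<longlonglongrightarrow> 1 / (1 + norm (1 - sgn l))"
        unfolding \<rho>_def
        by (intro tendsto_divide tendsto_add tendsto_const tendsto_norm tendsto_diff sg) (simp add: sl)
      then have \<rho>: "\<rho> \<longlonglongrightarrow> 1" by (simp add: sl)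
      have "(\<lambda>n. norm (c (r n))) \<longlonglongrightarrow> norm l" using cr by (rule tendsto_norm)
      then have m: "(\<lambda>n. mom (index_of (norm (c (r n)))) i) \<longlonglongrightarrow> mom (index_of (norm l)) i" for i
        using c l l0 by (intro continuous_on_tendsto_compose[OF continuous_on_mom_index_of[of i]])
          (auto simp: cut_disc_iff)
      have "(\<lambda>n. 1 / 2 * (\<rho> n * (\<Sum>i<N. \<rho> n ^ i * mom (index_of (norm (c (r n)))) i)))
          \<longlonglongrightarrow> 1 / 2 * (1 * (\<Sum>i<N. 1 ^ i * mom (index_of (norm l)) i))"
        by (intro tendsto_intros \<rho> m)
      then have "1 / 2 * (1 * (\<Sum>i<N. 1 ^ i * mom (index_of (norm l)) i)) \<le> norm w"
        by (rule LIMSEQ_le[OF _ tendsto_norm[OF Gr]])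
          (use eta_disc_lower_bound[OF c] in \<open>auto simp: \<rho>_def\<close>)
      moreover have "(\<Sum>i<N. 1 / real (Suc i)) \<le> (\<Sum>i<N. mom (index_of (norm l)) i)"
        using mom_half[of "norm l"] l l0 nl by (intro sum_mono) auto
      ultimately show ?thesis by simp
    qed
    obtain N where "2 * norm w < (\<Sum>i<N. 1 / real (Suc i))" using harmonic_unbounded by blast
    then show False using bound[of N] by simp
  qed
  moreover have "(\<lambda>n. eta_disc (c (r n))) \<longlonglongrightarrow> eta_disc l"
    using continuous_on_tendsto_compose[OF continuous_on_eta_disc cr] calculation c by simp
  then have "eta_disc l = w" using LIMSEQ_unique Gr by blast
  \<comment> \<open>Recording the closed sets that contain the sequence lets the same compactness
    argument show that images of closed sets are closed.\<close>
  moreover have "l \<in> C" if "closed C" "\<And>n. c n \<in> C" for C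
    using closed_sequentially[OF that(1) _ cr] that(2) by blast
  ultimately show ?thesis using that by blast
qed

section \<open>Surjectivity and continuity of the inverse\<close>

lemma open_cut_disc_interior: "open (cut_disc \<inter> ball 0 1)"
proof -
  have "cut_disc \<inter> ball 0 1 = ball 0 1 - ({0} \<union> complex_of_real ` {1/2..1})"
    by (auto simp: cut_disc_def)
  moreover have "compact (complex_of_real ` {1/2..1})"
    by (intro compact_continuous_image continuous_intros) auto
  ultimately show ?thesis by (auto intro!: open_Diff closed_Un compact_imp_closed)
qed

text \<open>The image is clopen in a half plane with one point deleted, which is connected. The open
  disc is treated separately because invariance of domain requires an open source; the unit circle
  has explicit values.\<close>

lemma eta_disc_image_interior: "eta_disc ` (cut_disc \<inter> ball 0 1) = {w. 1 / 2 < Re w} - {1}"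
proof -
  define S where "S = {w. 1 / 2 < Re w} - {1}"
  define D where "D = cut_disc \<inter> ball 0 1"
  have sub: "eta_disc ` D \<subseteq> S" using eta_disc_inner by (auto simp: D_def S_def)
  have conn: "connected S"
    unfolding S_def by (intro connected_open_delete open_halfspace_Re_gt convex_connected convex_halfspace_Re_gt) simp
  have "open (eta_disc ` D)"
    unfolding D_def
    by (rule invariance_of_domain[OF continuous_on_subset[OF continuous_on_eta_disc]
          open_cut_disc_interior inj_on_subset[OF inj_on_eta_disc]]) auto
  then have op: "openin (top_of_set S) (eta_disc ` D)" using sub by (simp add: open_subset)
  have cl: "closedin (top_of_set S) (eta_disc ` D)"
    unfolding closedin_limpt
  proof (intro conjI sub allI impI)
    fix w assume w: "w islimpt eta_disc ` D \<and> w \<in> S"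
    then obtain f where f: "\<And>n. f n \<in> eta_disc ` D - {w}" "f \<longlonglongrightarrow> w" unfolding islimpt_sequential by blast
    then have "\<forall>n. \<exists>u\<in>D. f n = eta_disc u" by blast
    then obtain c where c: "\<And>n. c n \<in> D" "\<And>n. f n = eta_disc (c n)" by metis
    have "c n \<in> cut_disc" for n using c(1) by (simp add: D_def)
    moreover have "(\<lambda>n. eta_disc (c n)) \<longlonglongrightarrow> w" using f(2) unfolding c(2) .
    moreover have "w \<noteq> 1" using w by (simp add: S_def)
    ultimately obtain l where l: "l \<in> cut_disc" "eta_disc l = w" using eta_disc_proper by blast
    \<comment> \<open>The unit circle is sent to the line Re w = 1/2, which the limit point
      avoids.\<close>
    have "norm l \<noteq> 1" using eta_disc_outer[OF l(1)] Re_inv_circle[of l] l w by (auto simp: S_def)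
    then show "w \<in> eta_disc ` D" using l by (auto simp: D_def cut_disc_iff)
  qed
  have ne: "- 1 / 2 \<in> D"
    by (auto simp: D_def cut_disc_iff sgn_div_norm scaleR_conv_of_real complex_eq_iff)
  have "eta_disc ` D = {} \<or> eta_disc ` D = S"
    using conn[unfolded connected_clopen, rule_format, of "eta_disc ` D"] op cl by simp
  with ne have "eta_disc ` D = S" by blast
  then show ?thesis by (simp add: D_def S_def)
qed

lemma eta_disc_image: "eta_disc ` cut_disc = Hplane - {1}"
proof
  show "eta_disc ` cut_disc \<subseteq> Hplane - {1}" by (rule image_subsetI[OF eta_disc_in_Hplane])
  show "Hplane - {1} \<subseteq> eta_disc ` cut_disc"
  proof
    fix w assume w: "w \<in> Hplane - {1}"
    show "w \<in> eta_disc ` cut_disc"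
    proof (cases "Re w = 1 / 2")
      case False
      then have "w \<in> eta_disc ` (cut_disc \<inter> ball 0 1)" unfolding eta_disc_image_interior using w by (auto simp: Hplane_def)
      then show ?thesis by blast
    next
      case True
      \<comment> \<open>The inverse of 1/(1 - u), the value on the unit circle; points of the line
        are equidistant from 0 and 1, which gives \<open>u\<close> modulus 1.\<close>
      define u where "u = 1 - 1 / w"
      have w0: "w \<noteq> 0" using True by auto
      have "norm (w - 1) = norm w"
      proof -
        have "(Re w - 1)\<^sup>2 = (Re w)\<^sup>2" unfolding True by (simp add: power2_eq_square)
        then show ?thesis by (simp add: cmod_def)
      qed
      moreover have "u = (w - 1) / w" using w0 by (simp add: u_def field_simps)
      ultimately have nu: "norm u = 1" using w0 by (simp add: norm_divide)
      then have "sgn u = u" by (simp add: sgn_eq)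
      moreover have "u \<noteq> 1" using w0 by (simp add: u_def)
      ultimately have u: "u \<in> cut_disc" using nu by (auto simp: cut_disc_iff)
      have "eta_disc u = w" using eta_disc_outer[OF u nu] w0 by (simp add: u_def)
      then show ?thesis using u by blast
    qed
  qed
qed

text \<open>A limit point of the image of a relatively closed set lifts, by
  \<open>eta_disc_proper\<close>, to a point of that set, so the bijection is closed and its inverse
  continuous, including at the boundary where invariance of domain says nothing.\<close>

lemma homeomorphic_map_eta_disc: "homeomorphic_map (top_of_set cut_disc) (top_of_set (Hplane - {1})) eta_disc"
proof (rule bijective_closed_imp_homeomorphic_map)
  show "continuous_map (top_of_set cut_disc) (top_of_set (Hplane - {1})) eta_disc"
    using continuous_on_eta_disc eta_disc_in_Hplane by (auto simp: continuous_map_in_subtopology)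
  show "closed_map (top_of_set cut_disc) (top_of_set (Hplane - {1})) eta_disc"
    unfolding closed_map_def
  proof (intro allI impI)
    fix C assume "closedin (top_of_set cut_disc) C"
    then obtain K where K: "closed K" "C = cut_disc \<inter> K" by (auto simp: closedin_closed)
    show "closedin (top_of_set (Hplane - {1})) (eta_disc ` C)"
      unfolding closedin_limpt
    proof (intro conjI allI impI)
      show "eta_disc ` C \<subseteq> Hplane - {1}" using eta_disc_in_Hplane K by auto
      fix w assume w: "w islimpt eta_disc ` C \<and> w \<in> Hplane - {1}"
      then obtain f where f: "\<And>n. f n \<in> eta_disc ` C - {w}" "f \<longlonglongrightarrow> w" unfolding islimpt_sequential by blast
      then have "\<forall>n. \<exists>u\<in>C. f n = eta_disc u" by blast
      then obtain c where c: "\<And>n. c n \<in> C" "\<And>n. f n = eta_disc (c n)" by metis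
      have cD: "\<And>n. c n \<in> cut_disc" using c(1) K by blast
      have cl: "(\<lambda>n. eta_disc (c n)) \<longlonglongrightarrow> w" using f(2) unfolding c(2) .
      have w1: "w \<noteq> 1" using w by simp
      obtain l where l: "l \<in> cut_disc" "eta_disc l = w" "\<And>C. closed C \<Longrightarrow> (\<And>n. c n \<in> C) \<Longrightarrow> l \<in> C"
        using eta_disc_proper[OF cD cl w1] by blast
      have "l \<in> K" using l(3)[OF K(1)] c K by blast
      then show "w \<in> eta_disc ` C" using l K by blast
    qed
  qed
  show "eta_disc ` topspace (top_of_set cut_disc) = topspace (top_of_set (Hplane - {1}))"
    using eta_disc_image by simp
  show "inj_on eta_disc (topspace (top_of_set cut_disc))" using inj_on_eta_disc by simp
qed

theorem theorem1p2:
  "(\<forall>p\<in>ST. eta_S_defined p) \<and>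
   bij_betw eta_S ST (Hplane - {1}) \<and>
   homeomorphic_map ST_topology (top_of_set cut_disc) tau_S \<and>
   homeomorphic_map (top_of_set cut_disc) (top_of_set (Hplane - {1}))
     (eta_S \<circ> the_inv_into ST tau_S)"
proof (intro conjI ballI eta_S_defined_ST homeomorphic_map_tau_S)
  have "eta_S ` ST = eta_disc ` cut_disc"
    using tau_S_facts(1,4) polar_inv_facts(1) by (force simp: eta_disc_def)
  then show "bij_betw eta_S ST (Hplane - {1})"
    using inj_on_eta_S eta_disc_image by (simp add: bij_betw_def)
  show "homeomorphic_map (top_of_set cut_disc) (top_of_set (Hplane - {1})) (eta_S \<circ> the_inv_into ST tau_S)"
    by (rule homeomorphic_map_eq[OF homeomorphic_map_eta_disc]) (simp add: the_inv_tau_S eta_disc_def)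
qed

end
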